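(* Let $m,n\geq 1$ be integers and let $\mathcal{A},\mathcal{B}\in\mathrm{T}^m(\mathbb{C}^n)$. (i) If $R_J(\mathcal{B})\neq 0$ for each $\emptyset\neq J\subseteq\{1,\ldots,n\}$, then $(\mathcal{A},\mathcal{B})$ has at most $n\,m^{n-1}$ CB-eigenvalues. (ii) If $\mathcal{A},\mathcal{B}$ are generic tensors in $\mathrm{T}^m(\mathbb{C}^n)$, then for each CB-eigenvalue of $(\mathcal{A},\mathcal{B})$ there is a unique associated CB-eigenvector, up to scaling.
   Context: $\mathrm{T}^m(\mathbb{C}^n)$ is the space of $m$-th order $n$-dimensional complex tensors $\mathcal{F}=(\mathcal{F}_{i_1,\ldots,i_m})_{1\le i_1,\ldots,i_m\le n}$ (not necessarily symmetric). For $x\in\mathbb{C}^n$, $\mathcal{F}x^{m-1}\in\mathbb{C}^n$ has entries $(\mathcal{F}x^{m-1})_i=\sum_{i_2,\ldots,i_m=1}^n \mathcal{F}_{i,i_2,\ldots,i_m}x_{i_2}\cdots x_{i_m}$. The symbol $\circ$ denotes the Hadamard (entrywise) product of vectors. If $\lambda\in\mathbb{C}$ and $x\in\mathbb{C}^n\setminus\{0\}$ satisfy $x\circ(\mathcal{A}x^{m-1}-\lambda\mathcal{B}x^{m-1})=0$, then $\lambda$ is called a combinatorial eigenvalue (CB-eigenvalue) of $(\mathcal{A},\mathcal{B})$ and $x$ an associated combinatorial eigenvector (CB-eigenvector). For $\emptyset\ne J\subseteq\{1,\ldots,n\}$, let $x_J=(x_j)_{j\in J}$ and let $\mathcal{F}_J$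 be the principal sub-tensor of $\mathcal{F}$ with all indices in $J$; $\mathcal{F}_J(x_J)^{m-1}$ is the vector indexed by $j\in J$ with entries $\sum_{i_2,\ldots,i_m\in J}\mathcal{F}_{j,i_2,\ldots,i_m}x_{i_2}\cdots x_{i_m}$. $R_J(\mathcal{F})$ denotes the resultant of the tuple of $|J|$ homogeneous polynomials $\mathcal{F}_J(x_J)^{m-1}$ in the $|J|$ variables $x_J$; in particular $R_J(\mathcal{F})=0$ if and only if $\mathcal{F}_J(x_J)^{m-1}=0$ has a nonzero solution $x_J\in\mathbb{C}^{|J|}$. A property holds for generic $\mathcal{A},\mathcal{B}$ if it holds for all pairs $(\mathcal{A},\mathcal{B})$ in an open dense subset, in the Zariski topology, of the space of pairs $\mathrm{T}^m(\mathbb{C}^n)\times\mathrm{T}^m(\mathbb{C}^n)$. *)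

theory Defs
  imports
    "HOL-Analysis.Analysis"
    "HOL-Library.Poly_Mapping"
    "HOL-Computational_Algebra.Factorial_Ring"
begin

section \<open>Multivariate polynomials\<close>

text \<open>
  A polynomial in variables of type \<open>'v\<close> is a finitely supported map from exponent vectors
  \<open>'v \<Rightarrow>\<^sub>0 nat\<close> to coefficients; the ring structure is the convolution product of Poly\_Mapping.
\<close>

type_synonym ('v, 'a) mpoly = "('v \<Rightarrow>\<^sub>0 nat) \<Rightarrow>\<^sub>0 'a"

definition monom_eval :: "('v \<Rightarrow> 'a) \<Rightarrow> ('v \<Rightarrow>\<^sub>0 nat) \<Rightarrow> 'a::comm_semiring_1" where
  "monom_eval x t = (\<Prod>v\<in>Poly_Mapping.keys t. x v ^ Poly_Mapping.lookup t v)"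

definition mpoly_eval :: "('v \<Rightarrow> 'a) \<Rightarrow> ('v, 'a) mpoly \<Rightarrow> 'a::comm_semiring_1" where
  "mpoly_eval x p = (\<Sum>t\<in>Poly_Mapping.keys p. Poly_Mapping.lookup p t * monom_eval x t)"

definition mpoly_vars :: "('v, 'a::zero) mpoly \<Rightarrow> 'v set" where
  "mpoly_vars p = (\<Union>t\<in>Poly_Mapping.keys p. Poly_Mapping.keys t)"

lemma monom_eval_superset:
  assumes "finite S" "Poly_Mapping.keys t \<subseteq> S"
  shows "monom_eval x t = (\<Prod>v\<in>S. x v ^ Poly_Mapping.lookup t v)"
  unfolding monom_eval_def
  using assms by (intro prod.mono_neutral_left) (auto simp: in_keys_iff)

lemma monom_eval_add: "monom_eval x (s + t) = monom_eval x s * monom_eval x t"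
proof -
  let ?S = "Poly_Mapping.keys s \<union> Poly_Mapping.keys t"
  have "monom_eval x (s + t) = (\<Prod>v\<in>?S. x v ^ Poly_Mapping.lookup (s + t) v)"
    using keys_add[of s t] by (intro monom_eval_superset) auto
  also have "\<dots> = (\<Prod>v\<in>?S. x v ^ Poly_Mapping.lookup s v) * (\<Prod>v\<in>?S. x v ^ Poly_Mapping.lookup t v)"
    by (simp add: lookup_add power_add prod.distrib)
  also have "\<dots> = monom_eval x s * monom_eval x t"
    using monom_eval_superset[of ?S s x] monom_eval_superset[of ?S t x] by simp
  finally show ?thesis .
qed

lemma monom_eval_zero [simp]: "monom_eval x 0 = 1"
  by (simp add: monom_eval_def)

lemma mpoly_eval_superset:
  assumes "finite S" "Poly_Mapping.keys p \<subseteq> S"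
  shows "mpoly_eval x p = (\<Sum>t\<in>S. Poly_Mapping.lookup p t * monom_eval x t)"
  unfolding mpoly_eval_def
  using assms by (intro sum.mono_neutral_left) (auto simp: in_keys_iff)

lemma mpoly_eval_zero [simp]: "mpoly_eval x 0 = 0"
  by (simp add: mpoly_eval_def)

lemma mpoly_eval_single: "mpoly_eval x (Poly_Mapping.single t c) = c * monom_eval x t"
  by (simp add: mpoly_eval_def)

lemma mpoly_eval_one [simp]: "mpoly_eval x 1 = 1"
  by (simp add: mpoly_eval_def)

lemma mpoly_eval_add: "mpoly_eval x (p + q) = mpoly_eval x p + mpoly_eval x q"
proof -
  let ?S = "Poly_Mapping.keys p \<union> Poly_Mapping.keys q"
  have "mpoly_eval x (p + q) = (\<Sum>t\<in>?S. Poly_Mapping.lookup (p + q) t * monom_eval x t)"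
    using keys_add[of p q] by (intro mpoly_eval_superset) auto
  then show ?thesis
    using mpoly_eval_superset[of ?S p x] mpoly_eval_superset[of ?S q x]
    by (simp add: lookup_add distrib_right sum.distrib)
qed

lemma mpoly_eval_sum: "mpoly_eval x (sum f A) = (\<Sum>a\<in>A. mpoly_eval x (f a))"
  by (induction A rule: infinite_finite_induct) (auto simp: mpoly_eval_add)

lemma mpoly_as_sum:
  "p = (\<Sum>t\<in>Poly_Mapping.keys p. Poly_Mapping.single t (Poly_Mapping.lookup p t))"
proof (rule poly_mapping_eqI)
  fix k
  have "(\<Sum>t\<in>Poly_Mapping.keys p. Poly_Mapping.lookup p t when t = k) = Poly_Mapping.lookup p k"
    by (cases "k \<in> Poly_Mapping.keys p") (auto simp: when_def in_keys_iff)
  then show "Poly_Mapping.lookup p k =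
      Poly_Mapping.lookup (\<Sum>t\<in>Poly_Mapping.keys p. Poly_Mapping.single t (Poly_Mapping.lookup p t)) k"
    by (simp add: lookup_sum lookup_single)
qed

lemma mpoly_eval_mult: "mpoly_eval x (p * q) = mpoly_eval x p * mpoly_eval x q"
proof -
  have "p * q = (\<Sum>s\<in>Poly_Mapping.keys p. \<Sum>t\<in>Poly_Mapping.keys q.
      Poly_Mapping.single (s + t) (Poly_Mapping.lookup p s * Poly_Mapping.lookup q t))"
    by (subst (1) mpoly_as_sum[of p], subst (1) mpoly_as_sum[of q])
       (simp add: sum_product mult_single)
  then show ?thesis
    by (simp add: mpoly_eval_sum mpoly_eval_single monom_eval_add)
       (simp add: mpoly_eval_def sum_product mult_ac)
qed


section \<open>The resultant of homogeneous polynomials of equal degree\<close>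

definition monomials :: "'v set \<Rightarrow> nat \<Rightarrow> ('v \<Rightarrow>\<^sub>0 nat) set" where
  "monomials J d = {t. Poly_Mapping.keys t \<subseteq> J \<and>
     (\<Sum>v\<in>Poly_Mapping.keys t. Poly_Mapping.lookup t v) = d}"

definition homogeneous :: "'v set \<Rightarrow> nat \<Rightarrow> ('v, 'a::zero) mpoly \<Rightarrow> bool" where
  "homogeneous J d p \<longleftrightarrow> Poly_Mapping.keys p \<subseteq> monomials J d"

text \<open>
  Vectors in \<open>\<complex>\<^bsup>J\<^esup>\<close> are functions of which only the values on \<open>J\<close> matter.
\<close>

definition has_nonzero_root :: "'v set \<Rightarrow> ('v \<Rightarrow> ('v, complex) mpoly) \<Rightarrow> bool" where
  "has_nonzero_root J f \<longleftrightarrow>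
     (\<exists>x. (\<exists>j\<in>J. x j \<noteq> 0) \<and> (\<forall>j\<in>J. mpoly_eval x (f j) = 0))"

text \<open>
  A polynomial in the coefficients of a tuple \<open>f\<close> has one variable \<open>(j, t)\<close> for the coefficient
  of \<open>f j\<close> at the monomial \<open>t\<close>.
\<close>

definition eval_at_coeffs ::
    "('v \<times> ('v \<Rightarrow>\<^sub>0 nat), int) mpoly \<Rightarrow> ('v \<Rightarrow> ('v, complex) mpoly) \<Rightarrow> complex" where
  "eval_at_coeffs R f =
     mpoly_eval (\<lambda>(j, t). Poly_Mapping.lookup (f j) t) (Poly_Mapping.map of_int R)"

text \<open>
  The resultant of \<open>|J|\<close> forms of degree \<open>d\<close> in the variables \<open>x\<^sub>j\<close>, \<open>j \<in> J\<close>, is the integer polynomial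
  in their coefficients that vanishes exactly when the forms have a nonzero common root, is
  irreducible over \<open>\<complex>\<close>, and takes the value 1 at the powers \<open>x\<^sub>j\<^sup>d\<close>.  (Cox, Little, O'Shea,
  Using Algebraic Geometry, Chapter 3, Theorem 2.3: for \<open>d \<ge> 1\<close> there is exactly one.)
\<close>

definition is_resultant_poly ::
    "'v set \<Rightarrow> nat \<Rightarrow> ('v \<times> ('v \<Rightarrow>\<^sub>0 nat), int) mpoly \<Rightarrow> bool" where
  "is_resultant_poly J d R \<longleftrightarrow>
     mpoly_vars R \<subseteq> J \<times> monomials J d \<and>
     irreducible (Poly_Mapping.map of_int R :: ('v \<times> ('v \<Rightarrow>\<^sub>0 nat), complex) mpoly) \<and>
     (\<forall>f. (\<forall>j\<in>J. homogeneous J d (f j)) \<longrightarrow> (eval_at_coeffs R f = 0 \<longleftrightarrow> has_nonzero_root J f)) \<and>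
     eval_at_coeffs R (\<lambda>j. Poly_Mapping.single (Poly_Mapping.single j d) 1) = 1"

text \<open>
  For \<open>d \<ge> 1\<close> and nonempty finite \<open>J\<close> the first branch is the one taken, and the choice is unique,
  by the theorem cited above.  For \<open>d = 0\<close> (tensors of order 1) and \<open>|J| \<ge> 2\<close> no such polynomial
  exists: a tuple of constants has a nonzero common root iff all the constants vanish, which is not
  one polynomial condition.  The last branch keeps the property that the resultant vanishes iff there is
  a nonzero common root in that case too.
\<close>

definition resultant :: "'v set \<Rightarrow> nat \<Rightarrow> ('v \<Rightarrow> ('v, complex) mpoly) \<Rightarrow> complex" where
  "resultant J d f =
     (if \<exists>R. is_resultant_poly J d R
      then eval_at_coeffs (SOME R. is_resultant_poly J d R) f
      else if has_nonzero_root J f then 0 else 1)"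


section \<open>Tensors and combinatorial eigenvalues\<close>

text \<open>
  The index set \<open>{1,\<dots>,n}\<close> is a finite type \<open>'n\<close> with \<open>n = CARD('n)\<close>.  A tensor of order \<open>m\<close> is a
  function on index lists of length \<open>m\<close>, extended by \<open>undefined\<close> to other lists.
\<close>

type_synonym 'n tensor = "'n list \<Rightarrow> complex"

definition index_tuples :: "nat \<Rightarrow> 'n list set" where
  "index_tuples m = {is. length is = m}"

definition tensors :: "nat \<Rightarrow> 'n tensor set" where
  "tensors m = index_tuples m \<rightarrow>\<^sub>E UNIV"

definition tensor_apply :: "nat \<Rightarrow> 'n::finite tensor \<Rightarrow> complex ^ 'n \<Rightarrow> complex ^ 'n" where
  "tensor_apply m F x =
     (\<chi> i. \<Sum>is\<in>index_tuples (m - 1). F (i # is) * prod_list (map (\<lambda>k. x $ k) is))"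

text \<open>The product \<open>*\<close> of vectors is the entrywise one.\<close>

definition cb_eigenvector ::
    "nat \<Rightarrow> 'n::finite tensor \<Rightarrow> 'n tensor \<Rightarrow> complex \<Rightarrow> complex ^ 'n \<Rightarrow> bool" where
  "cb_eigenvector m A B lam x \<longleftrightarrow>
     x \<noteq> 0 \<and> x * (tensor_apply m A x - lam *s tensor_apply m B x) = 0"

definition cb_eigenvalue :: "nat \<Rightarrow> 'n::finite tensor \<Rightarrow> 'n tensor \<Rightarrow> complex \<Rightarrow> bool" where
  "cb_eigenvalue m A B lam \<longleftrightarrow> (\<exists>x. cb_eigenvector m A B lam x)"

text \<open>The entry \<open>j\<close> of \<open>F\<^sub>J(x\<^sub>J)\<^bsup>m-1\<^esup>\<close> as a polynomial in \<open>x\<^sub>J\<close>.\<close>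

definition subtensor_form :: "nat \<Rightarrow> 'n tensor \<Rightarrow> 'n set \<Rightarrow> 'n \<Rightarrow> ('n, complex) mpoly" where
  "subtensor_form m F J j =
     (\<Sum>is | is \<in> index_tuples (m - 1) \<and> set is \<subseteq> J.
        Poly_Mapping.single (sum_list (map (\<lambda>i. Poly_Mapping.single i 1) is)) (F (j # is)))"

lemma mpoly_eval_subtensor_form:
  "mpoly_eval x (subtensor_form m F J j) =
     (\<Sum>is | is \<in> index_tuples (m - 1) \<and> set is \<subseteq> J. F (j # is) * prod_list (map x is))"
proof -
  have "monom_eval x (sum_list (map (\<lambda>i. Poly_Mapping.single i 1) is)) = prod_list (map x is)" for "is"
    by (induction "is") (auto simp: monom_eval_add, simp add: monom_eval_def)
  then show ?thesis
    by (simp add: subtensor_form_def mpoly_eval_sum mpoly_eval_single)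
qed

definition R_sub :: "nat \<Rightarrow> 'n set \<Rightarrow> 'n tensor \<Rightarrow> complex" where
  "R_sub m J F = resultant J (m - 1) (subtensor_form m F J)"


section \<open>Zariski topology and genericity\<close>

definition affine_space :: "'i set \<Rightarrow> ('i \<Rightarrow> complex) set" where
  "affine_space I = I \<rightarrow>\<^sub>E UNIV"

text \<open>
  The Zariski open sets are the complements of common zero loci of sets of polynomials.  Variables
  outside \<open>I\<close> need not be excluded, because they are constant on the affine space.
\<close>

definition zariski_open :: "'i set \<Rightarrow> ('i \<Rightarrow> complex) set \<Rightarrow> bool" where
  "zariski_open I U \<longleftrightarrow>
     (\<exists>P :: ('i, complex) mpoly set. U = affine_space I - {x. \<forall>p\<in>P. mpoly_eval x p = 0})"

definition zariski_topology :: "'i set \<Rightarrow> ('i \<Rightarrow> complex) topology" where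
  "zariski_topology I = topology (zariski_open I)"

lemma istopology_zariski_open:
  fixes I :: "'i set"
  shows "istopology (zariski_open I)"
  unfolding istopology_def
proof (intro conjI allI impI)
  fix S T
  assume "zariski_open I S" "zariski_open I T"
  then obtain P Q :: "('i, complex) mpoly set"
    where "S = affine_space I - {x. \<forall>p\<in>P. mpoly_eval x p = 0}"
      and "T = affine_space I - {x. \<forall>p\<in>Q. mpoly_eval x p = 0}"
    unfolding zariski_open_def by blast
  note ST = this
  have "S \<inter> T = affine_space I - {x. \<forall>r\<in>{p * q | p q. p \<in> P \<and> q \<in> Q}. mpoly_eval x r = 0}"
    unfolding ST
  proof (intro equalityI subsetI, goal_cases)
    case (1 x)
    then obtain p q where "x \<in> affine_space I" "p \<in> P" "q \<in> Q" "mpoly_eval x (p * q) \<noteq> 0"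
      by (auto simp: mpoly_eval_mult)
    then show ?case by blast
  next
    case (2 x)
    then obtain p q where "x \<in> affine_space I" "p \<in> P" "q \<in> Q" "mpoly_eval x (p * q) \<noteq> 0"
      by blast
    then show ?case
      using 2 by (auto simp: mpoly_eval_mult)
  qed
  then show "zariski_open I (S \<inter> T)"
    unfolding zariski_open_def by blast
next
  fix \<K>
  assume K: "\<forall>K\<in>\<K>. zariski_open I K"
  define P :: "('i, complex) mpoly set"
    where "P = {p. \<forall>x\<in>affine_space I. mpoly_eval x p \<noteq> 0 \<longrightarrow> x \<in> \<Union>\<K>}"
  have "\<Union>\<K> = affine_space I - {x. \<forall>p\<in>P. mpoly_eval x p = 0}"
  proof (intro equalityI subsetI)
    fix x assume "x \<in> \<Union>\<K>"
    then obtain S where S: "S \<in> \<K>" "x \<in> S" by blast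
    with K obtain Q :: "('i, complex) mpoly set"
      where Q: "S = affine_space I - {x. \<forall>p\<in>Q. mpoly_eval x p = 0}"
      unfolding zariski_open_def by blast
    with S obtain q where q: "q \<in> Q" "mpoly_eval x q \<noteq> 0" by blast
    have "q \<in> P"
      unfolding P_def using Q q(1) S(1) by blast
    then show "x \<in> affine_space I - {x. \<forall>p\<in>P. mpoly_eval x p = 0}"
      using q(2) Q S(2) by blast
  qed (auto simp: P_def)
  then show "zariski_open I (\<Union>\<K>)"
    unfolding zariski_open_def by blast
qed

lemma openin_zariski [simp]: "openin (zariski_topology I) = zariski_open I"
  unfolding zariski_topology_def by (rule topology_inverse'[OF istopology_zariski_open])

lemma topspace_zariski [simp]:
  fixes I :: "'i set"
  shows "topspace (zariski_topology I) = affine_space I"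
proof -
  have "affine_space I = affine_space I - {x. \<forall>p\<in>{1::('i, complex) mpoly}. mpoly_eval x p = 0}"
    by simp
  then have "zariski_open I (affine_space I)"
    unfolding zariski_open_def by blast
  moreover have "U \<subseteq> affine_space I" if "zariski_open I U" for U
    using that unfolding zariski_open_def by blast
  ultimately show ?thesis
    unfolding topspace_def by auto
qed

text \<open>
  A pair of tensors of order \<open>m\<close> is the point \<open>case_sum A B\<close> of the affine space whose coordinates
  are two disjoint copies of the index tuples of length \<open>m\<close>.
\<close>

lemma bij_betw_tensor_pairs:
  "bij_betw (\<lambda>(A, B). case_sum A B) (tensors m \<times> tensors m)
     (affine_space (index_tuples m <+> index_tuples m))"
proof (rule bij_betw_byWitness[where f' = "\<lambda>z. (z \<circ> Inl, z \<circ> Inr)"])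
  show "\<forall>z\<in>affine_space (index_tuples m <+> index_tuples m).
      (\<lambda>(A, B). case_sum A B) (z \<circ> Inl, z \<circ> Inr) = z"
    by (auto simp: fun_eq_iff split: sum.splits)
  show "(\<lambda>z. (z \<circ> Inl, z \<circ> Inr)) ` affine_space (index_tuples m <+> index_tuples m)
      \<subseteq> tensors m \<times> tensors m"
    unfolding tensors_def affine_space_def PiE_def extensional_def by auto
  show "(\<lambda>(A, B). case_sum A B) ` (tensors m \<times> tensors m)
      \<subseteq> affine_space (index_tuples m <+> index_tuples m)"
    unfolding tensors_def affine_space_def PiE_def extensional_def by (auto split: sum.splits)
qed (auto simp: fun_eq_iff)

definition generic_pair :: "nat \<Rightarrow> ('n tensor \<Rightarrow> 'n tensor \<Rightarrow> bool) \<Rightarrow> bool" where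
  "generic_pair m P \<longleftrightarrow>
     (let Z = zariski_topology (index_tuples m <+> index_tuples m)
      in \<exists>U. openin Z U \<and> Z closure_of U = topspace Z \<and>
           (\<forall>A\<in>tensors m. \<forall>B\<in>tensors m. case_sum A B \<in> U \<longrightarrow> P A B))"

end

theory Submission
  imports
    Defs
    "HOL-Complex_Analysis.Conformal_Mappings"
    "Jordan_Normal_Form.Char_Poly"
begin

text \<open>
  Every associated eigenvector with support \<open>J\<close> turns a CB-eigenvalue into a value \<open>t\<close> at which the forms
  \<open>f\<^sub>j - t g\<^sub>j\<close>, \<open>j \<in> J\<close>, have a common nonzero zero, where \<open>f\<close>, \<open>g\<close> come from \<open>\<A>\<^sub>J\<close>, \<open>\<B>\<^sub>J\<close> and \<open>g\<close> has no
  nonzero zero. With \<open>k = |J|\<close> forms of degree \<open>d = m - 1 \<ge> 1\<close> there are at most \<open>k d\<^bsup>k-1\<^esup>\<close> such values, and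
  \<open>\<Sum>\<^sub>J |J| d\<^bsup>|J|-1\<^esup> = n m\<^bsup>n-1\<^esup>\<close>.

  To bound the number of these values, take a form \<open>u\<close> of degree \<open>d\<close> that is nonzero at one eigenvector for
  each of them. A dimension count gives a nonzero polynomial relation \<open>P(t, f - t g, u) = 0\<close> of degree at most
  \<open>k d\<^bsup>k-1\<^esup>\<close> in \<open>t\<close>, and the leading coefficient \<open>c(t, y)\<close> of \<open>P(t, y, T)\<close> in \<open>T\<close> vanishes at every eigenvalue
  \<open>t\<^sub>0\<close>, for all \<open>y\<close>: if \<open>x\<^sub>0\<close> is the eigenvector, \<open>f - t g\<close> takes the constant value \<open>g(x\<^sub>0)\<close> at \<open>s x\<^sub>0\<close> for
  \<open>t = t\<^sub>0 - s\<^bsup>-d\<^esup>\<close>, while \<open>u(s x\<^sub>0)\<close> is unbounded as \<open>s \<rightarrow> \<infinity>\<close>. By a maximum principle for \<open>u\<close> on the fibres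
  of \<open>f - t g\<close> over a disc around \<open>g(x\<^sub>0)\<close>, unbounded roots \<open>T\<close> then occur over a circle on which
  \<open>c(t\<^sub>0, \<cdot>)\<close> could be chosen nonzero.

  For generic uniqueness, pairs with two nonproportional eigenvectors for one eigenvalue form a family
  with fewer parameters than the space of pairs has dimensions, so they satisfy a nonzero polynomial.
\<close>

section \<open>Spans of functions and polynomial functions\<close>

text \<open>The characteristic polynomial of a linear map on forms of high degree already shows that
  the eigenvalues are finite in number, but its degree counts the monomials of that high degree. The
  sharp number \<open>k d^(k-1)\<close> instead comes from the leading terms of two dimension
  counts, which give a relation but say nothing about its behaviour at an eigenvalue
  \<open>t0\<close>. Two obstacles shape the rest. And the point \<open>g(x0)\<close> over which
  \<open>u\<close> blows up may itself be a zero of \<open>c(t0, \<cdot>)\<close>, even if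
  \<open>c(t0, \<cdot>)\<close> is not the zero polynomial; the maximum principle carries the large
  values away from that point to where the leading coefficient is bounded below. Polynomials are
  handled as functions on complex space, and Noether normalisation and transcendence degree are
  replaced by linear dependence in finite-dimensional spans of monomials.\<close>

lemma homogeneous_system_nontrivial_solution:
  fixes M :: "'i \<Rightarrow> 'j \<Rightarrow> 'a::field"
  assumes "finite J" "finite I" "card J < card I"
  shows "\<exists>c. (\<exists>i\<in>I. c i \<noteq> 0) \<and> (\<forall>j\<in>J. (\<Sum>i\<in>I. c i * M i j) = 0)"
  using assms
proof (induction J arbitrary: I M rule: finite_induct)
  case empty
  then have "I \<noteq> {}" by auto
  then show ?case by (intro exI[of _ "\<lambda>_. 1"]) auto
next
  case (insert j J)
  show ?case
  proof (cases "\<forall>i\<in>I. M i j = 0")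
    case True
    from insert have "card J < card I" by simp
    from insert.IH[OF insert.prems(1) this] obtain c
      where "\<exists>i\<in>I. c i \<noteq> 0" "\<forall>j\<in>J. (\<Sum>i\<in>I. c i * M i j) = 0" by blast
    with True show ?thesis by (intro exI[of _ c]) auto
  next
    case False
    then obtain i0 where i0: "i0 \<in> I" "M i0 j \<noteq> 0" by blast
    define I' where "I' = I - {i0}"
    have I': "finite I'" "I = insert i0 I'" "i0 \<notin> I'"
      using i0 insert.prems by (auto simp: I'_def)
    have "card J < card I'" using I' insert by simp
    from insert.IH[OF I'(1) this, of "\<lambda>i l. M i l - M i j / M i0 j * M i0 l"] obtain c
      where c: "\<exists>i\<in>I'. c i \<noteq> 0"
        "\<And>l. l \<in> J \<Longrightarrow> (\<Sum>i\<in>I'. c i * (M i l - M i j / M i0 j * M i0 l)) = 0" by blast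
    define s where "s = (\<Sum>i\<in>I'. c i * M i j) / M i0 j"
    define c' where "c' = c(i0 := - s)"
    have eq: "(\<Sum>i\<in>I. c' i * M i l) = (\<Sum>i\<in>I'. c i * M i l) - s * M i0 l" for l
    proof -
      have "(\<Sum>i\<in>I'. c' i * M i l) = (\<Sum>i\<in>I'. c i * M i l)"
        using I'(3) by (intro sum.cong) (auto simp: c'_def)
      then show ?thesis using I' by (simp add: c'_def)
    qed
    have "(\<Sum>i\<in>I. c' i * M i l) = 0" if "l \<in> insert j J" for l
    proof (cases "l = j")
      case True
      then show ?thesis using eq i0 by (simp add: s_def)
    next
      case False
      with that have "(\<Sum>i\<in>I'. c i * M i l) - s * M i0 l = 0"
        using c(2)[of l] by (simp add: s_def algebra_simps sum_subtractf sum_distrib_left sum_divide_distrib)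
      then show ?thesis using eq by simp
    qed
    moreover have "\<exists>i\<in>I. c' i \<noteq> 0" using c(1) I' by (auto simp: c'_def)
    ultimately show ?thesis by blast
  qed
qed

definition lin :: "'i set \<Rightarrow> ('i \<Rightarrow> 'x \<Rightarrow> complex) \<Rightarrow> ('x \<Rightarrow> complex) set" where
  "lin I b = {h. \<exists>c. \<forall>x. h x = (\<Sum>i\<in>I. c i * b i x)}"

lemma linI: "(\<And>x. h x = (\<Sum>i\<in>I. c i * b i x)) \<Longrightarrow> h \<in> lin I b"
  by (auto simp: lin_def)

lemma lin_base: "finite I \<Longrightarrow> i \<in> I \<Longrightarrow> b i \<in> lin I b"
  by (rule linI[where c = "\<lambda>j. if j = i then 1 else 0"])
     (simp add: if_distrib if_distribR sum.delta cong: if_cong)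

lemma lin_zero: "(\<lambda>x. 0) \<in> lin I b"
  by (rule linI[where c = "\<lambda>_. 0"]) simp

lemma lin_add:
  assumes "g \<in> lin I b" "h \<in> lin I b"
  shows "(\<lambda>x. g x + h x) \<in> lin I b"
proof -
  from assms obtain c c' where "\<And>x. g x = (\<Sum>i\<in>I. c i * b i x)" "\<And>x. h x = (\<Sum>i\<in>I. c' i * b i x)"
    by (auto simp: lin_def)
  then show ?thesis
    by (intro linI[where c = "\<lambda>i. c i + c' i"]) (simp add: sum.distrib algebra_simps)
qed

lemma lin_scale:
  assumes "h \<in> lin I b"
  shows "(\<lambda>x. a * h x) \<in> lin I b"
proof -
  from assms obtain c where "\<And>x. h x = (\<Sum>i\<in>I. c i * b i x)"
    by (auto simp: lin_def)
  then show ?thesis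
    by (intro linI[where c = "\<lambda>i. a * c i"]) (simp add: sum_distrib_left algebra_simps)
qed

lemma lin_diff:
  assumes "g \<in> lin I b" "h \<in> lin I b"
  shows "(\<lambda>x. g x - h x) \<in> lin I b"
  using lin_add[OF assms(1) lin_scale[OF assms(2), of "-1"]] by simp

lemma lin_sum:
  assumes "\<And>a. a \<in> A \<Longrightarrow> h a \<in> lin I b"
  shows "(\<lambda>x. \<Sum>a\<in>A. h a x) \<in> lin I b"
  using assms
  by (induction A rule: infinite_finite_induct) (simp_all add: lin_zero lin_add)

lemma lin_trans:
  assumes "h \<in> lin I b" "\<And>i. i \<in> I \<Longrightarrow> b i \<in> lin J b'"
  shows "h \<in> lin J b'"
proof -
  from assms(1) obtain c where c: "\<And>x. h x = (\<Sum>i\<in>I. c i * b i x)"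
    by (auto simp: lin_def)
  have "(\<lambda>x. \<Sum>i\<in>I. c i * b i x) \<in> lin J b'"
    using assms(2) by (intro lin_sum lin_scale)
  moreover have "h = (\<lambda>x. \<Sum>i\<in>I. c i * b i x)" using c by auto
  ultimately show ?thesis by simp
qed

lemma lin_mult:
  assumes "g \<in> lin I b" "h \<in> lin J b'"
    and "\<And>i j. i \<in> I \<Longrightarrow> j \<in> J \<Longrightarrow> (\<lambda>x. b i x * b' j x) \<in> lin K b''"
  shows "(\<lambda>x. g x * h x) \<in> lin K b''"
proof -
  from assms obtain c c' where "\<And>x. g x = (\<Sum>i\<in>I. c i * b i x)" "\<And>x. h x = (\<Sum>j\<in>J. c' j * b' j x)"
    by (auto simp: lin_def)
  then have "(\<lambda>x. g x * h x) = (\<lambda>x. \<Sum>i\<in>I. \<Sum>j\<in>J. (c i * c' j) * (b i x * b' j x))"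
    by (auto simp: sum_product algebra_simps)
  moreover have "(\<lambda>x. \<Sum>i\<in>I. \<Sum>j\<in>J. (c i * c' j) * (b i x * b' j x)) \<in> lin K b''"
    using assms(3) by (intro lin_sum lin_scale)
  ultimately show ?thesis by simp
qed

text \<open>Every dimension count below ends here: more members than spanning functions force a
  relation. The members are counted by the index set \<open>A\<close>, so coinciding functions count
  separately.\<close>

lemma lin_dependent:
  assumes "finite I" "finite A" "card I < card A" "\<And>a. a \<in> A \<Longrightarrow> h a \<in> lin I b"
  obtains c where "\<exists>a\<in>A. c a \<noteq> 0" "\<And>x. (\<Sum>a\<in>A. c a * h a x) = 0"
proof -
  have "\<forall>a\<in>A. \<exists>m. \<forall>x. h a x = (\<Sum>i\<in>I. m i * b i x)"
    using assms(4) by (auto simp: lin_def)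
  then obtain M where M: "\<And>a x. a \<in> A \<Longrightarrow> h a x = (\<Sum>i\<in>I. M a i * b i x)"
    by metis
  from homogeneous_system_nontrivial_solution[OF assms(1-3), of M] obtain c
    where c: "\<exists>a\<in>A. c a \<noteq> 0" "\<And>i. i \<in> I \<Longrightarrow> (\<Sum>a\<in>A. c a * M a i) = 0" by blast
  have "(\<Sum>a\<in>A. c a * h a x) = 0" for x
  proof -
    have "(\<Sum>a\<in>A. c a * h a x) = (\<Sum>a\<in>A. \<Sum>i\<in>I. c a * M a i * b i x)"
      by (intro sum.cong) (auto simp: M sum_distrib_left algebra_simps)
    also have "\<dots> = (\<Sum>i\<in>I. (\<Sum>a\<in>A. c a * M a i) * b i x)"
      by (subst sum.swap) (simp add: sum_distrib_right)
    also have "\<dots> = 0" using c(2) by simp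
    finally show ?thesis .
  qed
  with c(1) that show ?thesis by blast
qed

section \<open>Monomials, exponent sets and their sizes\<close>

definition mpow :: "'v set \<Rightarrow> ('v \<Rightarrow> nat) \<Rightarrow> ('v \<Rightarrow> complex) \<Rightarrow> complex" where
  "mpow V \<alpha> x = (\<Prod>v\<in>V. x v ^ \<alpha> v)"

text \<open>Exponents are pinned to 0 outside \<open>V\<close>, so that a monomial has only one
  exponent function and the set can be counted.\<close>

definition exps :: "'v set \<Rightarrow> nat \<Rightarrow> ('v \<Rightarrow> nat) set" where
  "exps V m = {\<alpha>. (\<forall>v. v \<notin> V \<longrightarrow> \<alpha> v = 0) \<and> sum \<alpha> V = m}"

text \<open>Bounding each exponent separately gives the closed count
  \<open>(n + 1) ^ card V\<close>, convenient where only the order of growth matters;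
  \<open>exps\<close> serves where leading constants matter.\<close>

definition cube :: "'v set \<Rightarrow> nat \<Rightarrow> ('v \<Rightarrow> nat) set" where
  "cube V n = {\<alpha>. (\<forall>v. v \<notin> V \<longrightarrow> \<alpha> v = 0) \<and> (\<forall>v\<in>V. \<alpha> v \<le> n)}"

lemma bij_betw_cube: "bij_betw (\<lambda>\<alpha>. restrict \<alpha> V) (cube V n) (V \<rightarrow>\<^sub>E {..n})"
  by (rule bij_betw_byWitness[where f' = "\<lambda>\<alpha> v. if v \<in> V then \<alpha> v else 0"])
     (auto simp: cube_def fun_eq_iff PiE_def extensional_def restrict_def)

lemma finite_cube [simp]: "finite V \<Longrightarrow> finite (cube V n)"
  using bij_betw_finite[OF bij_betw_cube[of V n]] by (simp add: finite_PiE)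

lemma card_cube: "finite V \<Longrightarrow> card (cube V n) = (n + 1) ^ card V"
  using bij_betw_same_card[OF bij_betw_cube[of V n]] by (simp add: card_PiE)

lemma exps_subset_cube: "finite V \<Longrightarrow> exps V m \<subseteq> cube V m"
  by (auto simp: exps_def cube_def intro: member_le_sum)

lemma finite_exps [simp]: "finite V \<Longrightarrow> finite (exps V m)"
  using exps_subset_cube finite_cube finite_subset by metis

lemma exps_insert_bij:
  assumes "finite V" "v \<notin> V"
  shows "bij_betw (\<lambda>(j, \<alpha>). \<alpha>(v := m - j)) (SIGMA j:{..m}. exps V j) (exps (insert v V) m)"
proof -
  have s: "(\<Sum>x\<in>V. if x = v then c else \<alpha> x) = sum \<alpha> V" for \<alpha> :: "'a \<Rightarrow> nat" and c
    using assms by (intro sum.cong) auto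
  show ?thesis
    by (rule bij_betw_byWitness[where f' = "\<lambda>\<alpha>. (m - \<alpha> v, \<alpha>(v := 0))"])
       (use assms in \<open>auto simp: exps_def s fun_eq_iff\<close>)
qed

lemma sum_multichoose: "(\<Sum>j\<le>m. (k + j - 1) choose j) = (m + k) choose m"
proof (cases k)
  case 0
  have "(\<Sum>j\<le>m. (0 + j - 1) choose j) = (\<Sum>j\<in>{0::nat}. (0 + j - 1) choose j)"
    by (intro sum.mono_neutral_right) auto
  with 0 show ?thesis by simp
next
  case (Suc l)
  then show ?thesis using sum_choose_lower[of l m] by (simp add: add.commute)
qed

text \<open>Multisets of size \<open>m\<close>. Truncated subtraction is right also for empty
  \<open>V\<close>: \<open>(m - 1) choose m\<close> is 1 for \<open>m = 0\<close> and 0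
  otherwise.\<close>

lemma card_exps: "finite V \<Longrightarrow> card (exps V m) = (m + card V - 1) choose m"
proof (induction V arbitrary: m rule: finite_induct)
  case empty
  have "exps ({}::'a set) m = (if m = 0 then {\<lambda>_. 0} else {})"
    by (auto simp: exps_def)
  then show ?case by simp
next
  case (insert v V)
  have "card (exps (insert v V) m) = (\<Sum>j\<le>m. card (exps V j))"
    using bij_betw_same_card[OF exps_insert_bij[OF insert.hyps, of m]] insert.hyps by simp
  also have "\<dots> = (m + card V) choose m"
    using sum_multichoose[of "card V" m] by (simp add: insert.IH add.commute)
  finally show ?case using insert.hyps by simp
qed

lemma card_exps_le: "finite V \<Longrightarrow> card (SIGMA j:{..b}. exps V j) = (b + card V) choose b"
proof -
  assume V: "finite V"
  show ?thesis
    using V sum_multichoose[of "card V" b] by (simp add: card_exps add.commute)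
qed

lemma mpow_add: "mpow V (\<lambda>v. \<alpha> v + \<beta> v) x = mpow V \<alpha> x * mpow V \<beta> x"
  by (simp add: mpow_def power_add prod.distrib)

lemma mpow_zero [simp]: "mpow V (\<lambda>_. 0) x = 1"
  by (simp add: mpow_def)

lemma mpow_unit: "finite V \<Longrightarrow> v \<in> V \<Longrightarrow> mpow V (\<lambda>w. if w = v then n else 0) x = x v ^ n"
proof -
  assume V: "finite V" "v \<in> V"
  have "mpow V (\<lambda>w. if w = v then n else 0) x = (\<Prod>w\<in>V. if w = v then x w ^ n else 1)"
    unfolding mpow_def by (intro prod.cong) auto
  then show ?thesis using V by (simp add: prod.delta)
qed

lemma mpow_scale: "mpow V \<alpha> (\<lambda>v. s * x v) = s ^ sum \<alpha> V * mpow V \<alpha> x"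
  by (simp add: mpow_def power_mult_distrib prod.distrib power_sum)

lemma exps_add: "\<alpha> \<in> exps V m \<Longrightarrow> \<beta> \<in> exps V n \<Longrightarrow> (\<lambda>v. \<alpha> v + \<beta> v) \<in> exps V (m + n)"
  by (auto simp: exps_def sum.distrib)

lemma cube_add: "\<alpha> \<in> cube V m \<Longrightarrow> \<beta> \<in> cube V n \<Longrightarrow> (\<lambda>v. \<alpha> v + \<beta> v) \<in> cube V (m + n)"
  by (auto simp: cube_def intro!: add_mono)

text \<open>The reason why polynomials may be treated as functions. With the other variables frozen,
  the sum is a polynomial in \<open>x v\<close> that vanishes everywhere; its coefficient at
  \<open>\<alpha> v\<close> is a relation between monomials in one variable less.\<close>

lemma mpow_independent:
  assumes "finite V" "finite A" "\<And>\<alpha> v. \<alpha> \<in> A \<Longrightarrow> v \<notin> V \<Longrightarrow> \<alpha> v = (0::nat)"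
    and "\<And>x. (\<Sum>\<alpha>\<in>A. c \<alpha> * mpow V \<alpha> x) = 0" and "\<alpha> \<in> A"
  shows "c \<alpha> = 0"
  using assms
proof (induction V arbitrary: A c \<alpha> rule: finite_induct)
  case empty
  then have "\<beta> = \<alpha>" if "\<beta> \<in> A" for \<beta> using that by (metis emptyE ext)
  with empty have "A = {\<alpha>}" by blast
  with empty.prems(3) show ?case by (simp add: mpow_def)
next
  case (insert v V)
  define A' where "A' = {\<beta>\<in>A. \<beta> v = \<alpha> v}"
  \<comment> \<open>On \<open>A'\<close> the exponent of \<open>v\<close> is constant, so resetting
    it to 0 loses nothing and leaves exponents supported in \<open>V\<close>.\<close>
  have inj: "inj_on (\<lambda>\<beta>. \<beta>(v := 0)) A'"
    by (auto simp: inj_on_def A'_def fun_eq_iff) metis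
  have upd: "mpow V (\<beta>(v := 0)) x = mpow V \<beta> x" for \<beta> x
    unfolding mpow_def using insert.hyps by (intro prod.cong) auto
  have "(\<Sum>\<beta>\<in>A'. c \<beta> * mpow V \<beta> x) = 0" for x
  proof -
    define p where "p = (\<Sum>\<beta>\<in>A. monom (c \<beta> * mpow V \<beta> x) (\<beta> v))"
    have "poly p s = 0" for s
    proof -
      have "mpow (insert v V) \<beta> (x(v := s)) = s ^ \<beta> v * mpow V \<beta> x" for \<beta>
      proof -
        have "(\<Prod>w\<in>V. (x(v := s)) w ^ \<beta> w) = (\<Prod>w\<in>V. x w ^ \<beta> w)"
          using insert.hyps by (intro prod.cong) auto
        then show ?thesis using insert.hyps by (simp add: mpow_def)
      qed
      then have "poly p s = (\<Sum>\<beta>\<in>A. c \<beta> * mpow (insert v V) \<beta> (x(v := s)))"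
        by (simp add: p_def poly_sum poly_monom algebra_simps)
      then show ?thesis using insert.prems(3) by simp
    qed
    then have "p = 0" using poly_all_0_iff_0 by blast
    then have "coeff p (\<alpha> v) = 0" by simp
    moreover have "coeff p (\<alpha> v) = (\<Sum>\<beta>\<in>A. if \<beta> v = \<alpha> v then c \<beta> * mpow V \<beta> x else 0)"
      by (simp add: p_def coeff_sum coeff_monom cong: if_cong)
    ultimately show ?thesis using insert.prems(1) by (simp add: A'_def sum.If_cases Int_def)
  qed
  then have sum0: "(\<Sum>\<beta>\<in>(\<lambda>\<beta>. \<beta>(v := 0)) ` A'. c (\<beta>(v := \<alpha> v)) * mpow V \<beta> x) = 0" for x
  proof -
    have "(\<Sum>\<beta>\<in>(\<lambda>\<beta>. \<beta>(v := 0)) ` A'. c (\<beta>(v := \<alpha> v)) * mpow V \<beta> x) = (\<Sum>\<beta>\<in>A'. c \<beta> * mpow V \<beta> x)"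
      by (subst sum.reindex[OF inj]) (auto simp: upd A'_def intro!: sum.cong, metis fun_upd_triv)
    with \<open>\<And>x. (\<Sum>\<beta>\<in>A'. c \<beta> * mpow V \<beta> x) = 0\<close> show ?thesis by simp
  qed
  have fin: "finite ((\<lambda>\<beta>. \<beta>(v := 0)) ` A')"
    using insert.prems(1) by (simp add: A'_def)
  have zero: "\<beta> w = 0" if "\<beta> \<in> (\<lambda>\<beta>. \<beta>(v := 0)) ` A'" "w \<notin> V" for \<beta> w
    using that insert.prems(2) by (auto simp: A'_def)
  have mem: "\<alpha>(v := 0) \<in> (\<lambda>\<beta>. \<beta>(v := 0)) ` A'"
    using insert.prems(4) by (auto simp: A'_def)
  have "c ((\<alpha>(v := 0))(v := \<alpha> v)) = 0"
  proof (rule insert.IH[where A = "(\<lambda>\<beta>. \<beta>(v := 0)) ` A'" and c = "\<lambda>\<beta>. c (\<beta>(v := \<alpha> v))"])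
    show "\<beta> w = 0" if "\<beta> \<in> (\<lambda>\<beta>. \<beta>(v := 0)) ` A'" "w \<notin> V" for \<beta> w
      using that by (rule zero)
  qed (fact fin sum0 mem)+
  then show ?case by simp
qed

section \<open>Forms and polynomial functions\<close>

definition Hom :: "'v set \<Rightarrow> nat \<Rightarrow> (('v \<Rightarrow> complex) \<Rightarrow> complex) set" where
  "Hom V m = lin (exps V m) (mpow V)"

lemma Hom_mpow: "finite V \<Longrightarrow> \<alpha> \<in> exps V m \<Longrightarrow> mpow V \<alpha> \<in> Hom V m"
  unfolding Hom_def by (intro lin_base) auto

lemma Hom_mult:
  assumes "finite V" "g \<in> Hom V m" "h \<in> Hom V n"
  shows "(\<lambda>x. g x * h x) \<in> Hom V (m + n)"
  using assms(2,3) unfolding Hom_def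
proof (rule lin_mult)
  fix \<alpha> \<beta> assume "\<alpha> \<in> exps V m" "\<beta> \<in> exps V n"
  from lin_base[OF _ exps_add[OF this], of "mpow V"] assms(1)
  show "(\<lambda>x. mpow V \<alpha> x * mpow V \<beta> x) \<in> lin (exps V (m + n)) (mpow V)"
    by (simp add: mpow_add cong: if_cong) (simp add: mpow_add[abs_def])
qed

lemma Hom_const: "finite V \<Longrightarrow> (\<lambda>x. a) \<in> Hom V 0"
  using lin_scale[OF Hom_mpow[of V "\<lambda>_. 0" 0, unfolded Hom_def], of a]
  by (simp add: Hom_def exps_def)

lemma Hom_var_power: "finite V \<Longrightarrow> v \<in> V \<Longrightarrow> (\<lambda>x. x v ^ n) \<in> Hom V n"
proof -
  assume V: "finite V" "v \<in> V"
  then have "(\<lambda>w. if w = v then n else 0) \<in> exps V n"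
    by (auto simp: exps_def sum.delta)
  from Hom_mpow[OF V(1) this] have "mpow V (\<lambda>w. if w = v then n else 0) \<in> Hom V n" .
  moreover have "mpow V (\<lambda>w. if w = v then n else 0) = (\<lambda>x. x v ^ n)"
    using mpow_unit[OF V] by auto
  ultimately show ?thesis by simp
qed

lemma Hom_var: "finite V \<Longrightarrow> v \<in> V \<Longrightarrow> (\<lambda>x. x v) \<in> Hom V 1"
  using Hom_var_power[of V v 1] by simp

lemma Hom_power: "finite V \<Longrightarrow> h \<in> Hom V m \<Longrightarrow> (\<lambda>x. h x ^ n) \<in> Hom V (n * m)"
proof (induction n)
  case 0
  then show ?case using Hom_const[of V 1] by simp
next
  case (Suc n)
  then show ?case using Hom_mult[of V h m "\<lambda>x. h x ^ n" "n * m"] by simp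
qed

lemma Hom_diff: "g \<in> Hom V m \<Longrightarrow> h \<in> Hom V m \<Longrightarrow> (\<lambda>x. g x - h x) \<in> Hom V m"
  unfolding Hom_def by (rule lin_diff)

lemma Hom_scale: "h \<in> Hom V m \<Longrightarrow> (\<lambda>x. a * h x) \<in> Hom V m"
  unfolding Hom_def by (rule lin_scale)

lemma Hom_sum: "(\<And>a. a \<in> A \<Longrightarrow> h a \<in> Hom V m) \<Longrightarrow> (\<lambda>x. \<Sum>a\<in>A. h a x) \<in> Hom V m"
  unfolding Hom_def by (rule lin_sum)

lemma Hom_scaling: "h \<in> Hom V m \<Longrightarrow> h (\<lambda>v. s * x v) = s ^ m * h x"
proof -
  assume "h \<in> Hom V m"
  then obtain c where c: "\<And>x. h x = (\<Sum>\<alpha>\<in>exps V m. c \<alpha> * mpow V \<alpha> x)"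
    by (auto simp: Hom_def lin_def)
  have "h (\<lambda>v. s * x v) = (\<Sum>\<alpha>\<in>exps V m. c \<alpha> * (s ^ m * mpow V \<alpha> x))"
    unfolding c by (intro sum.cong) (auto simp: mpow_scale exps_def)
  then show ?thesis by (simp add: c sum_distrib_left algebra_simps)
qed

text \<open>Given by closure rules, so that substitution, limits and restriction to a line take one
  induction each; \<open>polyfun_lin_cube\<close> brings back coefficients and degrees.\<close>

inductive_set polyfun :: "'v set \<Rightarrow> (('v \<Rightarrow> complex) \<Rightarrow> complex) set" for V where
  const: "(\<lambda>x. a) \<in> polyfun V"
| var: "v \<in> V \<Longrightarrow> (\<lambda>x. x v) \<in> polyfun V"
| add: "g \<in> polyfun V \<Longrightarrow> h \<in> polyfun V \<Longrightarrow> (\<lambda>x. g x + h x) \<in> polyfun V"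
| mult: "g \<in> polyfun V \<Longrightarrow> h \<in> polyfun V \<Longrightarrow> (\<lambda>x. g x * h x) \<in> polyfun V"

lemma polyfun_uminus: "h \<in> polyfun V \<Longrightarrow> (\<lambda>x. - h x) \<in> polyfun V"
  using polyfun.mult[OF polyfun.const[of "-1"], of h] by simp

lemma polyfun_diff: "g \<in> polyfun V \<Longrightarrow> h \<in> polyfun V \<Longrightarrow> (\<lambda>x. g x - h x) \<in> polyfun V"
  using polyfun.add[OF _ polyfun_uminus, of g V h] by simp

lemma polyfun_sum: "(\<And>a. a \<in> A \<Longrightarrow> h a \<in> polyfun V) \<Longrightarrow> (\<lambda>x. \<Sum>a\<in>A. h a x) \<in> polyfun V"
  by (induction A rule: infinite_finite_induct) (auto intro: polyfun.intros)

lemma polyfun_prod: "(\<And>a. a \<in> A \<Longrightarrow> h a \<in> polyfun V) \<Longrightarrow> (\<lambda>x. \<Prod>a\<in>A. h a x) \<in> polyfun V"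
  by (induction A rule: infinite_finite_induct) (auto intro: polyfun.intros)

lemma polyfun_power: "h \<in> polyfun V \<Longrightarrow> (\<lambda>x. h x ^ n) \<in> polyfun V"
  by (induction n) (auto intro: polyfun.intros)

lemma polyfun_mpow: "mpow V \<alpha> \<in> polyfun V"
  unfolding mpow_def[abs_def] by (intro polyfun_prod polyfun_power polyfun.var)

lemma lin_mpow_polyfun: "h \<in> lin A (mpow V) \<Longrightarrow> h \<in> polyfun V"
proof -
  assume "h \<in> lin A (mpow V)"
  then obtain c where "\<And>x. h x = (\<Sum>\<alpha>\<in>A. c \<alpha> * mpow V \<alpha> x)"
    by (auto simp: lin_def)
  then have "h = (\<lambda>x. \<Sum>\<alpha>\<in>A. c \<alpha> * mpow V \<alpha> x)" by auto
  then show ?thesis by (auto intro!: polyfun_sum polyfun.mult polyfun.const polyfun_mpow)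
qed

lemma Hom_polyfun: "h \<in> Hom V m \<Longrightarrow> h \<in> polyfun V"
  unfolding Hom_def by (rule lin_mpow_polyfun)

lemma lin_mono: "finite J \<Longrightarrow> I \<subseteq> J \<Longrightarrow> h \<in> lin I b \<Longrightarrow> h \<in> lin J b"
  using lin_trans[of h I b J b] lin_base[of J _ b] by blast

lemma cube_mono: "m \<le> n \<Longrightarrow> cube V m \<subseteq> cube V n"
  by (auto simp: cube_def)

lemma lin_cube_mult:
  assumes "finite V" "g \<in> lin (cube V m) (mpow V)" "h \<in> lin (cube V n) (mpow V)"
  shows "(\<lambda>x. g x * h x) \<in> lin (cube V (m + n)) (mpow V)"
  using assms(2,3)
proof (rule lin_mult)
  fix \<alpha> \<beta> assume "\<alpha> \<in> cube V m" "\<beta> \<in> cube V n"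
  from lin_base[OF _ cube_add[OF this], of "mpow V"] assms(1)
  show "(\<lambda>x. mpow V \<alpha> x * mpow V \<beta> x) \<in> lin (cube V (m + n)) (mpow V)"
    by (simp add: mpow_add[abs_def])
qed

lemma polyfun_lin_cube:
  assumes "finite V" "h \<in> polyfun V"
  shows "\<exists>N. h \<in> lin (cube V N) (mpow V)"
  using assms(2)
proof induction
  case (const a)
  have "(\<lambda>x. a * mpow V (\<lambda>_. 0) x) \<in> lin (cube V 0) (mpow V)"
    using assms(1) by (intro lin_scale lin_base finite_cube) (auto simp: cube_def)
  then show ?case by auto
next
  case (var v)
  then have "mpow V (\<lambda>w. if w = v then 1 else 0) \<in> lin (cube V 1) (mpow V)"
    using assms(1) by (intro lin_base finite_cube) (auto simp: cube_def)
  moreover have "mpow V (\<lambda>w. if w = v then 1 else 0) = (\<lambda>x. x v)"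
    using mpow_unit[OF assms(1) var, of 1] by auto
  ultimately show ?case by auto
next
  case (add g h)
  then obtain M N where "g \<in> lin (cube V M) (mpow V)" "h \<in> lin (cube V N) (mpow V)" by blast
  then have "g \<in> lin (cube V (max M N)) (mpow V)" "h \<in> lin (cube V (max M N)) (mpow V)"
    using assms(1) lin_mono[OF _ cube_mono] by (metis finite_cube max.cobounded1 max.cobounded2)+
  then show ?case using lin_add by blast
next
  case (mult g h)
  then obtain M N where "g \<in> lin (cube V M) (mpow V)" "h \<in> lin (cube V N) (mpow V)" by blast
  then show ?case using lin_cube_mult[OF assms(1)] by blast
qed

lemma polyfun_homogeneous_components:
  assumes "finite V" "h \<in> polyfun V"
  obtains N p where "\<And>m. p m \<in> Hom V m" "\<And>x. h x = (\<Sum>m\<le>N. p m x)"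
proof -
  obtain B where "h \<in> lin (cube V B) (mpow V)" using polyfun_lin_cube[OF assms] by blast
  then obtain c where c: "\<And>x. h x = (\<Sum>\<alpha>\<in>cube V B. c \<alpha> * mpow V \<alpha> x)" by (auto simp: lin_def)
  define N where "N = card V * B"
  define p where "p m x = (\<Sum>\<alpha>\<in>{\<alpha>\<in>cube V B. sum \<alpha> V = m}. c \<alpha> * mpow V \<alpha> x)" for m x
  have "p m \<in> Hom V m" for m
    unfolding p_def[abs_def]
    by (intro Hom_sum Hom_scale Hom_mpow assms) (auto simp: exps_def cube_def)
  moreover have "h x = (\<Sum>m\<le>N. p m x)" for x
  proof -
    have "sum \<alpha> V \<le> N" if "\<alpha> \<in> cube V B" for \<alpha>
      using that sum_bounded_above[of V \<alpha> B] by (auto simp: cube_def N_def)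
    then have "(\<lambda>\<alpha>. sum \<alpha> V) ` cube V B \<subseteq> {..N}" by auto
    from sum.group[OF _ _ this, of "\<lambda>\<alpha>. c \<alpha> * mpow V \<alpha> x"] assms(1) show ?thesis
      unfolding c p_def by simp
  qed
  ultimately show ?thesis using that by blast
qed

text \<open>Reduces nonvanishing in many variables to one-variable polynomials, which have finitely
  many zeros; used whenever a point must be moved off a zero set.\<close>

lemma polyfun_line:
  assumes "h \<in> polyfun V"
  shows "\<exists>p. \<forall>s. h (\<lambda>v. a v + s * b v) = poly p s"
  using assms
proof induction
  case (const a)
  show ?case by (intro exI[of _ "[:a:]"]) simp
next
  case (var v)
  show ?case by (intro exI[of _ "[:a v, b v:]"]) simp
next
  case (add g h)
  then show ?case by (metis poly_add)
next
  case (mult g h)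
  then show ?case by (metis poly_mult)
qed

lemma polyfun_tendsto:
  assumes "h \<in> polyfun V" "\<And>v. v \<in> V \<Longrightarrow> ((\<lambda>n. X n v) \<longlongrightarrow> x v) F"
  shows "((\<lambda>n. h (X n)) \<longlongrightarrow> h x) F"
  using assms(1) by induction (auto intro: tendsto_intros assms(2))

lemma polyfun_cong:
  assumes "h \<in> polyfun V" "\<And>v. v \<in> V \<Longrightarrow> x v = y v"
  shows "h x = h y"
  using assms(1) by induction (auto simp: assms(2))

lemma polyfun_compose:
  assumes "h \<in> polyfun V" "\<And>v. v \<in> V \<Longrightarrow> F v \<in> polyfun W"
  shows "(\<lambda>x. h (\<lambda>v. F v x)) \<in> polyfun W"
  using assms(1) by induction (auto intro: polyfun.intros assms(2))

section \<open>A Nullstellensatz for forms\<close>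

definition polyideal :: "'v set \<Rightarrow> (('v \<Rightarrow> complex) \<Rightarrow> complex) set \<Rightarrow> bool" where
  "polyideal V I \<longleftrightarrow> I \<subseteq> polyfun V \<and> (\<lambda>x. 0) \<in> I \<and>
     (\<forall>g\<in>I. \<forall>h\<in>I. (\<lambda>x. g x + h x) \<in> I) \<and> (\<forall>q\<in>polyfun V. \<forall>h\<in>I. (\<lambda>x. q x * h x) \<in> I)"

lemma polyideal_add: "polyideal V I \<Longrightarrow> g \<in> I \<Longrightarrow> h \<in> I \<Longrightarrow> (\<lambda>x. g x + h x) \<in> I"
  and polyideal_mult: "polyideal V I \<Longrightarrow> q \<in> polyfun V \<Longrightarrow> h \<in> I \<Longrightarrow> (\<lambda>x. q x * h x) \<in> I"
  and polyideal_zero: "polyideal V I \<Longrightarrow> (\<lambda>x. 0) \<in> I"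
  and polyideal_polyfun: "polyideal V I \<Longrightarrow> h \<in> I \<Longrightarrow> h \<in> polyfun V"
  by (auto simp: polyideal_def)

lemma polyideal_diff: "polyideal V I \<Longrightarrow> g \<in> I \<Longrightarrow> h \<in> I \<Longrightarrow> (\<lambda>x. g x - h x) \<in> I"
  using polyideal_add[of V I g "\<lambda>x. - h x"] polyideal_mult[of V I "\<lambda>x. -1" h] polyfun.const
  by fastforce

lemma polyideal_sum:
  "polyideal V I \<Longrightarrow> (\<And>a. a \<in> A \<Longrightarrow> h a \<in> I) \<Longrightarrow> (\<lambda>x. \<Sum>a\<in>A. h a x) \<in> I"
  by (induction A rule: infinite_finite_induct) (auto intro: polyideal_zero polyideal_add)

definition adjoin where
  "adjoin V I h = {(\<lambda>x. g x + q x * h x) | g q. g \<in> I \<and> q \<in> polyfun V}"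

lemma adjoinI:
  "(\<And>x. f x = g x + q x * h x) \<Longrightarrow> g \<in> I \<Longrightarrow> q \<in> polyfun V \<Longrightarrow> f \<in> adjoin V I h"
  unfolding adjoin_def by (intro CollectI exI[of _ g] exI[of _ q]) auto

lemma adjoinE:
  assumes "f \<in> adjoin V I h"
  obtains g q where "\<And>x. f x = g x + q x * h x" "g \<in> I" "q \<in> polyfun V"
  using assms unfolding adjoin_def by auto

lemma polyideal_adjoin:
  assumes "polyideal V I" "h \<in> polyfun V"
  shows "polyideal V (adjoin V I h)" "I \<subseteq> adjoin V I h" "h \<in> adjoin V I h"
proof -
  show "polyideal V (adjoin V I h)"
    unfolding polyideal_def
  proof (intro conjI ballI)
    show "adjoin V I h \<subseteq> polyfun V"
      using assms by (auto simp: adjoin_def intro!: polyfun.add polyfun.mult dest: polyideal_polyfun)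
    show "(\<lambda>x. 0) \<in> adjoin V I h"
      by (rule adjoinI[OF _ polyideal_zero[OF assms(1)] polyfun.const[of 0]]) simp
  next
    fix a b assume ab: "a \<in> adjoin V I h" "b \<in> adjoin V I h"
    obtain g q where 1: "\<And>x. a x = g x + q x * h x" "g \<in> I" "q \<in> polyfun V"
      by (rule adjoinE[OF ab(1)]) (rule that)
    obtain g' q' where 2: "\<And>x. b x = g' x + q' x * h x" "g' \<in> I" "q' \<in> polyfun V"
      by (rule adjoinE[OF ab(2)]) (rule that)
    note * = 1 2
    then have "a x + b x = (g x + g' x) + (q x + q' x) * h x" for x
      by (simp add: algebra_simps)
    moreover have "(\<lambda>x. g x + g' x) \<in> I" "(\<lambda>x. q x + q' x) \<in> polyfun V"
      using * polyideal_add[OF assms(1)] polyfun.add by auto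
    ultimately show "(\<lambda>x. a x + b x) \<in> adjoin V I h"
      by (rule adjoinI)
  next
    fix p a assume p: "p \<in> polyfun V" "a \<in> adjoin V I h"
    obtain g q where *: "\<And>x. a x = g x + q x * h x" "g \<in> I" "q \<in> polyfun V"
      by (rule adjoinE[OF p(2)]) (rule that)
    then have "p x * a x = (p x * g x) + (p x * q x) * h x" for x
      by (simp add: algebra_simps)
    moreover have "(\<lambda>x. p x * g x) \<in> I" "(\<lambda>x. p x * q x) \<in> polyfun V"
      using * p polyideal_mult[OF assms(1)] polyfun.mult by auto
    ultimately show "(\<lambda>x. p x * a x) \<in> adjoin V I h"
      by (rule adjoinI)
  qed
  show "I \<subseteq> adjoin V I h"
    by (auto intro: adjoinI[OF _ _ polyfun.const[of 0]])
  show "h \<in> adjoin V I h"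
    by (rule adjoinI[OF _ polyideal_zero[OF assms(1)] polyfun.const[of 1]]) simp
qed

text \<open>
  Otherwise \<open>x\<^sub>v - a\<close> has an inverse \<open>q\<^sub>a\<close> modulo \<open>I\<close> for every one of the uncountably many \<open>a\<close>,
  so infinitely many of the \<open>q\<^sub>a\<close> lie in one finite-dimensional space; a linear dependence between
  them puts a nonzero polynomial in \<open>x\<^sub>v\<close>, that is, a product of units, into \<open>I\<close>.
\<close>
lemma proper_adjoin_coordinate:
  assumes V: "finite V" "v \<in> V" and I: "polyideal V I" and proper: "(\<lambda>x. 1) \<notin> I"
  shows "\<exists>a. (\<lambda>x. 1) \<notin> adjoin V I (\<lambda>x. x v - a)"
proof (rule ccontr)
  assume "\<not> ?thesis"
  then have "\<forall>a. \<exists>g q. g \<in> I \<and> q \<in> polyfun V \<and> (\<forall>x. g x + q x * (x v - a) = 1)"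
    by (auto simp: adjoin_def fun_eq_iff) metis
  then obtain g q where gq: "\<And>a. g a \<in> I" "\<And>a. q a \<in> polyfun V"
    and eq: "\<And>a x. g a x + q a x * (x v - a) = 1" by metis
  have inv: "1 - q a x * (x v - a) = g a x" for a x
    using eq[of a x] by (simp add: algebra_simps)
  \<comment> \<open>Multiplication by \<open>q r\<close> turns a linear factor
    \<open>x v - r\<close> into 1 modulo \<open>I\<close>, so a nonzero polynomial in
    \<open>I\<close> can be stripped of its roots until a nonzero constant lies in
    \<open>I\<close>.\<close>
  have no_poly: "p = 0" if "(\<lambda>x. poly p (x v)) \<in> I" for p
    using that
  proof (induction "degree p" arbitrary: p rule: less_induct)
    case less
    show ?case
    proof (cases "degree p = 0")
      case True
      then obtain c where c: "p = [:c:]" by (metis degree_eq_zeroE)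
      show ?thesis
      proof (rule ccontr)
        assume "p \<noteq> 0"
        with c have "c \<noteq> 0" by simp
        have "(\<lambda>x. 1 / c * poly p (x v)) \<in> I"
          using polyideal_mult[OF I polyfun.const less.prems] .
        with c \<open>c \<noteq> 0\<close> proper show False by simp
      qed
    next
      case False
      then obtain r where "poly p r = 0"
        using fundamental_theorem_of_algebra[of p] by (auto simp: constant_degree)
      then obtain p' where p': "p = [:-r, 1:] * p'" by (metis dvdE poly_eq_0_iff_dvd)
      have "p' \<noteq> 0" using False p' by auto
      then have deg: "degree p' < degree p" unfolding p' by (subst degree_mult_eq) auto
      have pp: "(\<lambda>x. poly p' (x v)) \<in> polyfun V"
      proof (induction p')
        case 0
        then show ?case using polyfun.const[of 0] by simp
      next
        case (pCons a p)
        then show ?case using V by (auto intro!: polyfun.intros)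
      qed
      have "(\<lambda>x. poly p' (x v) * g r x + q r x * poly p (x v)) \<in> I"
        by (intro polyideal_add[OF I] polyideal_mult[OF I] gq less.prems pp)
      moreover have "(\<lambda>x. poly p' (x v) * g r x + q r x * poly p (x v)) = (\<lambda>x. poly p' (x v))"
        by (auto simp: p' inv[symmetric] algebra_simps)
      ultimately have "p' = 0" using less.hyps[OF deg] by simp
      with \<open>p' \<noteq> 0\<close> show ?thesis by simp
    qed
  qed
  have "\<exists>N. infinite {a. q a \<in> lin (cube V N) (mpow V)}"
  proof (rule ccontr)
    assume "\<not> ?thesis"
    then have "countable (\<Union>N. {a. q a \<in> lin (cube V N) (mpow V)})"
      by (intro countable_UN) (auto intro: countable_finite)
    moreover have "(\<Union>N. {a. q a \<in> lin (cube V N) (mpow V)}) = UNIV"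
      using polyfun_lin_cube[OF V(1) gq(2)] by auto
    ultimately show False using uncountable_UNIV_complex by simp
  qed
  then obtain N where "infinite {a. q a \<in> lin (cube V N) (mpow V)}" by blast
  then obtain A where A: "finite A" "card A = Suc (card (cube V N))"
    "A \<subseteq> {a. q a \<in> lin (cube V N) (mpow V)}"
    using infinite_arbitrarily_large by metis
  from A have A': "card (cube V N) < card A" "\<And>a. a \<in> A \<Longrightarrow> q a \<in> lin (cube V N) (mpow V)" by auto
  obtain c where c: "\<exists>a\<in>A. c a \<noteq> 0" "\<And>x. (\<Sum>a\<in>A. c a * q a x) = 0"
    by (rule lin_dependent[OF finite_cube[OF V(1)] A(1) A'(1), of q]) (auto intro: A'(2) that)
  \<comment> \<open>Modulo \<open>I\<close> each \<open>q a\<close> stands for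
    \<open>1 / (x v - a)\<close>; this is the numerator of the dependence
    \<open>\<Sum> c a / (x v - a)\<close> over the common denominator. It is nonzero because only
    one summand survives at a point \<open>a\<close> with \<open>c a \<noteq> 0\<close>.\<close>
  define p where "p = (\<Sum>a\<in>A. [:c a:] * (\<Prod>b\<in>A - {a}. [:-b, 1:]))"
  have "(\<lambda>x. \<Sum>a\<in>A. (c a * (\<Prod>b\<in>A - {a}. x v - b)) * g a x) \<in> I"
    by (intro polyideal_sum[OF I] polyideal_mult[OF I] gq polyfun.mult polyfun.const polyfun_prod
        polyfun_diff polyfun.var V)
  moreover have "(\<Sum>a\<in>A. (c a * (\<Prod>b\<in>A - {a}. x v - b)) * g a x) = poly p (x v)" for x
  proof -
    have "(\<Sum>a\<in>A. (c a * (\<Prod>b\<in>A - {a}. x v - b)) * g a x)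
        = (\<Sum>a\<in>A. c a * (\<Prod>b\<in>A - {a}. x v - b) - c a * q a x * (\<Prod>b\<in>A. x v - b))"
    proof (intro sum.cong refl, goal_cases)
      case (1 a)
      have remove: "(\<Prod>b\<in>A. x v - b) = (x v - a) * (\<Prod>b\<in>A - {a}. x v - b)"
        using A(1) 1 by (rule prod.remove)
      show ?case unfolding inv[symmetric] remove by (simp add: algebra_simps)
    qed
    also have "\<dots> = (\<Sum>a\<in>A. c a * (\<Prod>b\<in>A - {a}. x v - b)) - (\<Sum>a\<in>A. c a * q a x) * (\<Prod>b\<in>A. x v - b)"
      by (simp add: sum_subtractf sum_distrib_right)
    also have "\<dots> = poly p (x v)"
      by (simp add: c p_def poly_sum poly_prod)
    finally show ?thesis .
  qed
  ultimately have "p = 0" using no_poly by simp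
  obtain a where a: "a \<in> A" "c a \<noteq> 0" using c by blast
  have "poly p a = (\<Sum>a'\<in>A. if a' = a then c a * (\<Prod>b\<in>A - {a}. a - b) else 0)"
    unfolding p_def poly_sum
  proof (intro sum.cong refl, goal_cases)
    case (1 a')
    show ?case
    proof (cases "a' = a")
      case False
      then have "(\<Prod>b\<in>A - {a'}. a - b) = 0" using a A(1) by (intro prod_zero) auto
      with False show ?thesis by (simp add: poly_prod)
    qed (simp add: poly_prod)
  qed
  also have "\<dots> = c a * (\<Prod>b\<in>A - {a}. a - b)" using A(1) a by simp
  finally show False using \<open>p = 0\<close> a A(1) by auto
qed

text \<open>Fix the coordinates one at a time, keeping the ideal proper. In the final ideal every
  polynomial function is congruent to its value at \<open>a\<close>, so a nonzero value on
  \<open>I\<close> would be a unit in it.\<close>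

lemma polyideal_common_zero:
  assumes V: "finite V" and I: "polyideal V I" and proper: "(\<lambda>x. 1) \<notin> I"
  obtains a where "\<And>h. h \<in> I \<Longrightarrow> h a = 0"
proof -
  have "\<exists>a I'. polyideal V I' \<and> I \<subseteq> I' \<and> (\<lambda>x. 1) \<notin> I' \<and> (\<forall>v\<in>W. (\<lambda>x. x v - a v) \<in> I')"
    if "W \<subseteq> V" for W
    using finite_subset[OF that V] that
  proof (induction W rule: finite_induct)
    case empty
    then show ?case using I proper by auto
  next
    case (insert w W)
    then obtain a I' where I': "polyideal V I'" "I \<subseteq> I'" "(\<lambda>x. 1) \<notin> I'"
      "\<forall>v\<in>W. (\<lambda>x. x v - a v) \<in> I'" by auto
    have "w \<in> V" using insert.prems by simp
    from proper_adjoin_coordinate[OF V this I'(1,3)] obtain b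
      where b: "(\<lambda>x. 1) \<notin> adjoin V I' (\<lambda>x. x w - b)" by blast
    have pf: "(\<lambda>x. x w - b) \<in> polyfun V"
      by (intro polyfun_diff polyfun.intros \<open>w \<in> V\<close>)
    from polyideal_adjoin[OF I'(1) pf] b I' insert.hyps show ?case
      by (intro exI[of _ "a(w := b)"] exI[of _ "adjoin V I' (\<lambda>x. x w - b)"]) auto
  qed
  from this[of V] obtain a I' where I': "polyideal V I'" "I \<subseteq> I'" "(\<lambda>x. 1) \<notin> I'"
    and coord: "\<And>v. v \<in> V \<Longrightarrow> (\<lambda>x. x v - a v) \<in> I'" by auto
  have "h a = 0" if "h \<in> I" for h
  proof (rule ccontr)
    assume "h a \<noteq> 0"
    have "(\<lambda>x. h x - h a) \<in> I'" if "h \<in> polyfun V" for h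
      using that
    proof induction
      case (const b)
      then show ?case using polyideal_zero[OF I'(1)] by simp
    next
      case (var v)
      then show ?case using coord by simp
    next
      case (add g h)
      from polyideal_add[OF I'(1) add.IH] show ?case by (simp add: algebra_simps)
    next
      case (mult g h)
      have "(\<lambda>x. h x * (g x - g a) + g a * (h x - h a)) \<in> I'"
        using mult by (intro polyideal_add[OF I'(1)] polyideal_mult[OF I'(1)] polyfun.const) auto
      then show ?case by (simp add: algebra_simps)
    qed
    then have "(\<lambda>x. h x - h a) \<in> I'" using polyideal_polyfun[OF I] \<open>h \<in> I\<close> by blast
    moreover have "h \<in> I'" using I' \<open>h \<in> I\<close> by blast
    ultimately have "(\<lambda>x. h x - (h x - h a)) \<in> I'" by (rule polyideal_diff[OF I'(1), rotated])
    then have "(\<lambda>x. h a) \<in> I'" by simp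
    from polyideal_mult[OF I'(1) polyfun.const this, of "1 / h a"] \<open>h a \<noteq> 0\<close> I'(3)
    show False by simp
  qed
  then show ?thesis using that by blast
qed

definition generated where
  "generated V K G = {h. \<exists>q. (\<forall>j\<in>K. q j \<in> polyfun V) \<and> (\<forall>x. h x = (\<Sum>j\<in>K. q j x * G j x))}"

lemma generatedI:
  "(\<And>x. h x = (\<Sum>j\<in>K. q j x * G j x)) \<Longrightarrow> (\<And>j. j \<in> K \<Longrightarrow> q j \<in> polyfun V) \<Longrightarrow> h \<in> generated V K G"
  unfolding generated_def by (intro CollectI exI[of _ q]) auto

lemma generatedE:
  assumes "h \<in> generated V K G"
  obtains q where "\<And>j. j \<in> K \<Longrightarrow> q j \<in> polyfun V" "\<And>x. h x = (\<Sum>j\<in>K. q j x * G j x)"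
  using assms unfolding generated_def by auto

lemma polyideal_generated:
  assumes "\<And>j. j \<in> K \<Longrightarrow> G j \<in> polyfun V"
  shows "polyideal V (generated V K G)"
  unfolding polyideal_def
proof (intro conjI ballI subsetI)
  fix h assume h: "h \<in> generated V K G"
  obtain q where q: "\<And>j. j \<in> K \<Longrightarrow> q j \<in> polyfun V" "\<And>x. h x = (\<Sum>j\<in>K. q j x * G j x)"
    by (rule generatedE[OF h]) (rule that)
  have "(\<lambda>x. \<Sum>j\<in>K. q j x * G j x) \<in> polyfun V"
    using assms q by (intro polyfun_sum polyfun.mult)
  then show "h \<in> polyfun V" using q(2) by presburger
next
  show "(\<lambda>x. 0) \<in> generated V K G"
    by (rule generatedI[where q = "\<lambda>_ _. 0"]) (auto intro: polyfun.const)
next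
  fix a b assume ab: "a \<in> generated V K G" "b \<in> generated V K G"
  obtain q where 1: "\<And>j. j \<in> K \<Longrightarrow> q j \<in> polyfun V" "\<And>x. a x = (\<Sum>j\<in>K. q j x * G j x)"
    by (rule generatedE[OF ab(1)]) (rule that)
  obtain q' where 2: "\<And>j. j \<in> K \<Longrightarrow> q' j \<in> polyfun V" "\<And>x. b x = (\<Sum>j\<in>K. q' j x * G j x)"
    by (rule generatedE[OF ab(2)]) (rule that)
  note * = 1 2
  show "(\<lambda>x. a x + b x) \<in> generated V K G"
    by (rule generatedI[where q = "\<lambda>j x. q j x + q' j x"])
       (auto simp: * sum.distrib algebra_simps intro: polyfun.add)
next
  fix p a assume p: "p \<in> polyfun V" "a \<in> generated V K G"
  obtain q where *: "\<And>j. j \<in> K \<Longrightarrow> q j \<in> polyfun V" "\<And>x. a x = (\<Sum>j\<in>K. q j x * G j x)"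
    by (rule generatedE[OF p(2)]) (rule that)
  show "(\<lambda>x. p x * a x) \<in> generated V K G"
    by (rule generatedI[where q = "\<lambda>j x. p x * q j x"])
       (auto simp: * p sum_distrib_left algebra_simps intro: polyfun.mult)
qed

section \<open>The homogeneous Nullstellensatz\<close>

definition no_nonzero_zero :: "'v set \<Rightarrow> 'j set \<Rightarrow> ('j \<Rightarrow> ('v \<Rightarrow> complex) \<Rightarrow> complex) \<Rightarrow> bool" where
  "no_nonzero_zero V K G \<longleftrightarrow> (\<forall>x. (\<forall>j\<in>K. G j x = 0) \<longrightarrow> (\<forall>v\<in>V. x v = 0))"

text \<open>A common zero of the \<open>G j\<close> and of \<open>x v - 1\<close> would be nonzero,
  so 1 is a combination of them. Substituting \<open>x / x v\<close> removes the term with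
  \<open>x v - 1\<close>, and multiplying by \<open>x v ^ n\<close> clears the denominators.\<close>

lemma coordinate_power_in_ideal:
  assumes V: "finite V" "v \<in> V" and K: "finite K" and G: "\<And>j. j \<in> K \<Longrightarrow> G j \<in> Hom V d"
    and nz: "no_nonzero_zero V K G"
  shows "\<exists>N\<ge>d. \<forall>n\<ge>N. \<exists>h. (\<forall>j\<in>K. h j \<in> Hom V (n - d)) \<and> (\<forall>x. x v ^ n = (\<Sum>j\<in>K. h j x * G j x))"
proof -
  define I where "I = generated V K G"
  have I: "polyideal V I"
    unfolding I_def by (rule polyideal_generated) (use G Hom_polyfun in blast)
  have pf: "(\<lambda>x. x v - 1) \<in> polyfun V" by (intro polyfun_diff polyfun.intros V)
  have mem: "(\<lambda>x. 1) \<in> adjoin V I (\<lambda>x. x v - 1)"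
  proof (rule ccontr)
    assume "\<not> ?thesis"
    from polyideal_common_zero[OF V(1) polyideal_adjoin(1)[OF I pf] this] obtain a
      where a: "\<And>h. h \<in> adjoin V I (\<lambda>x. x v - 1) \<Longrightarrow> h a = 0" by blast
    have "G j a = 0" if "j \<in> K" for j
    proof -
      have "G j \<in> I" unfolding I_def
        by (rule generatedI[where q = "\<lambda>i _. if i = j then 1 else 0"])
           (use that K in \<open>auto simp: if_distrib if_distribR sum.delta intro: polyfun.const cong: if_cong\<close>)
      then show ?thesis using a polyideal_adjoin(2)[OF I pf] by blast
    qed
    then have "a v = 0" using nz V unfolding no_nonzero_zero_def by blast
    moreover have "a v - 1 = 0" using a[OF polyideal_adjoin(3)[OF I pf]] .
    ultimately show False by simp
  qed
  obtain g r where g: "\<And>x. 1 = g x + r x * (x v - 1)" "g \<in> I" "r \<in> polyfun V"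
    by (rule adjoinE[OF mem]) (rule that)
  obtain q where q: "\<And>j. j \<in> K \<Longrightarrow> q j \<in> polyfun V" "\<And>x. g x = (\<Sum>j\<in>K. q j x * G j x)"
    by (rule generatedE[OF g(2)[unfolded I_def]]) (rule that)
  have one: "(\<Sum>j\<in>K. q j x * G j x) + r x * (x v - 1) = 1" for x
    using g(1)[of x] unfolding q(2) by (rule sym)
  have "\<forall>j\<in>K. \<exists>N p. (\<forall>m. p m \<in> Hom V m) \<and> (\<forall>x. q j x = (\<Sum>m\<le>N. p m x))"
    using q polyfun_homogeneous_components[OF V(1)] by metis
  then obtain N p where p: "\<And>j m. j \<in> K \<Longrightarrow> p j m \<in> Hom V m"
    "\<And>j x. j \<in> K \<Longrightarrow> q j x = (\<Sum>m\<le>N j. p j m x)" by metis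
  define M where "M = Max (insert 0 (N ` K))"
  have NM: "N j \<le> M" if "j \<in> K" for j using that K by (auto simp: M_def)
  show ?thesis
  \<comment> \<open>The \<open>+ 1\<close> keeps \<open>n - d - m\<close> positive, so that both
    sides vanish where \<open>x v = 0\<close> and the division is impossible.\<close>
  proof (intro exI[of _ "M + d + 1"] conjI allI impI)
    fix n assume n: "n \<ge> M + d + 1"
    define h where "h j x = (\<Sum>m\<le>N j. x v ^ (n - d - m) * p j m x)" for j x
    have "h j \<in> Hom V (n - d)" if "j \<in> K" for j
      unfolding h_def[abs_def]
    proof (rule Hom_sum)
      fix m assume "m \<in> {..N j}"
      then have "n - d - m + m = n - d" using NM[OF that] n by simp
      then show "(\<lambda>x. x v ^ (n - d - m) * p j m x) \<in> Hom V (n - d)"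
        using Hom_mult[OF V(1) Hom_var_power[OF V] p(1)[OF that]] by metis
    qed
    moreover have "x v ^ n = (\<Sum>j\<in>K. h j x * G j x)" for x
    proof (cases "x v = 0")
      case True
      have "h j x = 0" if "j \<in> K" for j
        unfolding h_def using True n NM[OF that] by (intro sum.neutral) auto
      with True n show ?thesis by simp
    next
      case False
      define y where "y = (\<lambda>w. (1 / x v) * x w)"
      have "x v ^ n = x v ^ n * (\<Sum>j\<in>K. q j y * G j y)"
        using one[of y] False by (simp add: y_def)
      also have "\<dots> = (\<Sum>j\<in>K. h j x * G j x)"
        unfolding sum_distrib_left
      proof (intro sum.cong refl, goal_cases)
        case (1 j)
        have "q j y = (\<Sum>m\<le>N j. (1 / x v) ^ m * p j m x)"
          unfolding p(2)[OF 1] y_def by (rule sum.cong[OF refl]) (rule Hom_scaling[OF p(1)[OF 1]])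
        then have "x v ^ (n - d) * q j y = (\<Sum>m\<le>N j. x v ^ (n - d) * ((1 / x v) ^ m * p j m x))"
          by (simp add: sum_distrib_left)
        also have "\<dots> = h j x"
          unfolding h_def
        proof (intro sum.cong refl, goal_cases)
          case (1 m)
          then have "x v ^ (n - d) = x v ^ (n - d - m) * x v ^ m"
            using NM[OF \<open>j \<in> K\<close>] n by (simp flip: power_add)
          with False show ?case by (simp add: power_divide)
        qed
        finally have "x v ^ (n - d) * q j y = h j x" .
        moreover have "x v ^ d * G j y = G j x"
          unfolding y_def using Hom_scaling[OF G[OF 1], of "1 / x v" x] False by (simp add: power_divide)
        moreover have "x v ^ n = x v ^ (n - d) * x v ^ d"
          using n by (simp flip: power_add)
        ultimately show ?case by (simp add: algebra_simps)
      qed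
      finally show ?thesis .
    qed
    ultimately show "\<exists>h. (\<forall>j\<in>K. h j \<in> Hom V (n - d)) \<and> (\<forall>x. x v ^ n = (\<Sum>j\<in>K. h j x * G j x))"
      by blast
  qed simp
qed

text \<open>The ideal of the \<open>G j\<close> contains all forms of degree at least
  \<open>D\<close>, that is, a power of the irrelevant ideal, with homogeneous cofactors. The clause
  \<open>D \<ge> d\<close> protects \<open>n - d\<close> from truncation.\<close>

definition irrelevant_from :: "'v set \<Rightarrow> 'j set \<Rightarrow> nat \<Rightarrow> ('j \<Rightarrow> ('v \<Rightarrow> complex) \<Rightarrow> complex) \<Rightarrow> nat \<Rightarrow> bool" where
  "irrelevant_from V K d G D \<longleftrightarrow> D \<ge> d \<and>
     (\<forall>n\<ge>D. \<forall>\<alpha>\<in>exps V n. \<exists>h. (\<forall>j\<in>K. h j \<in> Hom V (n - d)) \<and> (\<forall>x. mpow V \<alpha> x = (\<Sum>j\<in>K. h j x * G j x)))"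

text \<open>Pigeonhole: a monomial of degree above \<open>sum N V\<close> contains some variable at
  least \<open>N v\<close> times, and that power is already in the ideal.\<close>

lemma homogeneous_nullstellensatz:
  assumes V: "finite V" and K: "finite K" and G: "\<And>j. j \<in> K \<Longrightarrow> G j \<in> Hom V d"
    and nz: "no_nonzero_zero V K G"
  obtains D where "irrelevant_from V K d G D"
proof -
  have "\<forall>v\<in>V. \<exists>N\<ge>d. \<forall>n\<ge>N. \<exists>h. (\<forall>j\<in>K. h j \<in> Hom V (n - d)) \<and> (\<forall>x. x v ^ n = (\<Sum>j\<in>K. h j x * G j x))"
    using coordinate_power_in_ideal[OF V _ K G nz] by blast
  then obtain N where N: "\<And>v. v \<in> V \<Longrightarrow> N v \<ge> d"
    "\<And>v n. v \<in> V \<Longrightarrow> n \<ge> N v \<Longrightarrow> \<exists>h. (\<forall>j\<in>K. h j \<in> Hom V (n - d)) \<and> (\<forall>x. x v ^ n = (\<Sum>j\<in>K. h j x * G j x))"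
    by metis
  define D where "D = sum N V + d + 1"
  have "\<exists>h. (\<forall>j\<in>K. h j \<in> Hom V (n - d)) \<and> (\<forall>x. mpow V \<alpha> x = (\<Sum>j\<in>K. h j x * G j x))"
    if "n \<ge> D" "\<alpha> \<in> exps V n" for n \<alpha>
  proof -
    have "\<exists>v\<in>V. N v \<le> \<alpha> v"
    proof (rule ccontr)
      assume "\<not> ?thesis"
      then have "sum \<alpha> V \<le> sum N V" by (intro sum_mono) auto
      with that show False by (simp add: exps_def D_def)
    qed
    then obtain v where v: "v \<in> V" "N v \<le> \<alpha> v" by blast
    from N(2)[OF v] obtain h where h: "\<And>j. j \<in> K \<Longrightarrow> h j \<in> Hom V (\<alpha> v - d)"
      "\<And>x. x v ^ \<alpha> v = (\<Sum>j\<in>K. h j x * G j x)" by blast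
    define \<beta> where "\<beta> = \<alpha>(v := 0)"
    have s: "sum \<alpha> V = \<alpha> v + sum \<beta> V"
    proof -
      have "sum \<beta> (V - {v}) = sum \<alpha> (V - {v})" by (intro sum.cong) (auto simp: \<beta>_def)
      then show ?thesis using v V by (simp add: sum.remove[of V v] \<beta>_def)
    qed
    have \<beta>: "\<beta> \<in> exps V (n - \<alpha> v)" using that(2) s by (auto simp: exps_def \<beta>_def)
    have m: "mpow V \<alpha> x = mpow V \<beta> x * x v ^ \<alpha> v" for x
    proof -
      have "(\<Prod>w\<in>V - {v}. x w ^ \<beta> w) = (\<Prod>w\<in>V - {v}. x w ^ \<alpha> w)"
        by (intro prod.cong) (auto simp: \<beta>_def)
      then show ?thesis using v V by (simp add: mpow_def prod.remove[of V v] \<beta>_def)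
    qed
    have deg: "n - \<alpha> v + (\<alpha> v - d) = n - d" using N(1)[OF v(1)] v(2) s that(2) by (auto simp: exps_def)
    show ?thesis
    proof (intro exI[of _ "\<lambda>j x. mpow V \<beta> x * h j x"] conjI ballI allI)
      fix j assume "j \<in> K"
      from Hom_mult[OF V Hom_mpow[OF V \<beta>] h(1)[OF this]] deg
      show "(\<lambda>x. mpow V \<beta> x * h j x) \<in> Hom V (n - d)" by simp
    qed (simp add: m h(2) sum_distrib_left mult.assoc)
  qed
  then show ?thesis using that[of D] by (auto simp: irrelevant_from_def D_def)
qed

section \<open>Forms without a nonzero common zero\<close>

definition below :: "'v set \<Rightarrow> nat \<Rightarrow> ('v \<Rightarrow> nat) set" where
  "below V D = {\<gamma>. (\<forall>v. v \<notin> V \<longrightarrow> \<gamma> v = 0) \<and> sum \<gamma> V < D}"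

lemma finite_below: "finite V \<Longrightarrow> finite (below V D)"
proof -
  assume "finite V"
  then have "finite (\<Union>n<D. exps V n)" by simp
  moreover have "below V D \<subseteq> (\<Union>n<D. exps V n)" by (auto simp: below_def exps_def)
  ultimately show ?thesis by (rule finite_subset[rotated])
qed

definition gen_prod :: "'v set \<Rightarrow> 'j set \<Rightarrow> ('j \<Rightarrow> ('v \<Rightarrow> complex) \<Rightarrow> complex) \<Rightarrow>
    ('j \<Rightarrow> nat) \<times> ('v \<Rightarrow> nat) \<Rightarrow> ('v \<Rightarrow> complex) \<Rightarrow> complex" where
  "gen_prod V K G = (\<lambda>(\<beta>, \<gamma>) x. mpow K \<beta> (\<lambda>j. G j x) * mpow V \<gamma> x)"

text \<open>The monomials of degree below \<open>D\<close> generate all polynomials as a module over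
  the polynomials in \<open>G\<close>. Each rewriting step extracts one \<open>G j\<close> and
  lowers the degree by \<open>d \<ge> 1\<close>, so no exponent of a \<open>G j\<close> exceeds
  \<open>n\<close>.\<close>

lemma monomial_in_span_of_generators:
  assumes V: "finite V" and K: "finite K" and d: "d \<ge> 1" and irr: "irrelevant_from V K d G D"
    and "\<alpha> \<in> exps V n"
  shows "mpow V \<alpha> \<in> lin (cube K n \<times> below V D) (gen_prod V K G)"
  using assms(5)
proof (induction n arbitrary: \<alpha> rule: less_induct)
  case (less n)
  have fin: "finite (cube K n \<times> below V D)" using finite_below[OF V] K by simp
  show ?case
  proof (cases "n < D")
    case True
    then have "(\<lambda>_. 0, \<alpha>) \<in> cube K n \<times> below V D"
      using less.prems by (auto simp: exps_def below_def cube_def)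
    from lin_base[OF fin this, of "gen_prod V K G"] show ?thesis
      by (simp add: gen_prod_def)
  next
    case False
    then obtain h where h: "\<forall>j\<in>K. h j \<in> Hom V (n - d)"
      "\<And>x. mpow V \<alpha> x = (\<Sum>j\<in>K. h j x * G j x)"
      using irr less.prems unfolding irrelevant_from_def by (meson not_less)
    have n: "n \<ge> d" using False irr by (simp add: irrelevant_from_def)
    have "(\<lambda>x. h j x * G j x) \<in> lin (cube K n \<times> below V D) (gen_prod V K G)" if j: "j \<in> K" for j
    proof (rule lin_mult[where I = "cube K (n - d) \<times> below V D" and b = "gen_prod V K G"
          and J = "{()}" and b' = "\<lambda>_. G j"])
      have "h j \<in> lin (exps V (n - d)) (mpow V)" using h(1) j by (simp add: Hom_def)
      then show "h j \<in> lin (cube K (n - d) \<times> below V D) (gen_prod V K G)"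
        by (rule lin_trans) (rule less.IH, use n d in auto)
      show "G j \<in> lin {()} (\<lambda>_. G j)" by (rule lin_base) auto
      fix i and u :: unit assume i: "i \<in> cube K (n - d) \<times> below V D"
      obtain \<beta> \<gamma> where [simp]: "i = (\<beta>, \<gamma>)" by (cases i)
      define \<delta> where "\<delta> = (\<lambda>w. \<beta> w + (if w = j then 1 else 0 :: nat))"
      have "\<beta> w + 1 \<le> n" if "w \<in> K" for w
      proof -
        have "\<beta> w \<le> n - d" using i that by (auto simp: cube_def)
        then show ?thesis using n d by linarith
      qed
      then have "(\<delta>, \<gamma>) \<in> cube K n \<times> below V D"
        using i j by (auto simp: cube_def \<delta>_def Suc_le_eq dest: less_imp_le)
      from lin_base[OF fin this, of "gen_prod V K G"]
      have "gen_prod V K G (\<delta>, \<gamma>) \<in> lin (cube K n \<times> below V D) (gen_prod V K G)" .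
      moreover have "gen_prod V K G (\<delta>, \<gamma>) = (\<lambda>x. gen_prod V K G i x * G j x)"
        using mpow_unit[OF K j, of 1]
        by (simp add: gen_prod_def \<delta>_def mpow_add fun_eq_iff)
      ultimately show "(\<lambda>x. gen_prod V K G i x * G j x) \<in> lin (cube K n \<times> below V D) (gen_prod V K G)"
        by simp
    qed
    then have "(\<lambda>x. \<Sum>j\<in>K. h j x * G j x) \<in> lin (cube K n \<times> below V D) (gen_prod V K G)"
      by (rule lin_sum)
    moreover have "mpow V \<alpha> = (\<lambda>x. \<Sum>j\<in>K. h j x * G j x)" using h(2) by auto
    ultimately show ?thesis by simp
  qed
qed

lemma cube_monomial_in_span_of_generators:
  assumes V: "finite V" and K: "finite K" and d: "d \<ge> 1" and irr: "irrelevant_from V K d G D"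
    and "\<alpha> \<in> cube V n"
  shows "mpow V \<alpha> \<in> lin (cube K (card V * n) \<times> below V D) (gen_prod V K G)"
proof -
  have "sum \<alpha> V \<le> card V * n" using assms(5) sum_bounded_above[of V \<alpha> n] by (auto simp: cube_def)
  then have "cube K (sum \<alpha> V) \<times> below V D \<subseteq> cube K (card V * n) \<times> below V D"
    using cube_mono[of "sum \<alpha> V"] by auto
  moreover have "\<alpha> \<in> exps V (sum \<alpha> V)" using assms(5) by (auto simp: exps_def cube_def)
  ultimately show ?thesis
    using lin_mono[OF _ _ monomial_in_span_of_generators[OF V K d irr]] finite_below[OF V] K
    by (metis finite_cube finite_cartesian_product)
qed

text \<open>Otherwise the \<open>(n + 1) ^ card V\<close> monomials of a cube would lie in the span
  of a number of generators that grows only like \<open>n ^ card K\<close>.\<close>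

lemma few_forms_have_nonzero_zero:
  assumes V: "finite V" and K: "finite K" and card: "card K < card V" and d: "d \<ge> 1"
    and G: "\<And>j. j \<in> K \<Longrightarrow> G j \<in> Hom V d"
  shows "\<not> no_nonzero_zero V K G"
proof
  assume "no_nonzero_zero V K G"
  from homogeneous_nullstellensatz[OF V K G this] obtain D where irr: "irrelevant_from V K d G D" by blast
  define k where "k = card V"
  define p where "p = card K"
  define g where "g = card (below V D)"
  \<comment> \<open>Makes \<open>(k * (n + 1)) ^ p * g\<close> equal to
    \<open>n * (n + 1) ^ p\<close>, just below \<open>(n + 1) ^ (p + 1)\<close>.\<close>
  define n where "n = k ^ p * g"
  have k: "k \<ge> 1" using card by (simp add: k_def)
  have "card (cube K (k * n) \<times> below V D) = (k * n + 1) ^ p * g"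
    using K by (simp add: card_cartesian_product card_cube p_def g_def)
  also have "\<dots> \<le> (k * (n + 1)) ^ p * g"
    using k by (intro mult_right_mono power_mono) (auto simp: algebra_simps)
  also have "\<dots> = n * (n + 1) ^ p" 
    by (subst power_mult_distrib) (simp only: n_def mult_ac)
  also have "\<dots> < (n + 1) * (n + 1) ^ p" by (intro mult_strict_right_mono) auto
  also have "\<dots> = (n + 1) ^ (p + 1)" by simp
  also have "\<dots> \<le> (n + 1) ^ k" using card by (intro power_increasing) (auto simp: k_def p_def)
  also have "\<dots> = card (cube V n)" using V by (simp add: card_cube k_def)
  finally have lt: "card (cube K (k * n) \<times> below V D) < card (cube V n)" .
  have fin: "finite (cube K (k * n) \<times> below V D)" using finite_below[OF V] K by simp
  obtain c where c: "\<exists>\<alpha>\<in>cube V n. c \<alpha> \<noteq> 0" "\<And>x. (\<Sum>\<alpha>\<in>cube V n. c \<alpha> * mpow V \<alpha> x) = 0"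
    by (rule lin_dependent[OF fin finite_cube[OF V] lt, of "mpow V" "gen_prod V K G"])
       (auto intro: cube_monomial_in_span_of_generators[OF V K d irr, folded k_def] that)
  have "c \<alpha> = 0" if "\<alpha> \<in> cube V n" for \<alpha>
    by (rule mpow_independent[OF V finite_cube[OF V] _ c(2) that]) (auto simp: cube_def)
  with c(1) show False by blast
qed

lemma poly_zero_coeffs:
  fixes q :: "nat \<Rightarrow> complex"
  assumes "\<And>s. (\<Sum>m\<le>N. s ^ m * q m) = 0" "m \<le> N"
  shows "q m = 0"
proof -
  define p where "p = (\<Sum>m\<le>N. monom (q m) m)"
  have "poly p s = 0" for s using assms(1)[of s] by (simp add: p_def poly_sum poly_monom mult.commute)
  then have "p = 0" using poly_all_0_iff_0 by blast
  then have "coeff p m = 0" by simp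
  then show ?thesis using assms(2) by (simp add: p_def coeff_sum coeff_monom)
qed

text \<open>
  A homogeneous component \<open>p\<^sub>m\<close> of \<open>p\<close> with \<open>p\<^sub>m v \<noteq> 0\<close> also vanishes on the image of \<open>F\<close>; the
  composition of \<open>F\<close> with the projection along \<open>v\<close> would then be one form too few without a
  nonzero zero.
\<close>
lemma forms_algebraically_independent:
  assumes V: "finite V" and d: "d \<ge> 1" and F: "\<And>j. j \<in> V \<Longrightarrow> F j \<in> Hom V d"
    and nz: "no_nonzero_zero V V F" and p: "p \<in> polyfun V" and vanish: "\<And>x. p (\<lambda>j. F j x) = 0"
  shows "p y = 0"
proof -
  obtain N q where q: "\<And>m. q m \<in> Hom V m" "\<And>x. p x = (\<Sum>m\<le>N. q m x)"
    by (rule polyfun_homogeneous_components[OF V p]) (rule that)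
  have qF: "q m (\<lambda>j. F j x) = 0" if "m \<le> N" for m x
  proof (rule poly_zero_coeffs[where q = "\<lambda>m. q m (\<lambda>j. F j x)", OF _ that])
    fix s :: complex
    \<comment> \<open>Scaling \<open>x\<close> by a \<open>d\<close>-th root of \<open>s\<close>
      scales every \<open>F j x\<close> by \<open>s\<close>.\<close>
    obtain t where t: "t ^ d = s"
    proof (cases "s = 0")
      case True
      then show ?thesis using that[of 0] d by simp
    next
      case False
      then show ?thesis using that[of "exp (Ln s / of_nat d)"] d
        by (simp flip: exp_of_nat_mult)
    qed
    have "0 = p (\<lambda>j. F j (\<lambda>v. t * x v))" by (simp add: vanish)
    also have "\<dots> = p (\<lambda>j. s * F j x)"
      by (rule polyfun_cong[OF p]) (simp add: Hom_scaling[OF F] t)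
    also have "\<dots> = (\<Sum>m\<le>N. s ^ m * q m (\<lambda>j. F j x))"
      unfolding q(2) by (rule sum.cong[OF refl]) (rule Hom_scaling[OF q(1)])
    finally show "(\<Sum>m\<le>N. s ^ m * q m (\<lambda>j. F j x)) = 0" by simp
  qed
  have "q m v = 0" if m: "m \<le> N" for m v
  proof (rule ccontr)
    assume nonzero: "q m v \<noteq> 0"
    show False
    proof (cases "m = 0")
      case True
      \<comment> \<open>As \<open>0 ^ 0 = 1\<close>, scaling by 0 shows that a form of degree 0 is
        constant.\<close>
      have "q 0 v = q 0 (\<lambda>j. F j v)"
        using Hom_scaling[OF q(1)[of 0], of 0 v] Hom_scaling[OF q(1)[of 0], of 0 "\<lambda>j. F j v"] by simp
      with nonzero qF[of 0 v] True show False by simp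
    next
      case False
      have "\<exists>j\<in>V. v j \<noteq> 0"
      proof (rule ccontr)
        assume "\<not> ?thesis"
        then have "q m v = q m (\<lambda>j. 0 * v j)"
          by (intro polyfun_cong[OF Hom_polyfun[OF q(1)]]) auto
        also have "\<dots> = 0" using Hom_scaling[OF q(1), of m 0 v] False by simp
        finally show False using nonzero by simp
      qed
      then obtain i where i: "i \<in> V" "v i \<noteq> 0" by blast
      define G where "G j x = F j x - v j / v i * F i x" for j x
      have "\<not> no_nonzero_zero V (V - {i}) G"
      proof (rule few_forms_have_nonzero_zero[OF V _ _ d])
        show "card (V - {i}) < card V" using i V by (meson card_Diff1_less)
        fix j assume "j \<in> V - {i}"
        then show "G j \<in> Hom V d"
          unfolding G_def[abs_def] using F i by (intro Hom_diff Hom_scale) auto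
      qed (use V in auto)
      then obtain x where x: "\<And>j. j \<in> V - {i} \<Longrightarrow> G j x = 0" "\<exists>w\<in>V. x w \<noteq> 0"
        by (auto simp: no_nonzero_zero_def)
      have Fx: "F j x = F i x / v i * v j" if "j \<in> V" for j
        using x(1)[of j] that i by (cases "j = i") (auto simp: G_def field_simps)
      have "0 = q m (\<lambda>j. F j x)" using qF[OF m] by simp
      also have "\<dots> = q m (\<lambda>j. F i x / v i * v j)"
        by (rule polyfun_cong[OF Hom_polyfun[OF q(1)]]) (rule Fx)
      also have "\<dots> = (F i x / v i) ^ m * q m v" by (rule Hom_scaling[OF q(1)])
      finally have "F i x = 0" using nonzero i by simp
      then have "\<forall>j\<in>V. F j x = 0" using Fx by simp
      with nz x(2) show False by (auto simp: no_nonzero_zero_def)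
    qed
  qed
  then show ?thesis by (simp add: q(2))
qed

section \<open>Finiteness and integrality through characteristic polynomials\<close>

lemma char_poly_root_if_eigenvector:
  fixes M :: "'b \<Rightarrow> 'b \<Rightarrow> complex"
  assumes gs: "distinct gs" and e: "b \<in> set gs" "e b \<noteq> 0"
    and eigen: "\<And>a. a \<in> set gs \<Longrightarrow> (\<Sum>c\<in>set gs. M a c * e c) = t * e a"
  shows "poly (char_poly (mat (length gs) (length gs) (\<lambda>(i, j). M (gs ! i) (gs ! j)))) t = 0"
proof -
  let ?E = "length gs"
  let ?A = "mat ?E ?E (\<lambda>(i, j). M (gs ! i) (gs ! j))"
  let ?v = "vec ?E (\<lambda>i. e (gs ! i))"
  have A: "?A \<in> carrier_mat ?E ?E" by simp
  have v: "?v \<in> carrier_vec ?E" by simp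
  obtain i where i: "i < ?E" "gs ! i = b" using e(1) by (metis in_set_conv_nth)
  have "?v \<noteq> 0\<^sub>v ?E"
  proof
    assume "?v = 0\<^sub>v ?E"
    then have "vec_index ?v i = vec_index (0\<^sub>v ?E) i" by simp
    then show False using i e(2) by simp
  qed
  moreover have "?A *\<^sub>v ?v = t \<cdot>\<^sub>v ?v"
  proof (rule eq_vecI)
    fix i assume "i < dim_vec (t \<cdot>\<^sub>v ?v)"
    then have i: "i < ?E" by simp
    have "vec_index (?A *\<^sub>v ?v) i = (\<Sum>j<?E. M (gs ! i) (gs ! j) * e (gs ! j))"
      using i by (simp add: scalar_prod_def atLeast0LessThan)
    also have "\<dots> = (\<Sum>c\<in>set gs. M (gs ! i) c * e c)"
      using sum.reindex_bij_betw[OF bij_betw_nth[OF gs refl refl], of "\<lambda>c. M (gs ! i) c * e c"]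
      by simp
    also have "\<dots> = t * e (gs ! i)" using i by (intro eigen) simp
    finally show "vec_index (?A *\<^sub>v ?v) i = vec_index (t \<cdot>\<^sub>v ?v) i" using i by simp
  qed simp
  ultimately have "eigenvector ?A ?v t" unfolding eigenvector_def by simp
  then have "eigenvalue ?A t" unfolding eigenvalue_def by blast
  then show ?thesis using eigenvalue_root_char_poly[OF A] by simp
qed

text \<open>Write each monomial of degree \<open>D\<close> as a combination of the
  \<open>g j\<close> and replace \<open>g\<close> by \<open>f\<close>: this is a linear map on forms
  of degree \<open>D\<close>. If \<open>f = t g\<close> at \<open>x\<close>, the values of the
  monomials at \<open>x\<close> form an eigenvector for \<open>t\<close>. The size of the matrix
  gives finiteness, not the sharp bound.\<close>

lemma finite_singular_parameters:
  assumes V: "finite V" and K: "finite K" and irr: "irrelevant_from V K d g D"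
    and f: "\<And>j. j \<in> K \<Longrightarrow> f j \<in> Hom V d"
  shows "finite {t. \<exists>x. (\<exists>v\<in>V. x v \<noteq> 0) \<and> (\<forall>j\<in>K. f j x = t * g j x)}"
proof -
  obtain gs where gs: "distinct gs" "set gs = exps V D"
    using finite_distinct_list[OF finite_exps[OF V]] by blast
  have "\<forall>\<alpha>\<in>exps V D. \<exists>h. (\<forall>j\<in>K. h j \<in> Hom V (D - d)) \<and> (\<forall>x. mpow V \<alpha> x = (\<Sum>j\<in>K. h j x * g j x))"
    using irr by (auto simp: irrelevant_from_def)
  then obtain h where h: "\<And>\<alpha> j. \<alpha> \<in> exps V D \<Longrightarrow> j \<in> K \<Longrightarrow> h \<alpha> j \<in> Hom V (D - d)"
    "\<And>\<alpha> x. \<alpha> \<in> exps V D \<Longrightarrow> mpow V \<alpha> x = (\<Sum>j\<in>K. h \<alpha> j x * g j x)" by metis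
  have dD: "D - d + d = D" using irr by (simp add: irrelevant_from_def)
  have "(\<lambda>x. \<Sum>j\<in>K. h \<alpha> j x * f j x) \<in> Hom V D" if "\<alpha> \<in> exps V D" for \<alpha>
    using Hom_mult[OF V h(1)[OF that] f] dD by (intro Hom_sum) auto
  then have "\<forall>\<alpha>\<in>exps V D. \<exists>m. \<forall>x. (\<Sum>j\<in>K. h \<alpha> j x * f j x) = (\<Sum>\<beta>\<in>exps V D. m \<beta> * mpow V \<beta> x)"
    unfolding Hom_def lin_def by auto
  then obtain M where M: "\<And>\<alpha> x. \<alpha> \<in> exps V D \<Longrightarrow>
    (\<Sum>j\<in>K. h \<alpha> j x * f j x) = (\<Sum>\<beta>\<in>exps V D. M \<alpha> \<beta> * mpow V \<beta> x)" by metis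
  define P where "P = char_poly (mat (length gs) (length gs) (\<lambda>(i, j). M (gs ! i) (gs ! j)))"
  have "poly P t = 0" if x: "\<exists>v\<in>V. x v \<noteq> 0" "\<forall>j\<in>K. f j x = t * g j x" for t x
  proof -
    obtain v where v: "v \<in> V" "x v \<noteq> 0" using x by blast
    let ?\<gamma> = "\<lambda>w. if w = v then D else 0"
    show ?thesis unfolding P_def
    proof (rule char_poly_root_if_eigenvector[OF gs(1), where e = "\<lambda>\<alpha>. mpow V \<alpha> x"])
      show "?\<gamma> \<in> set gs" using v V gs by (auto simp: exps_def)
      show "mpow V ?\<gamma> x \<noteq> 0" using v by (simp add: mpow_unit[OF V])
      fix \<alpha> assume "\<alpha> \<in> set gs"
      then have "(\<Sum>\<beta>\<in>set gs. M \<alpha> \<beta> * mpow V \<beta> x) = (\<Sum>j\<in>K. h \<alpha> j x * f j x)"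
        using M gs by simp
      also have "\<dots> = (\<Sum>j\<in>K. t * (h \<alpha> j x * g j x))"
        using x(2) by (intro sum.cong) auto
      also have "\<dots> = t * mpow V \<alpha> x" using h(2) \<open>\<alpha> \<in> set gs\<close> gs by (simp add: sum_distrib_left)
      finally show "(\<Sum>\<beta>\<in>set gs. M \<alpha> \<beta> * mpow V \<beta> x) = t * mpow V \<alpha> x" .
    qed
  qed
  then have "{t. \<exists>x. (\<exists>v\<in>V. x v \<noteq> 0) \<and> (\<forall>j\<in>K. f j x = t * g j x)} \<subseteq> {t. poly P t = 0}" by auto
  moreover have "P \<noteq> 0"
    using degree_monic_char_poly[of "mat (length gs) (length gs) (\<lambda>(i, j). M (gs ! i) (gs ! j))" "length gs"]
    by (auto simp: P_def)
  ultimately show ?thesis using poly_roots_finite finite_subset by blast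
qed

text \<open>Stands for polynomials in one variable \<open>T\<close> over the polynomial functions of
  \<open>y\<close>; the degree in \<open>T\<close> may drop at special \<open>y\<close>.\<close>

definition polycoeffs :: "'v set \<Rightarrow> (('v \<Rightarrow> complex) \<Rightarrow> complex poly) set" where
  "polycoeffs V = {R. \<forall>j. (\<lambda>y. coeff (R y) j) \<in> polyfun V}"

lemma polycoeffs_coeff: "R \<in> polycoeffs V \<Longrightarrow> (\<lambda>y. coeff (R y) j) \<in> polyfun V"
  by (simp add: polycoeffs_def)

lemma polycoeffs_const: "(\<lambda>y. p) \<in> polycoeffs V"
  by (simp add: polycoeffs_def polyfun.const)

lemma polycoeffs_pCons: "h \<in> polyfun V \<Longrightarrow> (\<lambda>y. [:h y:]) \<in> polycoeffs V"
  unfolding polycoeffs_def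
proof (intro CollectI allI)
  fix j assume "h \<in> polyfun V"
  then show "(\<lambda>y. coeff [:h y:] j) \<in> polyfun V" by (cases j) (auto intro: polyfun.const)
qed

lemma polycoeffs_add: "R \<in> polycoeffs V \<Longrightarrow> S \<in> polycoeffs V \<Longrightarrow> (\<lambda>y. R y + S y) \<in> polycoeffs V"
  by (auto simp: polycoeffs_def intro: polyfun.add)

lemma polycoeffs_mult: "R \<in> polycoeffs V \<Longrightarrow> S \<in> polycoeffs V \<Longrightarrow> (\<lambda>y. R y * S y) \<in> polycoeffs V"
  by (auto simp: polycoeffs_def coeff_mult intro!: polyfun_sum polyfun.mult)

lemma polycoeffs_diff: "R \<in> polycoeffs V \<Longrightarrow> S \<in> polycoeffs V \<Longrightarrow> (\<lambda>y. R y - S y) \<in> polycoeffs V"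
  by (auto simp: polycoeffs_def intro: polyfun_diff)

lemma polycoeffs_sum: "(\<And>a. a \<in> A \<Longrightarrow> R a \<in> polycoeffs V) \<Longrightarrow> (\<lambda>y. \<Sum>a\<in>A. R a y) \<in> polycoeffs V"
  by (induction A rule: infinite_finite_induct) (auto intro: polycoeffs_const polycoeffs_add)

lemma polycoeffs_prod: "(\<And>a. a \<in> A \<Longrightarrow> R a \<in> polycoeffs V) \<Longrightarrow> (\<lambda>y. \<Prod>a\<in>A. R a y) \<in> polycoeffs V"
  by (induction A rule: infinite_finite_induct) (auto intro: polycoeffs_const polycoeffs_mult)

lemma char_poly_polycoeffs:
  assumes "\<And>i j. i < n \<Longrightarrow> j < n \<Longrightarrow> M i j \<in> polyfun V"
  shows "(\<lambda>y. char_poly (mat n n (\<lambda>(i, j). M i j y))) \<in> polycoeffs V"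
proof -
  have "char_poly (mat n n (\<lambda>(i, j). M i j y)) =
      (\<Sum>p | p permutes {0..<n}. signof p *
        (\<Prod>i\<in>{0..<n}. (if i = p i then [:0, 1:] else 0) - [:M i (p i) y:]))" for y
    unfolding char_poly_defs
    by (subst det_def'[of _ n], simp)
       (auto intro!: sum.cong prod.cong arg_cong2[of _ _ _ _ "(*)"] simp: permutes_in_image
         dest: permutes_in_image)
  moreover have "(\<lambda>y. (\<Sum>p | p permutes {0..<n}. signof p *
        (\<Prod>i\<in>{0..<n}. (if i = p i then [:0, 1:] else 0) - [:M i (p i) y:]))) \<in> polycoeffs V"
  proof (intro polycoeffs_sum polycoeffs_mult polycoeffs_prod polycoeffs_diff polycoeffs_const
      polycoeffs_pCons assms)
    fix p i assume "p \<in> {p. p permutes {0..<n}}" "i \<in> {0..<n}"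
    then show "i < n" "p i < n" using permutes_in_image[of p "{0..<n}" i] by auto
  qed
  ultimately show ?thesis by simp
qed

text \<open>Multiplication by \<open>u\<close> on the module generated by the monomials below
  \<open>D\<close> has a matrix with entries polynomial in \<open>F\<close>; its characteristic
  polynomial is monic and annihilates \<open>u\<close>.\<close>

lemma integral_equation:
  assumes V: "finite V" and K: "finite K" and d: "d \<ge> 1" and irr: "irrelevant_from V K d F D"
    and u: "u \<in> polyfun V"
  obtains R n where "R \<in> polycoeffs K" "\<And>y. degree (R y) = n" "\<And>y. coeff (R y) n = 1"
    "\<And>x. poly (R (\<lambda>j. F j x)) (u x) = 0"
proof -
  obtain gs where gs: "distinct gs" "set gs = below V D"
    using finite_distinct_list[OF finite_below[OF V]] by blast
  have "\<forall>\<gamma>. \<exists>N c. \<forall>x. u x * mpow V \<gamma> x = (\<Sum>i\<in>cube K N \<times> below V D. c i * gen_prod V K F i x)"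
  proof
    fix \<gamma>
    have "(\<lambda>x. u x * mpow V \<gamma> x) \<in> polyfun V" using u by (intro polyfun.mult polyfun_mpow)
    from polyfun_lin_cube[OF V this] obtain n where "(\<lambda>x. u x * mpow V \<gamma> x) \<in> lin (cube V n) (mpow V)"
      by blast
    then have "(\<lambda>x. u x * mpow V \<gamma> x) \<in> lin (cube K (card V * n) \<times> below V D) (gen_prod V K F)"
      by (rule lin_trans) (rule cube_monomial_in_span_of_generators[OF V K d irr])
    then show "\<exists>N c. \<forall>x. u x * mpow V \<gamma> x = (\<Sum>i\<in>cube K N \<times> below V D. c i * gen_prod V K F i x)"
      unfolding lin_def by auto
  qed
  then obtain N c where c: "\<And>\<gamma> x. u x * mpow V \<gamma> x =
      (\<Sum>i\<in>cube K (N \<gamma>) \<times> below V D. c \<gamma> i * gen_prod V K F i x)" by metis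
  define M where "M \<gamma> \<delta> y = (\<Sum>\<beta>\<in>cube K (N \<gamma>). c \<gamma> (\<beta>, \<delta>) * mpow K \<beta> y)" for \<gamma> \<delta> y
  have M: "M \<gamma> \<delta> \<in> polyfun K" for \<gamma> \<delta>
    unfolding M_def[abs_def] by (intro polyfun_sum polyfun.mult polyfun.const polyfun_mpow)
  define n where "n = length gs"
  define R where "R y = char_poly (mat n n (\<lambda>(i, j). M (gs ! i) (gs ! j) y))" for y
  show ?thesis
  proof (rule that)
    show "R \<in> polycoeffs K"
      unfolding R_def[abs_def] by (intro char_poly_polycoeffs M)
    show "degree (R y) = n" for y
      using degree_monic_char_poly[of "mat n n (\<lambda>(i, j). M (gs ! i) (gs ! j) y)" n] by (simp add: R_def)
    show "coeff (R y) n = 1" for y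
      using degree_monic_char_poly[of "mat n n (\<lambda>(i, j). M (gs ! i) (gs ! j) y)" n] by (simp add: R_def)
    fix x
    show "poly (R (\<lambda>j. F j x)) (u x) = 0"
      unfolding R_def n_def
    proof (rule char_poly_root_if_eigenvector[OF gs(1), where e = "\<lambda>\<gamma>. mpow V \<gamma> x"
          and M = "\<lambda>\<gamma> \<delta>. M \<gamma> \<delta> (\<lambda>j. F j x)"])
      \<comment> \<open>\<open>D \<ge> d \<ge> 1\<close> puts the monomial 1 into the list, so the
        vector of monomials is nonzero at every \<open>x\<close>, also at the origin.\<close>
      show "(\<lambda>_. 0) \<in> set gs" using irr d by (auto simp: gs below_def irrelevant_from_def)
      show "mpow V (\<lambda>_. 0) x \<noteq> 0" by simp
      fix \<gamma>
      show "(\<Sum>\<delta>\<in>set gs. M \<gamma> \<delta> (\<lambda>j. F j x) * mpow V \<delta> x) = u x * mpow V \<gamma> x"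
        unfolding c M_def sum_distrib_right gs
        by (subst sum.swap) (auto simp: sum.cartesian_product gen_prod_def intro!: sum.cong)
    qed
  qed
qed

section \<open>A relation found by counting dimensions\<close>

lemma card_below: "finite V \<Longrightarrow> card (below V (Suc b)) = (b + card V) choose b"
proof -
  assume V: "finite V"
  have "bij_betw snd (SIGMA j:{..b}. exps V j) (below V (Suc b))"
    by (rule bij_betw_byWitness[where f' = "\<lambda>\<alpha>. (sum \<alpha> V, \<alpha>)"]) (auto simp: exps_def below_def)
  from bij_betw_same_card[OF this] card_exps_le[OF V] show ?thesis by simp
qed

text \<open>Degree at most \<open>c\<close> in the parameter, but exactly \<open>m\<close> in
  \<open>x\<close>: the two gradings are kept apart because only the degree in the parameter is to
  be bounded sharply.\<close>

definition Bihom :: "'v set \<Rightarrow> nat \<Rightarrow> nat \<Rightarrow> (complex \<times> ('v \<Rightarrow> complex) \<Rightarrow> complex) set" where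
  "Bihom V c m = lin ({..c} \<times> exps V m) (\<lambda>(e, \<alpha>) (t, x). t ^ e * mpow V \<alpha> x)"

lemma Bihom_mult:
  assumes "finite V" "g \<in> Bihom V c m" "h \<in> Bihom V c' m'"
  shows "(\<lambda>z. g z * h z) \<in> Bihom V (c + c') (m + m')"
  using assms(2,3) unfolding Bihom_def
proof (rule lin_mult)
  fix i j assume ij: "i \<in> {..c} \<times> exps V m" "j \<in> {..c'} \<times> exps V m'"
  obtain e \<alpha> e' \<alpha>' where [simp]: "i = (e, \<alpha>)" "j = (e', \<alpha>')" by (cases i, cases j)
  let ?B = "\<lambda>(e, \<alpha>) (t, x). t ^ e * mpow V \<alpha> x"
  have "?B (e + e', \<lambda>v. \<alpha> v + \<alpha>' v) \<in> lin ({..c + c'} \<times> exps V (m + m')) ?B"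
    using ij assms(1) by (intro lin_base) (auto intro: exps_add)
  moreover have "?B (e + e', \<lambda>v. \<alpha> v + \<alpha>' v) = (\<lambda>z. ?B i z * ?B j z)"
    by (auto simp: fun_eq_iff mpow_add power_add)
  ultimately show "(\<lambda>z. ?B i z * ?B j z) \<in> lin ({..c + c'} \<times> exps V (m + m')) ?B" by simp
qed

lemma Bihom_param: "finite V \<Longrightarrow> (\<lambda>(t, x). t ^ a) \<in> Bihom V a 0"
proof -
  assume V: "finite V"
  let ?B = "\<lambda>(e, \<alpha>) (t, x). t ^ e * mpow V \<alpha> x"
  have "?B (a, \<lambda>_. 0) \<in> lin ({..a} \<times> exps V 0) ?B"
    using V by (intro lin_base finite_cartesian_product finite_exps) (auto simp: exps_def)
  then show ?thesis by (simp add: Bihom_def)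
qed

lemma Bihom_Hom: "finite V \<Longrightarrow> h \<in> Hom V m \<Longrightarrow> (\<lambda>(t, x). h x) \<in> Bihom V 0 m"
proof -
  assume V: "finite V" and "h \<in> Hom V m"
  then obtain c where c: "\<And>x. h x = (\<Sum>\<alpha>\<in>exps V m. c \<alpha> * mpow V \<alpha> x)"
    by (auto simp: Hom_def lin_def)
  have "(\<Sum>i\<in>{0} \<times> exps V m. c (snd i) * (case i of (e, \<alpha>) \<Rightarrow> \<lambda>(t, x). t ^ e * mpow V \<alpha> x) z) = (case z of (t, x) \<Rightarrow> h x)" for z
    by (cases z) (simp add: c sum.cartesian_product')
  then show ?thesis unfolding Bihom_def by (intro linI[where c = "\<lambda>i. c (snd i)"]) simp
qed

lemma Bihom_mono: "finite V \<Longrightarrow> c \<le> c' \<Longrightarrow> h \<in> Bihom V c m \<Longrightarrow> h \<in> Bihom V c' m"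
  unfolding Bihom_def by (rule lin_mono) auto

lemma Bihom_pencil:
  assumes V: "finite V" and f: "f \<in> Hom V d" and g: "g \<in> Hom V d"
  shows "(\<lambda>(t, x). f x - t * g x) \<in> Bihom V 1 d"
proof -
  have "(\<lambda>z. (case z of (t, x) \<Rightarrow> t ^ 1) * (case z of (t, x) \<Rightarrow> g x)) \<in> Bihom V (1 + 0) (0 + d)"
    by (intro Bihom_mult Bihom_param Bihom_Hom V g)
  moreover have "(\<lambda>(t, x). f x) \<in> Bihom V 1 d"
    by (rule Bihom_mono[OF V _ Bihom_Hom[OF V f]]) simp
  ultimately have "(\<lambda>z. (case z of (t, x) \<Rightarrow> f x) - (case z of (t, x) \<Rightarrow> t ^ 1) * (case z of (t, x) \<Rightarrow> g x)) \<in> Bihom V 1 d"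
    unfolding Bihom_def by (intro lin_diff) auto
  then show ?thesis by (simp add: case_prod_unfold)
qed

lemma Bihom_power:
  assumes "finite V" "h \<in> Bihom V c m"
  shows "(\<lambda>z. h z ^ n) \<in> Bihom V (n * c) (n * m)"
proof (induction n)
  case 0
  then show ?case using Bihom_param[OF assms(1), of 0] by (simp add: case_prod_unfold)
next
  case (Suc n)
  then show ?case using Bihom_mult[OF assms Suc.IH] by simp
qed

lemma Bihom_mpow:
  assumes V: "finite V" and S: "finite S" and F: "\<And>j. j \<in> S \<Longrightarrow> F j \<in> Bihom V c d"
  shows "(\<lambda>z. mpow S \<beta> (\<lambda>j. F j z)) \<in> Bihom V (sum \<beta> S * c) (sum \<beta> S * d)"
  unfolding mpow_def using S F
proof (induction S rule: finite_induct)
  case empty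
  then show ?case using Bihom_param[OF V, of 0] by (simp add: case_prod_unfold)
next
  case (insert j S)
  from Bihom_mult[OF V Bihom_power[OF V, of "F j" c d "\<beta> j"] insert.IH] insert.prems insert.hyps
  show ?case by (simp add: algebra_simps)
qed

lemma power_le_binomial: "b ^ k \<le> fact k * ((b + k) choose k :: nat)"
proof (induction k)
  case (Suc k)
  have "b ^ Suc k \<le> (b + Suc k) * (fact k * ((b + k) choose k))"
    unfolding power_Suc using Suc by (intro mult_mono) auto
  also have "\<dots> = fact k * (Suc k * ((b + Suc k) choose Suc k))"
    using Suc_times_binomial_eq[of "b + k" k] by (simp add: algebra_simps)
  also have "\<dots> = fact (Suc k) * ((b + Suc k) choose Suc k)" by (simp add: algebra_simps)
  finally show ?case .
qed simp

text \<open>Multiplied by \<open>fact k\<close>, the left side grows like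
  \<open>b * k * (d * b) ^ (k - 1) = L * b ^ k\<close> and the right side like
  \<open>(L + 1) * b ^ k\<close>, so one extra power of the parameter wins for large
  \<open>b\<close>.\<close>

lemma counting_inequality:
  fixes k d :: nat
  assumes k: "k \<ge> 1"
  defines "L \<equiv> k * d ^ (k - 1)"
  shows "\<exists>b. (L + b + 1) * ((d * b + k - 1) choose (d * b)) < (L + 1) * ((b + k) choose b)"
proof -
  have "(\<lambda>b. real k * (real (L + 1) / real b + 1) * (real d + real k / real b) ^ (k - 1))
      \<longlonglongrightarrow> real k * (0 + 1) * (real d + 0) ^ (k - 1)"
    by (intro tendsto_intros lim_const_over_n)
  then have "(\<lambda>b. real k * (real (L + 1) / real b + 1) * (real d + real k / real b) ^ (k - 1)) \<longlonglongrightarrow> real L"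
    by (simp add: L_def)
  then have "\<forall>\<^sub>F b in sequentially. real k * (real (L + 1) / real b + 1) * (real d + real k / real b) ^ (k - 1) < real L + 1"
    by (rule order_tendstoD) simp
  moreover have "\<forall>\<^sub>F b in sequentially. b \<ge> (1::nat)" by (rule eventually_ge_at_top)
  ultimately have "\<forall>\<^sub>F b in sequentially. real k * (real (L + 1) / real b + 1) * (real d + real k / real b) ^ (k - 1) < real L + 1 \<and> b \<ge> (1::nat)"
    by eventually_elim simp
  then obtain b :: nat where b: "real k * (real (L + 1) / real b + 1) * (real d + real k / real b) ^ (k - 1) < real L + 1" "b \<ge> 1"
    unfolding eventually_sequentially by blast
  have bk: "real b ^ k = real b * real b ^ (k - 1)" using k by (cases k) auto
  have e1: "(real (L + 1) / real b + 1) * real b = real (L + b + 1)" using b(2) by (simp add: field_simps)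
  have e2: "(real d + real k / real b) * real b = real (d * b + k)" using b(2) by (simp add: field_simps)
  have e3: "real k * p * e ^ (k - 1) * real b ^ k = real k * (p * real b) * (e * real b) ^ (k - 1)" for p e :: real
    unfolding bk power_mult_distrib by (simp only: mult_ac)
  have "real k * (real (L + 1) / real b + 1) * (real d + real k / real b) ^ (k - 1) * real b ^ k
      = real k * real (L + b + 1) * real (d * b + k) ^ (k - 1)"
    unfolding e3 e1 e2 ..
  moreover have "real k * (real (L + 1) / real b + 1) * (real d + real k / real b) ^ (k - 1) * real b ^ k < (real L + 1) * real b ^ k"
    using b by (intro mult_strict_right_mono) auto
  ultimately have "real (k * (L + b + 1) * (d * b + k) ^ (k - 1)) < real ((L + 1) * b ^ k)"
    by (simp add: algebra_simps)
  then have ineq: "k * (L + b + 1) * (d * b + k) ^ (k - 1) < (L + 1) * b ^ k"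
    by (simp only: of_nat_less_iff)
  have fk: "fact k = k * fact (k - 1)" using k by (cases k) auto
  have "((d * b + k - 1) choose (d * b)) = ((d * b + k - 1) choose (k - 1))"
    using k binomial_symmetric[of "d * b" "d * b + k - 1"] by simp
  then have "fact k * ((L + b + 1) * ((d * b + k - 1) choose (d * b)))
      = k * (L + b + 1) * (((d * b + k - 1) choose (k - 1)) * fact (k - 1))"
    by (simp only: fk mult_ac)
  also have "\<dots> \<le> k * (L + b + 1) * (d * b + k - 1) ^ (k - 1)"
    by (intro mult_left_mono binomial_fact_pow) auto
  also have "\<dots> \<le> k * (L + b + 1) * (d * b + k) ^ (k - 1)"
    by (intro mult_left_mono power_mono) auto
  also note ineq
  also have "(L + 1) * b ^ k \<le> (L + 1) * (fact k * ((b + k) choose k))"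
    by (intro mult_left_mono power_le_binomial) auto
  also have "((b + k) choose k) = ((b + k) choose b)"
    using binomial_symmetric[of k "b + k"] by simp
  also have "(L + 1) * (fact k * ((b + k) choose b)) = fact k * ((L + 1) * ((b + k) choose b))"
    by (rule mult.left_commute)
  finally show ?thesis by (intro exI[of _ b]) (metis mult_less_cancel1)
qed

text \<open>
  The sharp bound enters here: for large \<open>b\<close> the polynomials of degree at most \<open>L = k d\<^bsup>k-1\<^esup>\<close> in \<open>t\<close>
  and homogeneous of degree \<open>b\<close> in \<open>(y, T)\<close> span a space of dimension about \<open>(L + 1) b\<^sup>k / k!\<close>, while
  substituting \<open>y = f - t g\<close> and \<open>T = u\<close> lands in one of dimension about \<open>L b\<^sup>k / k!\<close>.
\<close>
lemma pencil_relation: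
  assumes V: "finite V" "V \<noteq> {}" and f: "\<And>j. j \<in> V \<Longrightarrow> f j \<in> Hom V d"
    and g: "\<And>j. j \<in> V \<Longrightarrow> g j \<in> Hom V d" and u: "u \<in> Hom V d"
  defines "L \<equiv> card V * d ^ (card V - 1)"
  obtains b C where "\<exists>a\<le>L. \<exists>\<beta>\<in>below V (Suc b). C a \<beta> \<noteq> 0"
    "\<And>t x. (\<Sum>a\<le>L. \<Sum>\<beta>\<in>below V (Suc b).
        C a \<beta> * t ^ a * mpow V \<beta> (\<lambda>j. f j x - t * g j x) * u x ^ (b - sum \<beta> V)) = 0"
proof -
  define k where "k = card V"
  have k: "k \<ge> 1" using V by (simp add: k_def Suc_le_eq card_gt_0_iff)
  from counting_inequality[OF k, of d] obtain b
    where b: "(L + b + 1) * ((d * b + k - 1) choose (d * b)) < (L + 1) * ((b + k) choose b)"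
    unfolding L_def k_def by blast
  let ?I = "{..L + b} \<times> exps V (d * b)"
  let ?A = "{..L} \<times> below V (Suc b)"
  \<comment> \<open>The power of \<open>u\<close> pads every product to degree \<open>d * b\<close>
    in \<open>x\<close>. At most \<open>b\<close> pencil factors occur, each of degree 1 in
    \<open>t\<close>, whence the bound \<open>L + b\<close>.\<close>
  define h where "h = (\<lambda>(a, \<beta>) (t, x). t ^ a * mpow V \<beta> (\<lambda>j. f j x - t * g j x) * u x ^ (b - sum \<beta> V))"
  have "card ?I = (L + b + 1) * ((d * b + k - 1) choose (d * b))"
    using V by (simp add: card_cartesian_product card_exps k_def)
  moreover have "card ?A = (L + 1) * ((b + k) choose b)"
    using V by (simp add: card_cartesian_product card_below k_def)
  ultimately have card: "card ?I < card ?A" using b by simp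
  have mem: "h i \<in> Bihom V (L + b) (d * b)" if i: "i \<in> ?A" for i
  proof -
    obtain a \<beta> where [simp]: "i = (a, \<beta>)" by (cases i)
    have s: "sum \<beta> V \<le> b" using i by (simp add: below_def less_Suc_eq_le)
    have "(\<lambda>z. (case z of (t, x) \<Rightarrow> t ^ a) * mpow V \<beta> (\<lambda>j. case z of (t, x) \<Rightarrow> f j x - t * g j x)
        * (case z of (t, x) \<Rightarrow> u x) ^ (b - sum \<beta> V))
      \<in> Bihom V (a + sum \<beta> V * 1 + (b - sum \<beta> V) * 0) (0 + sum \<beta> V * d + (b - sum \<beta> V) * d)"
      by (intro Bihom_mult Bihom_power Bihom_mpow Bihom_param Bihom_Hom Bihom_pencil V f g u)
    moreover have "sum \<beta> V * d + (b - sum \<beta> V) * d = d * b"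
      using s by (metis add_mult_distrib le_add_diff_inverse mult.commute)
    ultimately have "h i \<in> Bihom V (a + sum \<beta> V) (d * b)"
      by (simp add: h_def case_prod_unfold)
    then show ?thesis
      by (rule Bihom_mono[OF V(1), rotated]) (use i s in auto)
  qed
  obtain c where c: "\<exists>i\<in>?A. c i \<noteq> 0" "\<And>z. (\<Sum>i\<in>?A. c i * h i z) = 0"
    by (rule lin_dependent[of ?I ?A h "\<lambda>(e, \<alpha>) (t, x). t ^ e * mpow V \<alpha> x"])
       (use card mem V finite_below[of V] that in \<open>auto simp: Bihom_def\<close>)
  show ?thesis
  proof (rule that[of b "\<lambda>a \<beta>. c (a, \<beta>)"])
    show "\<exists>a\<le>L. \<exists>\<beta>\<in>below V (Suc b). c (a, \<beta>) \<noteq> 0" using c(1) by auto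
    fix t x
    show "(\<Sum>a\<le>L. \<Sum>\<beta>\<in>below V (Suc b).
        c (a, \<beta>) * t ^ a * mpow V \<beta> (\<lambda>j. f j x - t * g j x) * u x ^ (b - sum \<beta> V)) = 0"
      using c(2)[of "(t, x)"] by (simp add: h_def sum.cartesian_product' mult.assoc)
  qed
qed

section \<open>A maximum principle for finite maps\<close>

text \<open>Cauchy's root bound, with the coefficients compared with the leading one instead of
  divided by it.\<close>

lemma poly_root_norm_le:
  fixes p :: "complex poly"
  assumes "degree p \<le> n" "coeff p n \<noteq> 0" "poly p T = 0" "K \<ge> 0"
    and "\<And>j. j < n \<Longrightarrow> norm (coeff p j) \<le> K * norm (coeff p n)"
  shows "norm T \<le> 1 + n * K"
proof (cases "norm T \<le> 1")
  case True
  then show ?thesis using assms(4) by (intro order.trans[OF True]) simp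
next
  case False
  let ?c = "norm (coeff p n)"
  have deg: "degree p = n" using assms(1,2) le_degree by (metis le_antisym)
  have 0: "coeff p n * T ^ n = - (\<Sum>j<n. coeff p j * T ^ j)"
    using assms(3) unfolding poly_altdef deg lessThan_Suc_atMost[symmetric] by (simp add: add_eq_0_iff)
  have "n \<noteq> 0"
  proof
    assume "n = 0"
    with 0 assms(2) show False by simp
  qed
  then obtain l where l: "n = Suc l" by (metis nat.exhaust)
  have "?c * norm T ^ n = norm (\<Sum>j<n. coeff p j * T ^ j)"
    using arg_cong[OF 0, of norm] by (simp add: norm_mult norm_power)
  also have "\<dots> \<le> (\<Sum>j<n. norm (coeff p j * T ^ j))" by (rule norm_sum)
  also have "\<dots> \<le> (\<Sum>j<n. K * ?c * norm T ^ l)"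
  proof (rule sum_mono)
    fix j assume "j \<in> {..<n}"
    then show "norm (coeff p j * T ^ j) \<le> K * ?c * norm T ^ l"
      unfolding norm_mult norm_power using False l assms(4)
      by (intro mult_mono assms(5) power_increasing) auto
  qed
  also have "\<dots> = ?c * norm T ^ l * (n * K)" by simp
  finally have "?c * norm T ^ l * norm T \<le> ?c * norm T ^ l * (n * K)" by (simp add: l algebra_simps)
  moreover have "0 < ?c * norm T ^ l" using assms(2) False by (intro mult_pos_pos zero_less_power) auto
  ultimately have "norm T \<le> n * K" by (rule mult_left_le_imp_le)
  then show ?thesis by simp
qed

text \<open>A linear factor \<open>T - r\<close> with \<open>norm r \<le> M\<close> enlarges a bound
  on all coefficients by a factor of at most \<open>1 + M\<close> and keeps the leading
  coefficient.\<close>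

lemma norm_coeff_le_if_roots_le:
  fixes p :: "complex poly"
  assumes "\<And>T. poly p T = 0 \<Longrightarrow> norm T \<le> M" "M \<ge> 0"
  shows "norm (coeff p j) \<le> (1 + M) ^ degree p * norm (lead_coeff p)"
  using assms(1)
proof (induction "degree p" arbitrary: p j)
  case 0
  then obtain c where "p = [:c:]" by (metis degree_eq_zeroE)
  then show ?case by (cases j) auto
next
  case (Suc n)
  then obtain r where r: "poly p r = 0"
    using fundamental_theorem_of_algebra[of p] by (auto simp: constant_degree)
  then obtain q where q: "p = [:-r, 1:] * q" by (metis dvdE poly_eq_0_iff_dvd)
  have "q \<noteq> 0" using Suc q by auto
  then have deg: "degree p = Suc (degree q)" and lead: "lead_coeff p = lead_coeff q"
    unfolding q lead_coeff_mult by (subst degree_mult_eq) auto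
  have IH: "norm (coeff q i) \<le> (1 + M) ^ degree q * norm (lead_coeff q)" for i
    using Suc deg by (intro Suc.hyps) (auto simp: q)
  let ?B = "(1 + M) ^ degree q * norm (lead_coeff q)"
  have B: "0 \<le> ?B" using assms(2) by simp
  have "coeff p j = (if j = 0 then 0 else coeff q (j - 1)) - r * coeff q j"
    unfolding q by (cases j) auto
  then have "norm (coeff p j) \<le> norm (if j = 0 then 0 else coeff q (j - 1)) + norm r * norm (coeff q j)"
    by (metis norm_mult norm_triangle_ineq4)
  also have "\<dots> \<le> ?B + M * ?B"
    using IH B Suc.prems[OF r] assms(2) by (intro add_mono mult_mono) auto
  also have "\<dots> = (1 + M) ^ Suc (degree q) * norm (lead_coeff q)" by (simp add: algebra_simps)
  finally show ?case unfolding lead unfolding deg .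
qed

text \<open>By continuity: an estimate obtained off the zeros of a cancelled factor or of a leading
  coefficient extends to them.\<close>

lemma norm_poly_le_off_finite_set:
  fixes p q :: "complex poly"
  assumes "finite Z" "\<And>s. norm s < r \<Longrightarrow> s \<notin> Z \<Longrightarrow> norm (poly p s) \<le> K * norm (poly q s)"
    and "norm s < r"
  shows "norm (poly p s) \<le> K * norm (poly q s)"
proof (rule tendsto_le[of "at s"])
  show "((\<lambda>z. K * norm (poly q z)) \<longlongrightarrow> K * norm (poly q s)) (at s)"
    by (intro tendsto_intros)
  show "((\<lambda>z. norm (poly p z)) \<longlongrightarrow> norm (poly p s)) (at s)"
    by (intro tendsto_intros)
  have "\<forall>\<^sub>F z in at s. z \<notin> Z"
    using assms(1) islimpt_finite[of Z s]
    by (simp add: islimpt_iff_eventually)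
  moreover have "\<forall>\<^sub>F z in at s. norm z < r"
    using assms(3) by (intro order_tendstoD(2)[OF tendsto_norm[OF tendsto_ident_at]])
  ultimately show "\<forall>\<^sub>F z in at s. norm (poly p z) \<le> K * norm (poly q z)"
    by eventually_elim (rule assms(2))
qed simp

text \<open>The bound with \<open>K\<close> makes every zero of \<open>q\<close> in the disc a zero
  of \<open>p\<close>. Cancelling such factors one at a time leaves a quotient without poles, to
  which the maximum modulus principle applies.\<close>

lemma polynomial_quotient_maximum_principle:
  fixes p q :: "complex poly"
  assumes r: "r > 0"
    and circle: "\<And>s. norm s = r \<Longrightarrow> poly q s \<noteq> 0 \<and> norm (poly p s) \<le> M * norm (poly q s)"
    and disc: "\<And>s. norm s < r \<Longrightarrow> norm (poly p s) \<le> K * norm (poly q s)"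
    and q0: "poly q 0 \<noteq> 0"
  shows "norm (poly p 0) \<le> M * norm (poly q 0)"
  using circle disc q0
proof (induction "degree q" arbitrary: p q rule: less_induct)
  case less
  show ?case
  proof (cases "\<exists>z. norm z < r \<and> poly q z = 0")
    case True
    then obtain z where z: "norm z < r" "poly q z = 0" by blast
    then have "poly p z = 0" using less.prems(2)[of z] by simp
    with z obtain p' q' where pq: "p = [:-z, 1:] * p'" "q = [:-z, 1:] * q'"
      by (metis dvdE poly_eq_0_iff_dvd)
    have "q' \<noteq> 0" using less.prems(3) pq by auto
    then have deg: "degree q' < degree q" unfolding pq by (subst degree_mult_eq) auto
    have quot: "norm (poly p s) \<le> c * norm (poly q s) \<longleftrightarrow> norm (poly p' s) \<le> c * norm (poly q' s)"
      if "s \<noteq> z" for s c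
    proof -
      have p: "norm (poly p s) = norm (s - z) * norm (poly p' s)"
        and q: "norm (poly q s) = norm (s - z) * norm (poly q' s)"
        by (simp_all add: pq norm_mult[symmetric] algebra_simps)
      show ?thesis unfolding p q using that by (simp add: mult.left_commute[of c])
    qed
    have "norm (poly p' 0) \<le> M * norm (poly q' 0)"
    proof (rule less.hyps[OF deg])
      fix s :: complex assume s: "norm s = r"
      then have "s \<noteq> z" using z by auto
      then show "poly q' s \<noteq> 0 \<and> norm (poly p' s) \<le> M * norm (poly q' s)"
        using less.prems(1)[OF s] quot pq by auto
    next
      fix s :: complex assume s: "norm s < r"
      show "norm (poly p' s) \<le> K * norm (poly q' s)"
        by (rule norm_poly_le_off_finite_set[of "{z}" r, OF _ _ s]) (use less.prems(2) quot in auto)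
    next
      show "poly q' 0 \<noteq> 0" using less.prems(3) pq by auto
    qed
    moreover have "0 \<noteq> z" using z less.prems(3) by auto
    ultimately show ?thesis using quot by blast
  next
    case False
    have nz: "poly q s \<noteq> 0" if "norm s \<le> r" for s
      using that False less.prems(1)[of s] by (cases "norm s = r") auto
    have "norm (poly p 0 / poly q 0) \<le> M"
    proof (rule maximum_modulus_frontier[of "\<lambda>s. poly p s / poly q s" "ball 0 r"])
      show "(\<lambda>s. poly p s / poly q s) holomorphic_on interior (ball 0 r)"
        using nz by (intro holomorphic_intros) auto
      show "continuous_on (closure (ball 0 r)) (\<lambda>s. poly p s / poly q s)"
        using nz r by (intro continuous_intros) auto
      fix s :: complex assume "s \<in> frontier (ball 0 r)"
      then have "norm s = r" using r by (simp add: frontier_ball)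
      from less.prems(1)[OF this] show "norm (poly p s / poly q s) \<le> M"
        by (simp add: norm_divide divide_le_eq)
    qed (use r in auto)
    then show ?thesis using less.prems(3) by (simp add: norm_divide divide_le_eq)
  qed
qed

section \<open>Algebraic relations and the minimal polynomial\<close>

definition relation :: "'v set \<Rightarrow> ('v \<Rightarrow> ('v \<Rightarrow> complex) \<Rightarrow> complex) \<Rightarrow> (('v \<Rightarrow> complex) \<Rightarrow> complex) \<Rightarrow>
    nat \<Rightarrow> (('v \<Rightarrow> complex) \<Rightarrow> complex poly) \<Rightarrow> bool" where
  "relation V F u n R \<longleftrightarrow> R \<in> polycoeffs V \<and> (\<forall>y. degree (R y) \<le> n) \<and>
     (\<forall>x. poly (R (\<lambda>j. F j x)) (u x) = 0)"

lemma relation_trim: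
  assumes "relation V F u n R" "\<And>y. coeff (R y) n = 0"
  shows "relation V F u (n - 1) R \<or> (\<forall>y. R y = 0)"
proof (cases n)
  case 0
  have "R y = 0" for y
    using assms 0 unfolding relation_def
    by (metis leading_coeff_0_iff le_zero_eq)
  then show ?thesis by simp
next
  case (Suc k)
  have "degree (R y) \<le> k" for y
  proof (rule degree_le, intro allI impI)
    fix i assume "k < i"
    then show "coeff (R y) i = 0"
      using assms Suc \<open>k < i\<close> unfolding relation_def
      by (cases "i = n") (auto intro!: coeff_eq_0 intro: le_less_trans[of _ "Suc k"])
  qed
  then show ?thesis using assms(1) Suc by (auto simp: relation_def)
qed

lemma relation_exact_degree:
  assumes "relation V F u n R" "R y \<noteq> 0"
  shows "\<exists>m\<le>n. relation V F u m R \<and> (\<exists>y. coeff (R y) m \<noteq> 0)"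
  using assms
proof (induction n)
  case 0
  then have "coeff (R y) 0 \<noteq> 0" by (metis le_zero_eq leading_coeff_0_iff relation_def)
  with 0 show ?case by auto
next
  case (Suc n)
  show ?case
  proof (cases "\<exists>y. coeff (R y) (Suc n) \<noteq> 0")
    case False
    then have "relation V F u n R" using relation_trim[OF Suc.prems(1)] Suc.prems(2) by auto
    from Suc.IH[OF this Suc.prems(2)] show ?thesis using le_SucI by blast
  qed (use Suc.prems in auto)
qed

text \<open>
  \<open>Q\<close> is a minimal polynomial of \<open>u\<close> over the field generated by \<open>F\<close>, so it divides every relation
  over that field.
\<close>
lemma minimal_relation:
  assumes R0: "relation V F u n0 R0" "R0 y0 \<noteq> 0"
  obtains n Q where "n \<le> n0" "relation V F u n Q" "\<exists>y. coeff (Q y) n \<noteq> 0"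
    "\<And>m R y T. relation V F u m R \<Longrightarrow> coeff (Q y) n \<noteq> 0 \<Longrightarrow> poly (Q y) T = 0 \<Longrightarrow> poly (R y) T = 0"
proof -
  let ?P = "\<lambda>n. \<exists>Q. relation V F u n Q \<and> (\<exists>y. coeff (Q y) n \<noteq> 0)"
  define n where "n = (LEAST n. ?P n)"
  obtain m where m: "m \<le> n0" "?P m" using relation_exact_degree[OF R0] by blast
  have "?P n" unfolding n_def using m(2) by (rule LeastI)
  have "n \<le> m" unfolding n_def using m(2) by (rule Least_le)
  from \<open>?P n\<close> obtain Q where Q: "relation V F u n Q" "\<exists>y. coeff (Q y) n \<noteq> 0" by blast
  have min: "n \<le> m" if "?P m" for m unfolding n_def using that by (rule Least_le)
  have "poly (R y) T = 0"
    if "relation V F u m R" "coeff (Q y) n \<noteq> 0" "poly (Q y) T = 0" for m R y T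
    using that(1)
  proof (induction m arbitrary: R rule: less_induct)
    case (less m)
    have lower: ?case if "\<And>y. coeff (S y) m = 0" "relation V F u m S"
      "poly (S y) T = 0 \<Longrightarrow> poly (R y) T = 0" for S
    proof (cases "\<forall>y. S y = 0")
      case True
      then show ?thesis using that by simp
    next
      case False
      then have S: "relation V F u (m - 1) S" using relation_trim[OF that(2,1)] by blast
      have "m \<noteq> 0"
      proof
        assume "m = 0"
        with False that(1,2) show False unfolding relation_def by (metis leading_coeff_0_iff le_zero_eq)
      qed
      then show ?thesis using that(3) less.IH[OF _ S] by simp
    qed
    show ?case
    proof (cases "\<exists>y. coeff (R y) m \<noteq> 0")
      case False
      then show ?thesis using lower[of R] less.prems by auto
    next
      case True
      then have nm: "n \<le> m" using min less.prems by blast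
      \<comment> \<open>A step of pseudo-division by \<open>Q\<close>: multiplying crosswise by the
        leading coefficients cancels degree \<open>m\<close> without division, and the factor
        \<open>coeff (Q y) n\<close> can be removed where it is nonzero.\<close>
      define S where "S y = [:coeff (Q y) n:] * R y - [:coeff (R y) m:] * (monom 1 (m - n) * Q y)" for y
      have RQ: "R \<in> polycoeffs V" "Q \<in> polycoeffs V" "\<And>y. degree (R y) \<le> m" "\<And>y. degree (Q y) \<le> n"
        using less.prems Q(1) by (auto simp: relation_def)
      show ?thesis
      proof (rule lower[of S])
        show "coeff (S y) m = 0" for y
          using nm by (simp add: S_def coeff_monom_mult)
        have "S \<in> polycoeffs V"
          unfolding S_def[abs_def]
          by (intro polycoeffs_diff polycoeffs_mult polycoeffs_pCons polycoeffs_coeff polycoeffs_const RQ)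
        moreover have "degree (S y) \<le> m" for y
          unfolding S_def
        proof (rule degree_diff_le)
          show "degree ([:coeff (Q y) n:] * R y) \<le> m"
            using RQ(3)[of y] by (simp add: order.trans[OF degree_smult_le])
          have "degree (monom 1 (m - n) * Q y) \<le> (m - n) + n"
            using RQ(4)[of y] by (intro order.trans[OF degree_mult_le] add_mono degree_monom_le)
          then show "degree ([:coeff (R y) m:] * (monom 1 (m - n) * Q y)) \<le> m"
            using nm by (simp add: order.trans[OF degree_smult_le])
        qed
        ultimately show "relation V F u m S"
          using less.prems Q(1) by (auto simp: relation_def S_def)
        assume "poly (S y) T = 0"
        then show "poly (R y) T = 0" using that(2,3) by (simp add: S_def)
      qed
    qed
  qed
  with Q m \<open>n \<le> m\<close> that show ?thesis by (metis (no_types, lifting) order.trans)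
qed

lemma polyfun_bounded_on_disc:
  assumes "h \<in> polyfun V"
  shows "\<exists>K\<ge>0. \<forall>s. norm s \<le> r \<longrightarrow> norm (h (\<lambda>v. y v + s * w v)) \<le> K"
proof -
  obtain p where p: "\<And>s. h (\<lambda>v. y v + s * w v) = poly p s" using polyfun_line[OF assms] by blast
  have "compact (poly p ` cball 0 r)"
    by (intro compact_continuous_image continuous_intros) auto
  then obtain K where "\<forall>z\<in>poly p ` cball 0 r. norm z \<le> K"
    using compact_imp_bounded bounded_iff by metis
  then show ?thesis by (intro exI[of _ "max 0 K"]) (auto simp: p intro!: max.coboundedI2)
qed

text \<open>
  The coefficients of the minimal polynomial, divided by the leading one, are rational functions on
  the line \<open>y + s w\<close> without poles, because \<open>u\<close> is integral; so they obey the maximum principle.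
\<close>
lemma maximum_principle_for_fibres:
  fixes V :: "'v set" and F :: "'v \<Rightarrow> ('v \<Rightarrow> complex) \<Rightarrow> complex"
  assumes V: "finite V" and d: "d \<ge> 1" and F: "\<And>j. j \<in> V \<Longrightarrow> F j \<in> Hom V d"
    and nz: "no_nonzero_zero V V F" and u: "u \<in> polyfun V"
    and R0: "relation V F u n0 R0" "R0 y0 \<noteq> 0"
  shows "\<exists>q\<in>polyfun V. (\<exists>x. q (\<lambda>j. F j x) \<noteq> 0) \<and>
    (\<forall>x w r1 r2 M. q (\<lambda>j. F j x) \<noteq> 0 \<longrightarrow> 0 < r1 \<longrightarrow> r1 < r2 \<longrightarrow> M \<ge> 0 \<longrightarrow>
       norm (u x) > 1 + real n0 * (1 + M) ^ n0 \<longrightarrow>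
       (\<exists>s T. r1 \<le> norm s \<and> norm s \<le> r2 \<and> norm T > M \<and> poly (R0 (\<lambda>j. F j x + s * w j)) T = 0))"
proof -
  have indep: "p y = 0" if "p \<in> polyfun V" "\<And>x. p (\<lambda>j. F j x) = 0" for p y
    by (rule forms_algebraically_independent[OF V d F nz that])
  obtain n Q where n: "n \<le> n0" and Q: "relation V F u n Q" "\<exists>y. coeff (Q y) n \<noteq> 0"
    and div: "\<And>m R y T. relation V F u m R \<Longrightarrow> coeff (Q y) n \<noteq> 0 \<Longrightarrow> poly (Q y) T = 0 \<Longrightarrow> poly (R y) T = 0"
    by (rule minimal_relation[OF R0]) (auto intro: that)
  obtain D where irr: "irrelevant_from V V d F D"
    by (rule homogeneous_nullstellensatz[OF V V _ nz]) (auto intro: F that)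
  obtain R1 n1 where R1: "R1 \<in> polycoeffs V" "\<And>y. degree (R1 y) = n1" "\<And>y. coeff (R1 y) n1 = 1"
    "\<And>x. poly (R1 (\<lambda>j. F j x)) (u x) = 0"
    by (rule integral_equation[OF V V d irr u]) (rule that)
  have rel1: "relation V F u n1 R1" using R1 by (auto simp: relation_def)
  have Qc: "(\<lambda>y. coeff (Q y) j) \<in> polyfun V" for j
    using Q(1) by (auto simp: relation_def intro: polycoeffs_coeff)
  have Qdeg: "degree (Q y) \<le> n" for y using Q(1) by (simp add: relation_def)
  show ?thesis
  \<comment> \<open>\<open>q\<close> is the leading coefficient of the minimal polynomial. It is
    nonzero at some point, hence, as the forms are algebraically independent, at some point of the
    image of \<open>F\<close>.\<close>
  proof (intro bexI[of _ "\<lambda>y. coeff (Q y) n"] conjI allI impI)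
    show "(\<lambda>y. coeff (Q y) n) \<in> polyfun V" by (rule Qc)
    show "\<exists>x. coeff (Q (\<lambda>j. F j x)) n \<noteq> 0" using Q(2) indep[OF Qc] by blast
    fix x w :: "'v \<Rightarrow> complex" and r1 r2 M :: real
    assume q0: "coeff (Q (\<lambda>j. F j x)) n \<noteq> 0" and r: "0 < r1" "r1 < r2" and M: "M \<ge> 0"
      and big: "norm (u x) > 1 + n0 * (1 + M) ^ n0"
    define Y where "Y s = (\<lambda>j. F j x + s * w j)" for s
    have Y0: "Y 0 = (\<lambda>j. F j x)" by (simp add: Y_def)
    have "\<forall>j. \<exists>p. \<forall>s. coeff (Q (Y s)) j = poly p s" unfolding Y_def using polyfun_line[OF Qc, where a = "\<lambda>j. F j x" and b = w] by blast
    then obtain P where P: "\<And>j s. coeff (Q (Y s)) j = poly (P j) s" by metis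
    show "\<exists>s T. r1 \<le> norm s \<and> norm s \<le> r2 \<and> norm T > M \<and> poly (R0 (\<lambda>j. F j x + s * w j)) T = 0"
    proof (rule ccontr)
      assume "\<not> ?thesis"
      then have le: "norm T \<le> M" if "r1 \<le> norm s" "norm s \<le> r2" "poly (R0 (Y s)) T = 0" for s T
        using that unfolding Y_def by force
      have Pn: "P n \<noteq> 0" using q0 P[of 0 n] Y0 by auto
      define Z where "Z = {s. poly (P n) s = 0}"
      have Z: "finite Z" unfolding Z_def using poly_roots_finite[OF Pn] .
      \<comment> \<open>A radius in the annulus whose circle avoids the finitely many zeros of the
        leading coefficient.\<close>
      have "infinite ({r1..r2} - norm ` Z)"
        using r Z infinite_Icc[of r1 r2] by (intro Diff_infinite_finite) auto
      then obtain \<rho> where \<rho>: "\<rho> \<in> {r1..r2} - norm ` Z" using infinite_imp_nonempty by blast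
      have lead: "lead_coeff (Q (Y s)) = poly (P n) s \<and> degree (Q (Y s)) = n" if "poly (P n) s \<noteq> 0" for s
      proof -
        have "degree (Q (Y s)) = n" using that P[of s n] Qdeg[of "Y s"] le_degree le_antisym by metis
        then show ?thesis using P by simp
      qed
      have circle: "poly (P n) s \<noteq> 0 \<and> norm (poly (P j) s) \<le> (1 + M) ^ n * norm (poly (P n) s)"
        if s: "norm s = \<rho>" for s j
      proof -
        have nz: "poly (P n) s \<noteq> 0" using \<rho> s by (auto simp: Z_def)
        have "norm T \<le> M" if "poly (Q (Y s)) T = 0" for T
          using le[of s T] div[OF R0(1), of "Y s" T] that nz s \<rho> P by auto
        from norm_coeff_le_if_roots_le[where p = "Q (Y s)" and j = j, OF this M] lead[OF nz] nz show ?thesis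
          by (simp add: P)
      qed
      \<comment> \<open>The monic equation bounds the roots over the whole disc. This crude bound
        \<open>B\<close> only rules out poles of the normalised coefficients; the bound at the
        centre comes from \<open>M\<close> on the circle.\<close>
      have "\<forall>i. \<exists>K\<ge>0. \<forall>s. norm s \<le> \<rho> \<longrightarrow> norm (coeff (R1 (Y s)) i) \<le> K"
        unfolding Y_def
        using polyfun_bounded_on_disc[OF polycoeffs_coeff[OF R1(1)],
          where r = \<rho> and y = "\<lambda>j. F j x" and w = w] by blast
      then obtain K where K: "\<And>i. K i \<ge> 0" "\<And>i s. norm s \<le> \<rho> \<Longrightarrow> norm (coeff (R1 (Y s)) i) \<le> K i"
        by metis
      define B where "B = 1 + n1 * (\<Sum>i<n1. K i)"
      have Ksum: "0 \<le> (\<Sum>i<n1. K i)" by (intro sum_nonneg K)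
      have B: "B \<ge> 0" using Ksum by (simp add: B_def)
      have disc: "norm (poly (P j) s) \<le> (1 + B) ^ n * norm (poly (P n) s)" if "norm s < \<rho>" for s j
      proof (rule norm_poly_le_off_finite_set[OF Z _ that])
        fix s :: complex assume s: "norm s < \<rho>" "s \<notin> Z"
        then have nz: "poly (P n) s \<noteq> 0" by (simp add: Z_def)
        have "norm T \<le> B" if T: "poly (Q (Y s)) T = 0" for T
          unfolding B_def
        proof (rule poly_root_norm_le)
          show "poly (R1 (Y s)) T = 0" using div[OF rel1 _ T] nz P by simp
          fix i assume "i < n1"
          have "norm (coeff (R1 (Y s)) i) \<le> K i" using s K by simp
          also have "\<dots> \<le> (\<Sum>i<n1. K i)" using \<open>i < n1\<close> K(1) by (intro member_le_sum) auto
          finally show "norm (coeff (R1 (Y s)) i) \<le> (\<Sum>i<n1. K i) * norm (coeff (R1 (Y s)) n1)"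
            by (simp add: R1)
        qed (use R1 Ksum in auto)
        from norm_coeff_le_if_roots_le[where p = "Q (Y s)" and j = j, OF this B] lead[OF nz] nz
        show "norm (poly (P j) s) \<le> (1 + B) ^ n * norm (poly (P n) s)" by (simp add: P)
      qed
      have center: "norm (poly (P j) 0) \<le> (1 + M) ^ n * norm (poly (P n) 0)" for j
        by (rule polynomial_quotient_maximum_principle[of \<rho>, OF _ circle disc])
           (use \<rho> r q0 P[of 0 n] Y0 in auto)
      have "norm (u x) \<le> 1 + n * (1 + M) ^ n"
      proof (rule poly_root_norm_le)
        show "poly (Q (Y 0)) (u x) = 0" using Q(1) by (simp add: relation_def Y0)
        show "coeff (Q (Y 0)) n \<noteq> 0" using q0 Y0 by simp
      qed (use Qdeg center M in \<open>auto simp: P\<close>)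
      \<comment> \<open>The threshold is phrased with \<open>n0\<close>, which is known before the
        minimal degree \<open>n\<close> is.\<close>
      also have "\<dots> \<le> 1 + n0 * (1 + M) ^ n0"
        using n M by (intro add_left_mono mult_mono power_increasing) auto
      finally show False using big by simp
    qed
  qed
qed

section \<open>The eigenvalues of a pencil of forms\<close>

text \<open>A linear form with coefficients \<open>s ^ e v\<close> on the moment curve: each of the
  finitely many vectors excludes finitely many \<open>s\<close>. Its \<open>d\<close>-th power has
  the required degree.\<close>

lemma form_avoiding_zeros:
  assumes V: "finite V" and E: "finite E" and X: "\<And>t. t \<in> E \<Longrightarrow> \<exists>v\<in>V. X t v \<noteq> 0"
  obtains u where "u \<in> Hom V d" "\<And>t. t \<in> E \<Longrightarrow> u (X t) \<noteq> 0"
proof -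
  obtain e :: "'a \<Rightarrow> nat" where e: "inj_on e V" using V finite_imp_inj_to_nat_seg by metis
  define P where "P x = (\<Sum>v\<in>V. monom (x v) (e v))" for x :: "'a \<Rightarrow> complex"
  have "P (X t) \<noteq> 0" if t: "t \<in> E" for t
  proof -
    obtain v where v: "v \<in> V" "X t v \<noteq> 0" using X[OF t] by blast
    have "coeff (P (X t)) (e v) = (\<Sum>w\<in>V. if w = v then X t v else 0)"
      unfolding P_def coeff_sum coeff_monom using v e by (intro sum.cong) (auto simp: inj_on_def)
    also have "\<dots> = X t v" using V v by simp
    finally show ?thesis using v by auto
  qed
  then have "finite (\<Union>t\<in>E. {s. poly (P (X t)) s = 0})"
    using E poly_roots_finite by (intro finite_UN_I) auto
  then obtain s where s: "s \<notin> (\<Union>t\<in>E. {s. poly (P (X t)) s = 0})"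
    using infinite_UNIV_char_0[where 'a = complex] by (metis ex_new_if_finite)
  have "(\<lambda>x. poly (P x) s) = (\<lambda>x. \<Sum>v\<in>V. s ^ e v * x v)"
    by (simp add: P_def poly_sum poly_monom mult.commute)
  moreover have "(\<lambda>x. \<Sum>v\<in>V. s ^ e v * x v) \<in> Hom V 1"
    using V by (intro Hom_sum Hom_scale Hom_var)
  ultimately have "(\<lambda>x. poly (P x) s ^ d) \<in> Hom V d"
    using Hom_power[OF V, of "\<lambda>x. poly (P x) s" 1 d] by simp
  with s show ?thesis by (intro that[of "\<lambda>x. poly (P x) s ^ d"]) auto
qed

lemma eventually_at_notin_finite: "finite Z \<Longrightarrow> \<forall>\<^sub>F z in at s. z \<notin> Z" for s :: complex
  using islimpt_finite[of Z s] by (simp add: islimpt_iff_eventually)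

theorem pencil_eigenvalue_bound:
  assumes V: "finite V" "V \<noteq> {}" and d: "d \<ge> 1"
    and f: "\<And>j. j \<in> V \<Longrightarrow> f j \<in> Hom V d" and g: "\<And>j. j \<in> V \<Longrightarrow> g j \<in> Hom V d"
    and nz: "no_nonzero_zero V V g"
  defines "E \<equiv> {t. \<exists>x. (\<exists>v\<in>V. x v \<noteq> 0) \<and> (\<forall>j\<in>V. f j x = t * g j x)}"
  shows "finite E" "card E \<le> card V * d ^ (card V - 1)"
proof -
  define L where "L = card V * d ^ (card V - 1)"
  obtain D where irr: "irrelevant_from V V d g D"
    by (rule homogeneous_nullstellensatz[OF V(1) V(1) _ nz]) (auto intro: g that)
  show finE: "finite E" unfolding E_def by (rule finite_singular_parameters[OF V(1) V(1) irr f])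
  show "card E \<le> card V * d ^ (card V - 1)"
  proof (rule ccontr)
    assume "\<not> ?thesis"
    then have LE: "L < card E" by (simp add: L_def)
    have "\<forall>t\<in>E. \<exists>x. (\<exists>v\<in>V. x v \<noteq> 0) \<and> (\<forall>j\<in>V. f j x = t * g j x)" by (simp add: E_def)
    then obtain X where X: "\<And>t. t \<in> E \<Longrightarrow> \<exists>v\<in>V. X t v \<noteq> 0"
      "\<And>t j. t \<in> E \<Longrightarrow> j \<in> V \<Longrightarrow> f j (X t) = t * g j (X t)" by metis
    obtain u where u: "u \<in> Hom V d" "\<And>t. t \<in> E \<Longrightarrow> u (X t) \<noteq> 0"
      by (rule form_avoiding_zeros[OF V(1) finE X(1), where d = d]) (auto intro: that)
    obtain b C where C: "\<exists>a\<le>L. \<exists>\<beta>\<in>below V (Suc b). C a \<beta> \<noteq> 0"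
      and rel0: "\<And>t x. (\<Sum>a\<le>L. \<Sum>\<beta>\<in>below V (Suc b).
        C a \<beta> * t ^ a * mpow V \<beta> (\<lambda>j. f j x - t * g j x) * u x ^ (b - sum \<beta> V)) = 0"
      by (rule pencil_relation[OF V _ _ u(1), of f g, folded L_def])
         (rule f, assumption, rule g, assumption, rule that)
    define W where "W = below V (Suc b)"
    have W: "finite W" unfolding W_def using finite_below[OF V(1)] .
    \<comment> \<open>\<open>T\<close> carries the exponent \<open>b - sum \<beta> V\<close>, so the
      least degree in \<open>y\<close> gives the top degree \<open>e\<close> in
      \<open>T\<close>.\<close>
    obtain a0 \<beta>0 where a0: "a0 \<le> L" "\<beta>0 \<in> W" "C a0 \<beta>0 \<noteq> 0"
      and least: "\<And>a \<beta>. a \<le> L \<Longrightarrow> \<beta> \<in> W \<Longrightarrow> C a \<beta> \<noteq> 0 \<Longrightarrow> sum \<beta>0 V \<le> sum \<beta> V"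
    proof -
      have "\<exists>p. fst p \<le> L \<and> snd p \<in> W \<and> C (fst p) (snd p) \<noteq> 0" using C by (auto simp: W_def)
      from ex_has_least_nat[of "\<lambda>p. fst p \<le> L \<and> snd p \<in> W \<and> C (fst p) (snd p) \<noteq> 0" _ "\<lambda>p. sum (snd p) V"] this
      obtain p where "fst p \<le> L \<and> snd p \<in> W \<and> C (fst p) (snd p) \<noteq> 0"
        "\<And>q. fst q \<le> L \<and> snd q \<in> W \<and> C (fst q) (snd q) \<noteq> 0 \<Longrightarrow> sum (snd p) V \<le> sum (snd q) V" by blast
      then show ?thesis by (intro that[of "fst p" "snd p"]) (metis fst_conv snd_conv)+
    qed
    define e where "e = b - sum \<beta>0 V"
    have Wb: "sum \<beta> V \<le> b" if "\<beta> \<in> W" for \<beta> using that by (simp add: W_def below_def)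
    define R where "R t y = (\<Sum>a\<le>L. \<Sum>\<beta>\<in>W. monom (C a \<beta> * t ^ a * mpow V \<beta> y) (b - sum \<beta> V))" for t y
    have coeffR: "coeff (R t y) j = (\<Sum>a\<le>L. \<Sum>\<beta>\<in>W. if b - sum \<beta> V = j then C a \<beta> * t ^ a * mpow V \<beta> y else 0)" for t y j
      by (simp add: R_def coeff_sum coeff_monom)
    define S where "S = {\<beta>\<in>W. sum \<beta> V = sum \<beta>0 V}"
    have coeffRe: "coeff (R t y) e = (\<Sum>a\<le>L. (\<Sum>\<beta>\<in>S. C a \<beta> * mpow V \<beta> y) * t ^ a)" for t y
    proof -
      have "b - sum \<beta> V = e \<longleftrightarrow> sum \<beta> V = sum \<beta>0 V" if "\<beta> \<in> W" for \<beta>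
        using Wb[OF that] Wb[OF a0(2)] unfolding e_def by linarith
      then have "(\<Sum>\<beta>\<in>W. if b - sum \<beta> V = e then C a \<beta> * t ^ a * mpow V \<beta> y else 0)
          = (\<Sum>\<beta>\<in>W. if sum \<beta> V = sum \<beta>0 V then C a \<beta> * t ^ a * mpow V \<beta> y else 0)" for a
        by (intro sum.cong) auto
      also have "\<dots> a = (\<Sum>\<beta>\<in>S. C a \<beta> * t ^ a * mpow V \<beta> y)" for a
        using W by (simp add: S_def sum.If_cases Int_def)
      finally show ?thesis unfolding coeffR by (simp add: sum_distrib_left mult_ac)
    qed
    have relR: "relation V (\<lambda>j x. f j x - t * g j x) u e (R t)" for t
      unfolding relation_def
    proof (intro conjI allI)
      have "(\<lambda>y. if b - sum \<beta> V = j then C a \<beta> * t ^ a * mpow V \<beta> y else 0) \<in> polyfun V" for j a \<beta>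
        by (cases "b - sum \<beta> V = j") (auto intro!: polyfun.mult polyfun.const polyfun_mpow)
      then show "R t \<in> polycoeffs V"
        unfolding polycoeffs_def mem_Collect_eq coeffR by (intro allI polyfun_sum)
      show "degree (R t y) \<le> e" for y
      proof (rule degree_le, intro allI impI)
        fix i assume i: "e < i"
        have "C a \<beta> = 0" if "a \<le> L" "\<beta> \<in> W" "b - sum \<beta> V = i" for a \<beta>
          using least[OF that(1,2)] that(3) i unfolding e_def by linarith
        then show "coeff (R t y) i = 0" unfolding coeffR by (intro sum.neutral ballI) auto
      qed
      show "poly (R t (\<lambda>j. f j x - t * g j x)) (u x) = 0" for x
        using rel0[where t = t and x = x] by (simp add: R_def poly_sum poly_monom W_def)
    qed
    \<comment> \<open>For fixed \<open>y\<close> the leading coefficient has degree at most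
      \<open>L\<close> in \<open>t\<close>; vanishing on all of \<open>E\<close> it would be zero.
      This is where \<open>L < card E\<close> is used.\<close>
    have "\<exists>t\<in>E. \<exists>y. coeff (R t y) e \<noteq> 0"
    proof (rule ccontr)
      assume none: "\<not> ?thesis"
      have "(\<Sum>\<beta>\<in>S. C a0 \<beta> * mpow V \<beta> y) = 0" for y
      proof -
        define p where "p = (\<Sum>a\<le>L. monom (\<Sum>\<beta>\<in>S. C a \<beta> * mpow V \<beta> y) a)"
        have roots: "E \<subseteq> {t. poly p t = 0}"
          using none by (auto simp: p_def poly_sum poly_monom coeffRe)
        have "p = 0"
        proof (rule ccontr)
          assume p: "p \<noteq> 0"
          have "card E \<le> card {t. poly p t = 0}" using roots poly_roots_finite[OF p] by (intro card_mono)
          also have "\<dots> \<le> degree p" by (rule card_poly_roots_bound[OF p])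
          also have "\<dots> \<le> L" unfolding p_def
            by (intro degree_sum_le) (auto intro: order.trans[OF degree_monom_le])
          finally show False using LE by simp
        qed
        then have "coeff p a0 = 0" by simp
        then show ?thesis using a0(1) by (simp add: p_def coeff_sum coeff_monom)
      qed
      then have "\<And>y. (\<Sum>\<beta>\<in>S. C a0 \<beta> * mpow V \<beta> y) = 0" .
      moreover have "finite S" "\<beta>0 \<in> S" using W a0(2) by (simp_all add: S_def)
      moreover have "\<beta> v = 0" if "\<beta> \<in> S" "v \<notin> V" for \<beta> v
        using that by (simp add: S_def W_def below_def)
      ultimately have "C a0 \<beta>0 = 0"
        using mpow_independent[where V = V and A = S and c = "C a0" and \<alpha> = \<beta>0] V(1) by blast
      with a0(3) show False by simp
    qed
    then obtain t0 y1 where t0: "t0 \<in> E" and y1: "coeff (R t0 y1) e \<noteq> 0" by blast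
    define x0 where "x0 = X t0"
    define y0 where "y0 = (\<lambda>j. g j x0)"
    define w where "w = (\<lambda>j. y1 j - y0 j)"
    have "(\<lambda>y. coeff (R t0 y) e) \<in> polyfun V" using relR by (auto simp: relation_def intro: polycoeffs_coeff)
    from polyfun_line[OF this, where a = y0 and b = w] obtain p where p: "\<And>s. coeff (R t0 (\<lambda>j. y0 j + s * w j)) e = poly p s" by blast
    have "poly p 1 \<noteq> 0" using y1 p[of 1] by (simp add: w_def)
    then have "p \<noteq> 0" by auto
    \<comment> \<open>The line from \<open>y0\<close> to \<open>y1\<close> meets the zeros of the
      leading coefficient at \<open>t0\<close> finitely often. The parameter \<open>s = 0\<close>
      may be one of them, so an annulus around it is used.\<close>
    from finite_set_avoid[OF poly_roots_finite[OF this], of 0] obtain r where r: "r > 0"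
      "\<And>s. poly p s = 0 \<Longrightarrow> s \<noteq> 0 \<Longrightarrow> r \<le> norm s" by auto
    have annulus: "coeff (R t0 (\<lambda>j. y0 j + s * w j)) e \<noteq> 0" if "r / 4 \<le> norm s" "norm s \<le> r / 2" for s
      using r(2)[of s] that r(1) p[of s] by (cases "s = 0") auto
    \<comment> \<open>\<open>N\<close> measures both the accuracy of the approximation and the size
      of the root; as it grows, roots escape to infinity over a limit point in the annulus.\<close>
    have "\<exists>t Y s T. norm (t - t0) < 1 / (real N + 1) \<and> (\<forall>j\<in>V. norm (Y j - y0 j) < 1 / (real N + 1)) \<and>
        r / 4 \<le> norm s \<and> norm s \<le> r / 2 \<and> norm T > N \<and> poly (R t (\<lambda>j. Y j + s * w j)) T = 0" for N :: nat
    proof -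
      define \<tau> where "\<tau> n = complex_of_nat (Suc n)" for n
      define t where "t n = t0 - (1 / \<tau> n) ^ d" for n
      define \<delta> where "\<delta> = 1 / (real N + 1)"
      have \<delta>: "\<delta> > 0" by (simp add: \<delta>_def)
      have "(\<lambda>n. 1 / \<tau> n) \<longlonglongrightarrow> 0"
        unfolding \<tau>_def using LIMSEQ_Suc[OF lim_const_over_n[of 1]] by simp
      then have "(\<lambda>n. (1 / \<tau> n) ^ d) \<longlonglongrightarrow> 0 ^ d" by (rule tendsto_power)
      then have "(\<lambda>n. t0 - (1 / \<tau> n) ^ d) \<longlonglongrightarrow> t0 - 0 ^ d"
        by (rule tendsto_diff[OF tendsto_const])
      then have lim: "t \<longlonglongrightarrow> t0" using d by (simp add: t_def[abs_def] power_0_left)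
      \<comment> \<open>\<open>t n\<close> is never \<open>t0\<close>, hence eventually outside the
        finite set \<open>E\<close>; there the pencil has no nonzero common zero, as the maximum
        principle requires.\<close>
      have "filterlim t (at t0) sequentially"
        using lim by (auto simp: filterlim_at t_def \<tau>_def simp del: of_nat_Suc)
      then have "\<forall>\<^sub>F n in sequentially. t n \<notin> E"
        using filterlim_iff eventually_at_notin_finite[OF finE] by blast
      \<comment> \<open>Keeps the relation at \<open>t n\<close> from being identically
        zero.\<close>
      moreover have "\<forall>\<^sub>F n in sequentially. coeff (R (t n) y1) e \<noteq> 0"
      proof -
        have "(\<lambda>n. coeff (R (t n) y1) e) \<longlonglongrightarrow> coeff (R t0 y1) e"
          unfolding coeffRe by (intro tendsto_intros lim)
        then show ?thesis using y1 by (rule tendsto_imp_eventually_ne)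
      qed
      moreover have "\<forall>\<^sub>F n in sequentially. norm (t n - t0) < \<delta>"
        using lim \<delta> by (simp add: tendsto_iff dist_norm)
      moreover have "\<forall>\<^sub>F n in sequentially. real n * norm (u x0) > 2 + e * (1 + real N) ^ e"
      proof -
        have "norm (u x0) > 0" using u(2)[OF t0] by (simp add: x0_def)
        then have "filterlim (\<lambda>n. real n * norm (u x0)) at_top sequentially"
          by (intro filterlim_at_top_mult_tendsto_pos[OF tendsto_const] filterlim_real_sequentially)
        then show ?thesis by (simp add: filterlim_at_top_dense)
      qed
      ultimately have "\<forall>\<^sub>F n in sequentially. t n \<notin> E \<and> coeff (R (t n) y1) e \<noteq> 0 \<and> norm (t n - t0) < \<delta> \<and>
          real n * norm (u x0) > 2 + e * (1 + real N) ^ e" by eventually_elim simp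
      then obtain n where n: "t n \<notin> E" "coeff (R (t n) y1) e \<noteq> 0" "norm (t n - t0) < \<delta>"
        "real n * norm (u x0) > 2 + e * (1 + real N) ^ e"
        unfolding eventually_sequentially by blast
      define F where "F j x = f j x - t n * g j x" for j x
      have F: "F j \<in> Hom V d" if "j \<in> V" for j
        unfolding F_def[abs_def] using that by (intro Hom_diff Hom_scale f g)
      have nzF: "no_nonzero_zero V V F"
        using n(1) by (auto simp: no_nonzero_zero_def F_def E_def)
      have relF: "relation V F u e (R (t n))" using relR[of "t n"] by (simp add: F_def[abs_def])
      have Rn: "R (t n) y1 \<noteq> 0" using n(2) by auto
      obtain q where q: "q \<in> polyfun V" "\<exists>x. q (\<lambda>j. F j x) \<noteq> 0"
        and mp: "\<forall>x w r1 r2 M. q (\<lambda>j. F j x) \<noteq> 0 \<longrightarrow> 0 < r1 \<longrightarrow> r1 < r2 \<longrightarrow> M \<ge> 0 \<longrightarrow>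
           norm (u x) > 1 + real e * (1 + M) ^ e \<longrightarrow>
           (\<exists>s T. r1 \<le> norm s \<and> norm s \<le> r2 \<and> norm T > M \<and> poly (R (t n) (\<lambda>j. F j x + s * w j)) T = 0)"
        using maximum_principle_for_fibres[where ?R0.0 = "R (t n)" and F = F and u = u,
          OF V(1) d _ nzF Hom_polyfun[OF u(1)] relF Rn] F by blast
      obtain z where z: "q (\<lambda>j. F j z) \<noteq> 0" using q(2) by blast
      define c where "c = (\<lambda>v. \<tau> n * x0 v)"
      have Fc: "F j c = y0 j" if j: "j \<in> V" for j
      proof -
        have "F j c = \<tau> n ^ d * F j x0" unfolding c_def by (rule Hom_scaling[OF F[OF j]])
        also have "F j x0 = (1 / \<tau> n) ^ d * g j x0"
          using X(2)[OF t0 j] by (simp add: F_def x0_def t_def algebra_simps)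
        also have "\<tau> n ^ d * ((1 / \<tau> n) ^ d * g j x0) = g j x0"
          by (simp add: \<tau>_def power_divide del: of_nat_Suc)
        finally show ?thesis by (simp add: y0_def)
      qed
      have uc: "norm (u c) > 2 + e * (1 + real N) ^ e"
      proof -
        have "real n \<le> real (Suc n) ^ d" using d by (intro order.trans[OF _ self_le_power]) auto
        then have "real n * norm (u x0) \<le> real (Suc n) ^ d * norm (u x0)" by (intro mult_right_mono) auto
        also have "\<dots> = norm (u c)"
          unfolding c_def Hom_scaling[OF u(1)] norm_mult norm_power by (simp add: \<tau>_def del: of_nat_Suc)
        finally show ?thesis using n(4) by simp
      qed
      \<comment> \<open>\<open>q\<close> may vanish at the image of \<open>c\<close>. A small step
        from \<open>c\<close> towards \<open>z\<close> leaves its zeros, while \<open>F\<close>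
        stays near \<open>y0\<close> and \<open>u\<close> stays large.\<close>
      define l where "l \<rho> = (\<lambda>v. c v + \<rho> * (z v - c v))" for \<rho>
      have "((\<lambda>\<rho>. l \<rho> v) \<longlongrightarrow> c v + 0 * (z v - c v)) (at 0)" for v
        unfolding l_def by (intro tendsto_intros)
      then have l: "((\<lambda>\<rho>. l \<rho> v) \<longlongrightarrow> c v) (at 0)" for v by simp
      have "(\<lambda>x. q (\<lambda>j. F j x)) \<in> polyfun V"
        by (rule polyfun_compose[OF q(1)]) (rule Hom_polyfun[OF F])
      from polyfun_line[OF this, where a = c and b = "\<lambda>v. z v - c v"] obtain p' where p': "\<And>\<rho>. q (\<lambda>j. F j (l \<rho>)) = poly p' \<rho>"
        unfolding l_def by blast
      have "l 1 = z" by (simp add: l_def)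
      then have "p' \<noteq> 0" using z p'[of 1] by auto
      have "\<forall>\<^sub>F \<rho> in at 0. q (\<lambda>j. F j (l \<rho>)) \<noteq> 0"
        using eventually_at_notin_finite[OF poly_roots_finite[OF \<open>p' \<noteq> 0\<close>], of 0] by (simp add: p')
      moreover have "\<forall>\<^sub>F \<rho> in at 0. \<forall>j\<in>V. norm (F j (l \<rho>) - y0 j) < \<delta>"
      proof (intro eventually_ball_finite[OF V(1)] ballI)
        fix j assume j: "j \<in> V"
        have "((\<lambda>\<rho>. F j (l \<rho>)) \<longlongrightarrow> F j c) (at 0)"
          by (rule polyfun_tendsto[OF Hom_polyfun[OF F[OF j]] l])
        then show "\<forall>\<^sub>F \<rho> in at 0. norm (F j (l \<rho>) - y0 j) < \<delta>"
          using \<delta> by (simp add: Fc[OF j] tendsto_iff dist_norm)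
      qed
      moreover have "\<forall>\<^sub>F \<rho> in at 0. norm (u (l \<rho>)) > 2 + e * (1 + real N) ^ e"
        by (rule order_tendstoD(1)[OF tendsto_norm[OF polyfun_tendsto[OF Hom_polyfun[OF u(1)] l]] uc])
      ultimately have "\<forall>\<^sub>F \<rho> in at (0::complex). q (\<lambda>j. F j (l \<rho>)) \<noteq> 0 \<and> (\<forall>j\<in>V. norm (F j (l \<rho>) - y0 j) < \<delta>)
          \<and> norm (u (l \<rho>)) > 2 + e * (1 + real N) ^ e" by eventually_elim simp
      then obtain \<rho> where \<rho>: "q (\<lambda>j. F j (l \<rho>)) \<noteq> 0" "\<forall>j\<in>V. norm (F j (l \<rho>) - y0 j) < \<delta>"
        "norm (u (l \<rho>)) > 2 + e * (1 + real N) ^ e"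
        using eventually_happens[of _ "at (0::complex)"] by (auto simp: trivial_limit_at)
      from mp[rule_format, OF \<rho>(1), of "r / 4" "r / 2" "real N" w] r(1) \<rho>(3)
      obtain s T where "r / 4 \<le> norm s" "norm s \<le> r / 2" "norm T > real N"
        "poly (R (t n) (\<lambda>j. F j (l \<rho>) + s * w j)) T = 0" by auto
      with \<rho>(2) n(3) have "norm (t n - t0) < \<delta> \<and> (\<forall>j\<in>V. norm (F j (l \<rho>) - y0 j) < \<delta>) \<and>
        r / 4 \<le> norm s \<and> norm s \<le> r / 2 \<and> norm T > N \<and>
        poly (R (t n) (\<lambda>j. F j (l \<rho>) + s * w j)) T = 0" by blast
      then show ?thesis unfolding \<delta>_def
        by (intro exI[of _ "t n"] exI[of _ "\<lambda>j. F j (l \<rho>)"] exI[of _ s] exI[of _ T])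
    qed
    then have "\<forall>N. \<exists>t Y s T. norm (t - t0) < 1 / (real N + 1) \<and> (\<forall>j\<in>V. norm (Y j - y0 j) < 1 / (real N + 1)) \<and>
        r / 4 \<le> norm s \<and> norm s \<le> r / 2 \<and> norm T > N \<and> poly (R t (\<lambda>j. Y j + s * w j)) T = 0"
      by (rule allI)
    from this[unfolded choice_iff] obtain t Y s T where all: "\<forall>N. norm (t N - t0) < 1 / (real N + 1) \<and>
        (\<forall>j\<in>V. norm (Y N j - y0 j) < 1 / (real N + 1)) \<and>
        r / 4 \<le> norm (s N) \<and> norm (s N) \<le> r / 2 \<and> norm (T N) > N \<and>
        poly (R (t N) (\<lambda>j. Y N j + s N * w j)) (T N) = 0"
      by (elim exE) (rule that)
    then have seq: "\<And>N. norm (t N - t0) < 1 / (real N + 1)"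
      "\<And>N j. j \<in> V \<Longrightarrow> norm (Y N j - y0 j) < 1 / (real N + 1)"
      "\<And>N. r / 4 \<le> norm (s N)" "\<And>N. norm (s N) \<le> r / 2" "\<And>N. norm (T N) > real N"
      "\<And>N. poly (R (t N) (\<lambda>j. Y N j + s N * w j)) (T N) = 0" by auto
    \<comment> \<open>\<open>t\<close> and \<open>Y\<close> converge by construction;
      \<open>s\<close> needs a convergent subsequence.\<close>
    have "compact (cball (0::complex) (r / 2))" by simp
    moreover have "\<forall>N. s N \<in> cball 0 (r / 2)" using seq(4) by simp
    ultimately obtain s' \<phi> where \<phi>: "strict_mono (\<phi> :: nat \<Rightarrow> nat)" "(s \<circ> \<phi>) \<longlonglongrightarrow> s'"
      unfolding compact_def by metis
    have small: "(\<lambda>N. 1 / (real N + 1)) \<longlonglongrightarrow> 0"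
      using LIMSEQ_Suc[OF lim_const_over_n[of "1::real"]] by (simp add: add.commute)
    have tlim: "t \<longlonglongrightarrow> t0"
      by (rule LIM_zero_cancel, rule Lim_null_comparison[OF _ small]) (auto intro!: always_eventually less_imp_le seq(1))
    have Ylim: "(\<lambda>N. Y N j) \<longlonglongrightarrow> y0 j" if "j \<in> V" for j
      by (rule LIM_zero_cancel, rule Lim_null_comparison[OF _ small]) (auto intro!: always_eventually less_imp_le seq(2)[OF that])
    have s': "r / 4 \<le> norm s'" "norm s' \<le> r / 2"
      using tendsto_lowerbound[OF tendsto_norm[OF \<phi>(2)], of "r / 4"]
        tendsto_upperbound[OF tendsto_norm[OF \<phi>(2)], of "r / 2"] seq(3,4)
      by (auto intro: always_eventually)
    define \<kappa> where "\<kappa> j = coeff (R t0 (\<lambda>j. y0 j + s' * w j)) j" for j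
    define k where "k j N = coeff (R (t (\<phi> N)) (\<lambda>j. Y (\<phi> N) j + s (\<phi> N) * w j)) j" for j N
    have klim: "k j \<longlonglongrightarrow> \<kappa> j" for j
    proof -
      have "(\<lambda>N. mpow V \<beta> (\<lambda>j. Y (\<phi> N) j + s (\<phi> N) * w j)) \<longlonglongrightarrow> mpow V \<beta> (\<lambda>j. y0 j + s' * w j)" for \<beta>
      proof (rule polyfun_tendsto[OF polyfun_mpow])
        fix j assume "j \<in> V"
        show "(\<lambda>N. Y (\<phi> N) j + s (\<phi> N) * w j) \<longlonglongrightarrow> y0 j + s' * w j"
          using LIMSEQ_subseq_LIMSEQ[OF Ylim[OF \<open>j \<in> V\<close>] \<phi>(1)] \<phi>(2)
          by (intro tendsto_intros) (auto simp: o_def)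
      qed
      moreover have "(\<lambda>N. t (\<phi> N)) \<longlonglongrightarrow> t0" using LIMSEQ_subseq_LIMSEQ[OF tlim \<phi>(1)] by (simp add: o_def)
      ultimately have "(\<lambda>N. if b - sum \<beta> V = j then C a \<beta> * t (\<phi> N) ^ a * mpow V \<beta> (\<lambda>j. Y (\<phi> N) j + s (\<phi> N) * w j) else 0)
        \<longlonglongrightarrow> (if b - sum \<beta> V = j then C a \<beta> * t0 ^ a * mpow V \<beta> (\<lambda>j. y0 j + s' * w j) else 0)" for a \<beta>
        by (auto intro!: tendsto_intros)
      then show ?thesis unfolding k_def[abs_def] \<kappa>_def coeffR by (intro tendsto_sum)
    qed
    have \<kappa>e: "norm (\<kappa> e) > 0" using annulus[OF s'] by (simp add: \<kappa>_def)
    \<comment> \<open>The leading coefficients tend to \<open>\<kappa> e\<close>, nonzero on the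
      annulus, so they eventually exceed half its norm; the root bound is then uniform in
      \<open>N\<close>, against \<open>norm (T N) > N\<close>.\<close>
    define K where "K = (\<Sum>j<e. norm (\<kappa> j) + 1) * (2 / norm (\<kappa> e))"
    have K0: "K \<ge> 0" unfolding K_def by (intro mult_nonneg_nonneg sum_nonneg) auto
    have "\<forall>\<^sub>F N in sequentially. \<forall>j\<in>{..<e}. norm (k j N) < norm (\<kappa> j) + 1"
      by (intro eventually_ball_finite ballI order_tendstoD(2)[OF tendsto_norm[OF klim]]) auto
    moreover have "\<forall>\<^sub>F N in sequentially. norm (k e N) > norm (\<kappa> e) / 2"
      using \<kappa>e by (intro order_tendstoD(1)[OF tendsto_norm[OF klim]]) auto
    moreover have "\<forall>\<^sub>F N in sequentially. real N > 1 + e * K"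
      using filterlim_real_sequentially by (simp add: filterlim_at_top_dense)
    ultimately have "\<forall>\<^sub>F N in sequentially. False"
    proof eventually_elim
      case (elim N)
      have "norm (T (\<phi> N)) \<le> 1 + e * K"
      proof (rule poly_root_norm_le[OF _ _ seq(6) K0])
        show "degree (R (t (\<phi> N)) (\<lambda>j. Y (\<phi> N) j + s (\<phi> N) * w j)) \<le> e"
          using relR by (simp add: relation_def)
        show "coeff (R (t (\<phi> N)) (\<lambda>j. Y (\<phi> N) j + s (\<phi> N) * w j)) e \<noteq> 0"
          using elim(2) \<kappa>e by (auto simp: k_def)
        fix j assume j: "j < e"
        have "norm (k j N) \<le> (\<Sum>j<e. norm (\<kappa> j) + 1)"
          using elim(1) j by (intro order.trans[OF less_imp_le member_le_sum]) (auto intro: add_nonneg_nonneg)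
        also have "\<dots> = K * (norm (\<kappa> e) / 2)" using \<kappa>e by (simp add: K_def)
        also have "\<dots> \<le> K * norm (k e N)" using elim(2) K0 by (intro mult_left_mono) auto
        finally show "norm (coeff (R (t (\<phi> N)) (\<lambda>j. Y (\<phi> N) j + s (\<phi> N) * w j)) j)
            \<le> K * norm (coeff (R (t (\<phi> N)) (\<lambda>j. Y (\<phi> N) j + s (\<phi> N) * w j)) e)" by (simp add: k_def)
      qed
      moreover have "real N \<le> real (\<phi> N)" using seq_suble[OF \<phi>(1)] by simp
      ultimately show False using seq(5)[of "\<phi> N"] elim(3) by linarith
    qed
    then show False by simp
  qed
qed

section \<open>Combinatorial eigenvalues\<close>

lemma subtensor_form_homogeneous:
  fixes F :: "'n::finite tensor"
  shows "homogeneous J (m - 1) (subtensor_form m F J j)"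
proof -
  have keys: "t \<in> monomials J (length is)"
    if "t = sum_list (map (\<lambda>i. Poly_Mapping.single i (1::nat)) is)" "set is \<subseteq> J" for t and "is" :: "'n list"
  proof -
    have "Poly_Mapping.keys t \<subseteq> set is \<and>
      (\<Sum>v\<in>UNIV. Poly_Mapping.lookup t v) = length is"
      unfolding that(1)
    proof (induction "is")
      case (Cons i "is")
      let ?s = "sum_list (map (\<lambda>i. Poly_Mapping.single i (1::nat)) is)"
      have "Poly_Mapping.keys (Poly_Mapping.single i (1::nat) + ?s) \<subseteq> insert i (set is)"
        using keys_add[of "Poly_Mapping.single i (1::nat)" ?s] Cons.IH by auto
      moreover have "(\<Sum>v\<in>UNIV. Poly_Mapping.lookup (Poly_Mapping.single i (1::nat) + ?s) v) = Suc (length is)"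
        using Cons.IH by (simp add: lookup_add lookup_single sum.distrib when_def)
      ultimately show ?case by simp
    qed simp
    moreover have "(\<Sum>v\<in>Poly_Mapping.keys t. Poly_Mapping.lookup t v) = (\<Sum>v\<in>UNIV. Poly_Mapping.lookup t v)"
      by (intro sum.mono_neutral_left) (auto simp: in_keys_iff)
    ultimately show ?thesis using that(2) by (auto simp: monomials_def)
  qed
  have "Poly_Mapping.keys (subtensor_form m F J j) \<subseteq>
    (\<Union>is\<in>{is \<in> index_tuples (m - 1). set is \<subseteq> J}. Poly_Mapping.keys
      (Poly_Mapping.single (sum_list (map (\<lambda>i. Poly_Mapping.single i (1::nat)) is)) (F (j # is))))"
    unfolding subtensor_form_def
    using keys_sum by (fastforce simp: Collect_conj_eq)
  also have "\<dots> \<subseteq> monomials J (m - 1)"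
  proof (rule UN_least)
    fix "is" assume "is \<in> {is \<in> index_tuples (m - 1). set is \<subseteq> J}"
    then have "sum_list (map (\<lambda>i. Poly_Mapping.single i (1::nat)) is) \<in> monomials J (m - 1)"
      using keys[OF refl, of "is"] by (simp add: index_tuples_def)
    then show "Poly_Mapping.keys (Poly_Mapping.single (sum_list (map (\<lambda>i. Poly_Mapping.single i (1::nat)) is))
        (F (j # is))) \<subseteq> monomials J (m - 1)" by simp
  qed
  finally show ?thesis by (simp add: homogeneous_def)
qed

text \<open>Both branches of \<open>resultant\<close> vanish when there is a nonzero root;
  homogeneity of the sub-tensor forms lets the resultant polynomial apply to them.\<close>

lemma R_sub_nonzero:
  fixes F :: "'n::finite tensor"
  assumes "R_sub m J F \<noteq> 0"
  shows "\<not> has_nonzero_root J (subtensor_form m F J)"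
proof (cases "\<exists>R :: ('n \<times> ('n \<Rightarrow>\<^sub>0 nat), int) mpoly. is_resultant_poly J (m - 1) R")
  case True
  define R :: "('n \<times> ('n \<Rightarrow>\<^sub>0 nat), int) mpoly" where "R = (SOME R. is_resultant_poly J (m - 1) R)"
  have "is_resultant_poly J (m - 1) R" unfolding R_def using True by (rule someI_ex)
  then have "eval_at_coeffs R (subtensor_form m F J) = 0 \<longleftrightarrow> has_nonzero_root J (subtensor_form m F J)"
    using subtensor_form_homogeneous[of J m F] unfolding is_resultant_poly_def by blast
  moreover have "R_sub m J F = eval_at_coeffs R (subtensor_form m F J)"
    using True by (simp add: R_sub_def resultant_def R_def)
  ultimately show ?thesis using assms by simp
next
  case False
  then show ?thesis using assms by (auto simp: R_sub_def resultant_def)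
qed

lemma prod_list_Hom: "finite J \<Longrightarrow> set is \<subseteq> J \<Longrightarrow> (\<lambda>x. prod_list (map x is)) \<in> Hom J (length is)"
proof (induction "is")
  case Nil
  then show ?case using Hom_const[of J 1] by simp
next
  case (Cons i "is")
  then show ?case using Hom_mult[of J "\<lambda>x. x i" 1 "\<lambda>x. prod_list (map x is)" "length is"] Hom_var[of J i] by simp
qed

lemma subtensor_eval_Hom:
  fixes F :: "'n::finite tensor"
  shows "(\<lambda>x. mpoly_eval x (subtensor_form m F J j)) \<in> Hom J (m - 1)"
  unfolding mpoly_eval_subtensor_form
proof (intro Hom_sum Hom_scale)
  fix "is" assume "is \<in> {is. is \<in> index_tuples (m - 1) \<and> set is \<subseteq> J}"
  then show "(\<lambda>x. prod_list (map x is)) \<in> Hom J (m - 1)"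
    using prod_list_Hom[of J "is"] by (auto simp: index_tuples_def)
qed

lemma finite_index_tuples [simp]: "finite (index_tuples m :: 'n::finite list set)"
  using finite_lists_length_eq[of "UNIV :: 'n set" m] by (simp add: index_tuples_def)

text \<open>Passing to the support of \<open>x\<close>: an index list that leaves \<open>J\<close>
  contributes a factor 0.\<close>

lemma tensor_apply_restrict:
  fixes F :: "'n::finite tensor" and x :: "complex ^ 'n"
  assumes "\<And>i. i \<notin> J \<Longrightarrow> vec_nth x i = 0"
  shows "vec_nth (tensor_apply m F x) j = mpoly_eval (vec_nth x) (subtensor_form m F J j)"
proof -
  have "prod_list (map (vec_nth x) is) = 0" if "\<not> set is \<subseteq> J" for "is"
    using that assms by (force simp: prod_list_zero_iff)
  then show ?thesis
    unfolding mpoly_eval_subtensor_form tensor_apply_def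
    by (simp, intro sum.mono_neutral_right) auto
qed

lemma cb_eigenvector_iff:
  fixes A B :: "'n::finite tensor"
  shows "cb_eigenvector m A B lam x \<longleftrightarrow> x \<noteq> 0 \<and>
    (\<forall>i. vec_nth x i \<noteq> 0 \<longrightarrow> vec_nth (tensor_apply m A x) i = lam * vec_nth (tensor_apply m B x) i)"
  unfolding cb_eigenvector_def by (auto simp: Finite_Cartesian_Product.vec_eq_iff)

definition pencil_eigenvalues :: "nat \<Rightarrow> 'n::finite tensor \<Rightarrow> 'n tensor \<Rightarrow> 'n set \<Rightarrow> complex set" where
  "pencil_eigenvalues m A B J = {t. \<exists>x. (\<exists>v\<in>J. x v \<noteq> 0) \<and>
     (\<forall>j\<in>J. mpoly_eval x (subtensor_form m A J j) = t * mpoly_eval x (subtensor_form m B J j))}"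

lemma cb_eigenvalue_in_pencil_eigenvalues:
  fixes A B :: "'n::finite tensor"
  assumes "cb_eigenvalue m A B lam"
  shows "lam \<in> (\<Union>J\<in>Pow UNIV - {{}}. pencil_eigenvalues m A B J)"
proof -
  obtain x where x: "cb_eigenvector m A B lam x" using assms by (auto simp: cb_eigenvalue_def)
  define J where "J = {i. vec_nth x i \<noteq> 0}"
  have r: "vec_nth (tensor_apply m F x) j = mpoly_eval (vec_nth x) (subtensor_form m F J j)" for F j
    by (rule tensor_apply_restrict) (simp add: J_def)
  have "J \<noteq> {}" using x by (auto simp: cb_eigenvector_iff J_def Finite_Cartesian_Product.vec_eq_iff)
  moreover have "lam \<in> pencil_eigenvalues m A B J"
    using x \<open>J \<noteq> {}\<close> unfolding pencil_eigenvalues_def cb_eigenvector_iff r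
    by (intro CollectI exI[of _ "vec_nth x"]) (auto simp: J_def)
  ultimately show ?thesis by blast
qed

section \<open>Summing the bounds over all supports\<close>

lemma sum_Pow_power_card:
  fixes d :: nat
  assumes "finite S"
  shows "(\<Sum>K\<in>Pow S. d ^ card K) = (d + 1) ^ card S"
  using prod_add[OF assms, of "\<lambda>_. d" "\<lambda>_. 1"] by simp

text \<open>Counts pairs \<open>j \<in> J\<close>: once \<open>j\<close> is chosen, the rest of
  \<open>J\<close> is any subset of \<open>S - {j}\<close>, and the binomial theorem sums over
  these. The empty set contributes 0.\<close>

lemma sum_Pow_card_power:
  fixes d :: nat
  assumes S: "finite S"
  shows "(\<Sum>J\<in>Pow S. card J * d ^ (card J - 1)) = card S * (d + 1) ^ (card S - 1)"
proof -
  have "(\<Sum>J\<in>Pow S. card J * d ^ (card J - 1)) = (\<Sum>J\<in>Pow S. \<Sum>j\<in>S. if j \<in> J then d ^ (card J - 1) else 0)"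
  proof (rule sum.cong[OF refl])
    fix J assume "J \<in> Pow S"
    then have "S \<inter> J = J" by auto
    then show "card J * d ^ (card J - 1) = (\<Sum>j\<in>S. if j \<in> J then d ^ (card J - 1) else 0)"
      using S by (simp add: sum.If_cases)
  qed
  also have "\<dots> = (\<Sum>j\<in>S. \<Sum>J\<in>Pow S. if j \<in> J then d ^ (card J - 1) else 0)" by (rule sum.swap)
  also have "\<dots> = (\<Sum>j\<in>S. (d + 1) ^ (card S - 1))"
  proof (rule sum.cong[OF refl])
    fix j assume j: "j \<in> S"
    have "(\<Sum>J\<in>Pow S. if j \<in> J then d ^ (card J - 1) else 0) = (\<Sum>J\<in>{J\<in>Pow S. j \<in> J}. d ^ (card J - 1))"
      using S by (simp add: sum.If_cases Int_def)
    also have "\<dots> = (\<Sum>K\<in>Pow (S - {j}). d ^ card K)"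
    proof (rule sum.reindex_bij_witness[where i = "insert j" and j = "\<lambda>J. J - {j}"])
      fix J assume J: "J \<in> {J \<in> Pow S. j \<in> J}"
      then have "finite J" using S finite_subset by auto
      with J show "d ^ card (J - {j}) = d ^ (card J - 1)" by simp
    qed (use j in auto)
    also have "\<dots> = (d + 1) ^ card (S - {j})" using S by (intro sum_Pow_power_card) simp
    also have "card (S - {j}) = card S - 1" using j by simp
    finally show "(\<Sum>J\<in>Pow S. if j \<in> J then d ^ (card J - 1) else 0) = (d + 1) ^ (card S - 1)" .
  qed
  finally show ?thesis by simp
qed

lemma cb_eigenvalue_count:
  fixes A B :: "'n::finite tensor"
  assumes m: "m \<ge> 1" and R: "\<And>J. J \<noteq> {} \<Longrightarrow> R_sub m J B \<noteq> 0"
  shows "finite {lam. cb_eigenvalue m A B lam} \<and>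
    card {lam. cb_eigenvalue m A B lam} \<le> CARD('n) * m ^ (CARD('n) - 1)"
proof (cases "m = 1")
  \<comment> \<open>In order 1 the forms are constants, outside the reach of
    \<open>pencil_eigenvalue_bound\<close>. The singletons \<open>J\<close> force
    \<open>B [j] \<noteq> 0\<close>, and each eigenvalue is one of the quotients
    \<open>A [j] / B [j]\<close>.\<close>
  case True
  have form: "mpoly_eval x (subtensor_form 1 F J j) = F [j]" for x J j and F :: "'n tensor"
  proof -
    have "{is. is \<in> index_tuples (1 - 1) \<and> set is \<subseteq> J} = {[]}" by (auto simp: index_tuples_def)
    then show ?thesis unfolding mpoly_eval_subtensor_form by simp
  qed
  have B: "B [j] \<noteq> 0" for j
  proof
    assume "B [j] = 0"
    then have "has_nonzero_root {j} (subtensor_form 1 B {j})"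
      unfolding has_nonzero_root_def form by (intro exI[of _ "\<lambda>_. 1"]) simp
    with R_sub_nonzero[OF R[of "{j}"]] True show False by simp
  qed
  have "{lam. cb_eigenvalue m A B lam} \<subseteq> (\<lambda>j. A [j] / B [j]) ` UNIV"
  proof
    fix lam assume "lam \<in> {lam. cb_eigenvalue m A B lam}"
    then obtain J where "lam \<in> pencil_eigenvalues 1 A B J" using cb_eigenvalue_in_pencil_eigenvalues True by blast
    then obtain j where "A [j] = lam * B [j]" unfolding pencil_eigenvalues_def form by auto
    then have "lam = A [j] / B [j]" using B[of j] by simp
    then show "lam \<in> (\<lambda>j. A [j] / B [j]) ` UNIV" by blast
  qed
  moreover have "finite ((\<lambda>j. A [j] / B [j]) ` UNIV)" by simp
  moreover have "card ((\<lambda>j. A [j] / B [j]) ` UNIV) \<le> CARD('n)" by (rule card_image_le) simp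
  ultimately have "finite {lam. cb_eigenvalue m A B lam}" "card {lam. cb_eigenvalue m A B lam} \<le> CARD('n)"
    by (meson finite_subset card_mono order.trans)+
  then show ?thesis using True by simp
next
  case False
  define d where "d = m - 1"
  have d: "d \<ge> 1" "m = d + 1" using m False by (auto simp: d_def)
  have bound: "finite (pencil_eigenvalues m A B J) \<and> card (pencil_eigenvalues m A B J) \<le> card J * d ^ (card J - 1)"
    if J: "J \<noteq> {}" for J
  proof -
    have "no_nonzero_zero J J (\<lambda>j x. mpoly_eval x (subtensor_form m B J j))"
      using R_sub_nonzero[OF R[OF J]] by (auto simp: has_nonzero_root_def no_nonzero_zero_def)
    from pencil_eigenvalue_bound[OF finite J d(1), of "\<lambda>j x. mpoly_eval x (subtensor_form m A J j)",
        OF _ _ this] show ?thesis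
      using subtensor_eval_Hom[of m _ J] unfolding d_def pencil_eigenvalues_def by blast
  qed
  let ?U = "\<Union>J\<in>Pow UNIV - {{}}. pencil_eigenvalues m A B J"
  have sub: "{lam. cb_eigenvalue m A B lam} \<subseteq> ?U"
    using cb_eigenvalue_in_pencil_eigenvalues by blast
  have fin: "finite ?U" using bound by auto
  have "card ?U \<le> (\<Sum>J\<in>Pow UNIV - {{}}. card (pencil_eigenvalues m A B J))" by (rule card_UN_le) simp
  also have "\<dots> \<le> (\<Sum>J\<in>Pow (UNIV :: 'n set) - {{}}. card J * d ^ (card J - 1))"
    using bound by (intro sum_mono) auto
  also have "\<dots> \<le> (\<Sum>J\<in>Pow (UNIV :: 'n set). card J * d ^ (card J - 1))" by (intro sum_mono2) auto
  also have "\<dots> = CARD('n) * m ^ (CARD('n) - 1)" unfolding d(2) by (rule sum_Pow_card_power) simp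
  finally show ?thesis using finite_subset[OF sub fin] card_mono[OF fin sub] by linarith
qed

section \<open>Uniqueness of eigenvectors for generic tensors\<close>

lemma lin_cube_const: "finite V \<Longrightarrow> (\<lambda>x. 1) \<in> lin (cube V n) (mpow V)"
proof -
  assume V: "finite V"
  have "mpow V (\<lambda>_. 0) \<in> lin (cube V n) (mpow V)"
    using V by (intro lin_base finite_cube) (auto simp: cube_def)
  moreover have "mpow V (\<lambda>_. 0) = (\<lambda>x. 1)" by auto
  ultimately show ?thesis by simp
qed

lemma lin_cube_power:
  assumes "finite V" "g \<in> lin (cube V m) (mpow V)"
  shows "(\<lambda>x. g x ^ n) \<in> lin (cube V (n * m)) (mpow V)"
proof (induction n)
  case (Suc n)
  from lin_cube_mult[OF assms Suc.IH] show ?case by simp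
qed (use lin_cube_const[OF assms(1)] in simp)

lemma lin_cube_prod:
  assumes "finite V" "finite S" "\<And>i. i \<in> S \<Longrightarrow> g i \<in> lin (cube V m) (mpow V)"
  shows "(\<lambda>x. \<Prod>i\<in>S. g i x) \<in> lin (cube V (card S * m)) (mpow V)"
  using assms(2,3)
proof (induction S rule: finite_induct)
  case (insert i S)
  have "(\<lambda>x. g i x * (\<Prod>i\<in>S. g i x)) \<in> lin (cube V (m + card S * m)) (mpow V)"
    using insert by (intro lin_cube_mult assms(1)) auto
  then show ?case using insert.hyps by simp
qed (use lin_cube_const[OF assms(1)] in simp)

text \<open>Quantities \<open>z i\<close> that are rational in fewer than \<open>card I\<close>
  parameters, with common denominator \<open>D\<close>, satisfy a polynomial relation. The
  parameters are functions on \<open>X\<close> and index their own variables, hence the evaluation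
  at \<open>\<lambda>\<theta>. \<theta> \<xi>\<close>.\<close>

lemma algebraic_dependence:
  fixes z :: "'i \<Rightarrow> 'x \<Rightarrow> complex" and \<Theta> :: "('x \<Rightarrow> complex) set"
  assumes I: "finite I" and \<Theta>: "finite \<Theta>" and card: "card \<Theta> < card I"
    and D: "\<exists>h\<in>polyfun \<Theta>. \<forall>\<xi>\<in>X. D \<xi> = h (\<lambda>\<theta>. \<theta> \<xi>)"
    and z: "\<And>i. i \<in> I \<Longrightarrow> \<exists>h\<in>polyfun \<Theta>. \<forall>\<xi>\<in>X. D \<xi> * z i \<xi> = h (\<lambda>\<theta>. \<theta> \<xi>)"
  shows "\<exists>h\<in>polyfun I. (\<exists>a. h a \<noteq> 0) \<and> (\<forall>\<xi>\<in>X. D \<xi> \<noteq> 0 \<longrightarrow> h (\<lambda>i. z i \<xi>) = 0)"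
proof -
  obtain h0 where h0: "h0 \<in> polyfun \<Theta>" "\<And>\<xi>. \<xi> \<in> X \<Longrightarrow> D \<xi> = h0 (\<lambda>\<theta>. \<theta> \<xi>)" using D by blast
  have "\<forall>i\<in>I. \<exists>h. h \<in> polyfun \<Theta> \<and> (\<forall>\<xi>\<in>X. D \<xi> * z i \<xi> = h (\<lambda>\<theta>. \<theta> \<xi>))" using z by blast
  from bchoice[OF this] obtain h where h: "\<And>i. i \<in> I \<Longrightarrow> h i \<in> polyfun \<Theta>"
    "\<And>i \<xi>. i \<in> I \<Longrightarrow> \<xi> \<in> X \<Longrightarrow> D \<xi> * z i \<xi> = h i (\<lambda>\<theta>. \<theta> \<xi>)" by blast
  have "\<forall>i\<in>I. \<exists>N. h i \<in> lin (cube \<Theta> N) (mpow \<Theta>)" using h(1) polyfun_lin_cube[OF \<Theta>] by blast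
  then obtain N where N: "\<And>i. i \<in> I \<Longrightarrow> h i \<in> lin (cube \<Theta> (N i)) (mpow \<Theta>)" by metis
  obtain N0 where N0: "h0 \<in> lin (cube \<Theta> N0) (mpow \<Theta>)" using polyfun_lin_cube[OF \<Theta> h0(1)] by blast
  define M where "M = Max (insert N0 (N ` I))"
  have "cube \<Theta> (N i) \<subseteq> cube \<Theta> M" if "i \<in> I" for i
    using that I by (intro cube_mono) (auto simp: M_def)
  then have hM: "h i \<in> lin (cube \<Theta> M) (mpow \<Theta>)" if "i \<in> I" for i
    using lin_mono[OF finite_cube[OF \<Theta>] _ N[OF that]] that by blast
  have "cube \<Theta> N0 \<subseteq> cube \<Theta> M" using I by (intro cube_mono) (auto simp: M_def)
  then have h0M: "h0 \<in> lin (cube \<Theta> M) (mpow \<Theta>)" using lin_mono[OF finite_cube[OF \<Theta>] _ N0] by blast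
  define q where "q = card I"
  define p where "p = card \<Theta>"
  \<comment> \<open>Makes \<open>((q * M + 1) * (e + 1)) ^ p\<close> equal to
    \<open>e * (e + 1) ^ p\<close>, just below \<open>(e + 1) ^ (p + 1)\<close>.\<close>
  define e where "e = (q * M + 1) ^ p"
  \<comment> \<open>Monomials in \<open>z\<close> cleared of denominators, all by the same power
    \<open>D ^ (e * q)\<close>, so that a relation between them descends to the monomials
    themselves.\<close>
  define \<Psi> where "\<Psi> t y = (\<Prod>i\<in>I. h i y ^ t i * h0 y ^ (e - t i))" for t y
  have \<Psi>: "\<Psi> t \<in> lin (cube \<Theta> (q * (e * M))) (mpow \<Theta>)" if t: "t \<in> cube I e" for t
    unfolding \<Psi>_def[abs_def] q_def
  proof (rule lin_cube_prod[OF \<Theta> I])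
    fix i assume i: "i \<in> I"
    have "(\<lambda>y. h i y ^ t i * h0 y ^ (e - t i)) \<in> lin (cube \<Theta> (t i * M + (e - t i) * M)) (mpow \<Theta>)"
      by (intro lin_cube_mult lin_cube_power \<Theta> hM h0M i)
    moreover have "t i * M + (e - t i) * M = e * M"
      using t i by (simp add: cube_def flip: add_mult_distrib)
    ultimately show "(\<lambda>y. h i y ^ t i * h0 y ^ (e - t i)) \<in> lin (cube \<Theta> (e * M)) (mpow \<Theta>)" by simp
  qed
  have "card (cube \<Theta> (q * (e * M))) = (q * (e * M) + 1) ^ p"
    using \<Theta> by (simp add: card_cube p_def)
  also have "\<dots> \<le> ((q * M + 1) * (e + 1)) ^ p" by (intro power_mono) (auto simp: algebra_simps)
  also have "\<dots> = e * (e + 1) ^ p" by (subst power_mult_distrib) (simp only: e_def)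
  also have "\<dots> < (e + 1) * (e + 1) ^ p" by (intro mult_strict_right_mono) auto
  also have "\<dots> = (e + 1) ^ (p + 1)" by simp
  also have "\<dots> \<le> (e + 1) ^ q" using card by (intro power_increasing) (auto simp: p_def q_def)
  also have "\<dots> = card (cube I e)" using I by (simp add: card_cube q_def)
  finally have lt: "card (cube \<Theta> (q * (e * M))) < card (cube I e)" .
  obtain c where c: "\<exists>t\<in>cube I e. c t \<noteq> 0" "\<And>y. (\<Sum>t\<in>cube I e. c t * \<Psi> t y) = 0"
    by (rule lin_dependent[OF finite_cube[OF \<Theta>] finite_cube[OF I] lt, of \<Psi> "mpow \<Theta>"])
       (rule \<Psi>, assumption, rule that)
  define H where "H x = (\<Sum>t\<in>cube I e. c t * mpow I t x)" for x
  show ?thesis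
  proof (intro bexI[of _ H] conjI ballI impI)
    show "H \<in> polyfun I"
      unfolding H_def[abs_def] by (intro polyfun_sum polyfun.mult polyfun.const polyfun_mpow)
    show "\<exists>a. H a \<noteq> 0"
    proof (rule ccontr)
      assume "\<not> ?thesis"
      then have H0: "(\<Sum>t\<in>cube I e. c t * mpow I t x) = 0" for x by (simp add: H_def)
      have "c t = 0" if "t \<in> cube I e" for t
        by (rule mpow_independent[where V = I and A = "cube I e" and c = c, OF I finite_cube[OF I] _ H0 that])
           (auto simp: cube_def)
      with c(1) show False by blast
    qed
    fix \<xi> assume \<xi>: "\<xi> \<in> X" "D \<xi> \<noteq> 0"
    have "\<Psi> t (\<lambda>\<theta>. \<theta> \<xi>) = D \<xi> ^ (e * q) * mpow I t (\<lambda>i. z i \<xi>)" if t: "t \<in> cube I e" for t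
    proof -
      have "\<Psi> t (\<lambda>\<theta>. \<theta> \<xi>) = (\<Prod>i\<in>I. D \<xi> ^ e * z i \<xi> ^ t i)"
        unfolding \<Psi>_def
      proof (rule prod.cong[OF refl])
        fix i assume i: "i \<in> I"
        then have "D \<xi> ^ e = D \<xi> ^ t i * D \<xi> ^ (e - t i)"
          using t by (simp add: cube_def flip: power_add)
        then show "h i (\<lambda>\<theta>. \<theta> \<xi>) ^ t i * h0 (\<lambda>\<theta>. \<theta> \<xi>) ^ (e - t i) = D \<xi> ^ e * z i \<xi> ^ t i"
          using i \<xi> h(2)[symmetric] h0(2)[symmetric] by (simp add: power_mult_distrib)
      qed
      then show ?thesis by (simp add: prod.distrib mpow_def q_def power_mult)
    qed
    then have "(\<Sum>t\<in>cube I e. c t * \<Psi> t (\<lambda>\<theta>. \<theta> \<xi>)) = D \<xi> ^ (e * q) * H (\<lambda>i. z i \<xi>)"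
      by (simp add: H_def sum_distrib_left mult.left_commute)
    with c(2) \<xi>(2) show "H (\<lambda>i. z i \<xi>) = 0" by simp
  qed
qed

section \<open>Zariski density of nonvanishing loci\<close>

lemma polyfun_mpoly:
  assumes "h \<in> polyfun V"
  shows "\<exists>p :: ('v, complex) mpoly. \<forall>x. mpoly_eval x p = h x"
  using assms
proof induction
  case (const a)
  show ?case by (intro exI[of _ "Poly_Mapping.single 0 a"]) (simp add: mpoly_eval_single)
next
  case (var v)
  show ?case
    by (intro exI[of _ "Poly_Mapping.single (Poly_Mapping.single v 1) 1"])
       (simp add: mpoly_eval_single monom_eval_def)
next
  case (add g h)
  then show ?case by (metis mpoly_eval_add)
next
  case (mult g h)
  then show ?case by (metis mpoly_eval_mult)
qed

text \<open>The polynomials of a Zariski open set may involve variables outside the affine space, so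
  every coordinate must be polynomial in \<open>s\<close>, including those frozen at
  \<open>undefined\<close>.\<close>

lemma mpoly_eval_curve:
  fixes p :: "('v, complex) mpoly"
  assumes "\<And>v. \<exists>r. \<forall>s. l s v = poly r s"
  shows "\<exists>r. \<forall>s. mpoly_eval (l s) p = poly r s"
proof -
  obtain r where r: "\<And>v s. l s v = poly (r v) s" using assms by metis
  have "mpoly_eval (l s) p = poly (\<Sum>t\<in>Poly_Mapping.keys p. [:Poly_Mapping.lookup p t:] *
      (\<Prod>v\<in>Poly_Mapping.keys t. r v ^ Poly_Mapping.lookup t v)) s" for s
    by (simp add: mpoly_eval_def monom_eval_def r poly_sum poly_prod)
  then show ?thesis by blast
qed

lemma common_nonroot:
  fixes p q :: "complex poly"
  assumes "poly p a \<noteq> 0" "poly q b \<noteq> 0"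
  obtains s where "poly p s \<noteq> 0" "poly q s \<noteq> 0"
proof -
  have "p * q \<noteq> 0" using assms by auto
  then obtain s where "poly (p * q) s \<noteq> 0" using poly_all_0_iff_0 by blast
  then show ?thesis using that by auto
qed

text \<open>Join a point where the partial product is nonzero to one where the new factor is; along
  the line each of them vanishes only finitely often.\<close>

lemma polyfun_prod_nonzero:
  assumes "finite S" "\<And>c. c \<in> S \<Longrightarrow> h c \<in> polyfun V" "\<And>c. c \<in> S \<Longrightarrow> \<exists>a. h c a \<noteq> 0"
  shows "\<exists>a. (\<Prod>c\<in>S. h c a) \<noteq> 0"
  using assms
proof (induction S rule: finite_induct)
  case (insert c S)
  then obtain a where a: "(\<Prod>c\<in>S. h c a) \<noteq> 0" by blast
  obtain b where b: "h c b \<noteq> 0" using insert.prems by blast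
  have "(\<lambda>x. \<Prod>c\<in>S. h c x) \<in> polyfun V" using insert.prems by (intro polyfun_prod) auto
  from polyfun_line[OF this, where a = a and b = "\<lambda>v. b v - a v"]
  obtain p where p: "\<And>s. (\<Prod>c\<in>S. h c (\<lambda>v. a v + s * (b v - a v))) = poly p s" by blast
  have "h c \<in> polyfun V" using insert.prems by simp
  from polyfun_line[OF this, where a = a and b = "\<lambda>v. b v - a v"]
  obtain q where q: "\<And>s. h c (\<lambda>v. a v + s * (b v - a v)) = poly q s" by blast
  have "poly p 0 \<noteq> 0" "poly q 1 \<noteq> 0" using a b p[of 0] q[of 1] by auto
  then obtain s where "poly p s \<noteq> 0" "poly q s \<noteq> 0" by (rule common_nonroot)
  then show ?case using insert.hyps p[of s] q[of s]
    by (intro exI[of _ "\<lambda>v. a v + s * (b v - a v)"]) simp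
qed simp

lemma zariski_dense_nonzero_locus:
  assumes h: "h \<in> polyfun I" and a: "h a \<noteq> 0"
  defines "U \<equiv> {w \<in> affine_space I. h w \<noteq> 0}"
  shows "openin (zariski_topology I) U"
    and "zariski_topology I closure_of U = topspace (zariski_topology I)"
proof -
  obtain P :: "('a, complex) mpoly" where P: "\<And>x. mpoly_eval x P = h x" using polyfun_mpoly[OF h] by blast
  have "U = affine_space I - {x. \<forall>p\<in>{P}. mpoly_eval x p = 0}" by (auto simp: U_def P)
  then show "openin (zariski_topology I) U" unfolding openin_zariski zariski_open_def by blast
  show "zariski_topology I closure_of U = topspace (zariski_topology I)"
    unfolding dense_intersects_open
  proof (intro allI impI)
    fix T assume T: "openin (zariski_topology I) T \<and> T \<noteq> {}"
    then obtain Q :: "('a, complex) mpoly set" where Q: "T = affine_space I - {x. \<forall>p\<in>Q. mpoly_eval x p = 0}"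
      by (auto simp: zariski_open_def)
    then obtain b p where b: "b \<in> affine_space I" "p \<in> Q" "mpoly_eval b p \<noteq> 0" using T by blast
    \<comment> \<open>The line from \<open>a\<close> to \<open>b\<close>, corrected outside
      \<open>I\<close> so that it stays in the affine space; \<open>h\<close> depends on the
      coordinates in \<open>I\<close> only.\<close>
    define l where "l s = (\<lambda>v. if v \<in> I then a v + s * (b v - a v) else undefined)" for s
    have "\<exists>r. \<forall>s. l s v = poly r s" for v
    proof (cases "v \<in> I")
      case True
      then show ?thesis by (intro exI[of _ "[:a v, b v - a v:]"]) (simp add: l_def)
    next
      case False
      then show ?thesis by (intro exI[of _ "[:undefined:]"]) (simp add: l_def)
    qed
    from mpoly_eval_curve[where l = l and p = p, OF this] obtain r1 where r1: "\<And>s. mpoly_eval (l s) p = poly r1 s" by blast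
    from polyfun_line[OF h, where a = a and b = "\<lambda>v. b v - a v"]
    obtain r2 where r2: "\<And>s. h (\<lambda>v. a v + s * (b v - a v)) = poly r2 s" by blast
    have hl: "h (l s) = poly r2 s" for s
      unfolding r2[symmetric] by (rule polyfun_cong[OF h]) (simp add: l_def)
    have "l 1 = b" using b(1) by (auto simp: l_def affine_space_def PiE_def extensional_def)
    then have "poly r1 1 \<noteq> 0" using b(3) r1[of 1] by simp
    moreover have "poly r2 0 \<noteq> 0" using a r2[of 0] by simp
    ultimately obtain s where s: "poly r1 s \<noteq> 0" "poly r2 s \<noteq> 0" by (rule common_nonroot)
    have "l s \<in> affine_space I" by (auto simp: l_def affine_space_def)
    moreover have "mpoly_eval (l s) p \<noteq> 0" "h (l s) \<noteq> 0" using s r1 hl by simp_all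
    ultimately have "l s \<in> U \<inter> T" unfolding U_def Q using b(2) by blast
    then show "U \<inter> T \<noteq> {}" by blast
  qed
qed

section \<open>Two eigenvectors for one eigenvalue\<close>

type_synonym 'n config = "'n tensor \<times> 'n tensor \<times> complex \<times> ('n \<Rightarrow> complex) \<times> ('n \<Rightarrow> complex)"

definition tensor_coord :: "'n list + 'n list \<Rightarrow> 'n config \<Rightarrow> complex" where
  "tensor_coord k = (\<lambda>(A, B, lam, x, y). case_sum A B k)"

definition eigen_eq :: "nat \<Rightarrow> 'n tensor \<Rightarrow> 'n tensor \<Rightarrow> complex \<Rightarrow> ('n \<Rightarrow> complex) \<Rightarrow> 'n \<Rightarrow> bool" where
  "eigen_eq d A B lam x i \<longleftrightarrow>
     (\<Sum>is\<in>index_tuples d. A (i # is) * prod_list (map x is)) =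
     lam * (\<Sum>is\<in>index_tuples d. B (i # is) * prod_list (map x is))"

definition bad_configs :: "nat \<Rightarrow> 'n set \<Rightarrow> 'n set \<Rightarrow> 'n \<Rightarrow> 'n \<Rightarrow> 'n config set" where
  "bad_configs d S T p r = {(A, B, lam, x, y).
     (\<forall>i. i \<notin> S \<longrightarrow> x i = 0) \<and> (\<forall>i. i \<notin> T \<longrightarrow> y i = 0) \<and> x p = 1 \<and> y r = 1 \<and>
     (\<forall>i\<in>S. eigen_eq d A B lam x i) \<and> (\<forall>i\<in>T. eigen_eq d A B lam y i)}"

text \<open>
  Two eigenvectors with supports \<open>S\<close>, \<open>T\<close> for the same eigenvalue impose \<open>|S| + |T|\<close> independent linear
  conditions on \<open>A\<close>, and after normalisation they depend, with the eigenvalue, on \<open>|S| + |T| - 1\<close>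
  parameters. For \<open>i \<in> S \<inter> T\<close> the two conditions on the row \<open>i\<close> of \<open>A\<close> are solved for the entries at
  \<open>(p,\<dots>,p)\<close> and \<open>(q,p,\<dots>,p)\<close>; the determinant is \<open>y\<^sub>q - x\<^sub>q\<close>.
\<close>
lemma bad_configs_dependence:
  fixes S T :: "'n::finite set"
  assumes d: "d \<ge> 1" and p: "p \<in> S" and r: "r \<in> T" and common: "S \<inter> T \<noteq> {} \<Longrightarrow> p = r \<and> q \<noteq> p"
  defines "I \<equiv> (index_tuples (Suc d) :: 'n list set) <+> (index_tuples (Suc d) :: 'n list set)"
  shows "\<exists>h\<in>polyfun I. (\<exists>a. h a \<noteq> 0) \<and>
    (\<forall>(A, B, lam, x, y)\<in>bad_configs d S T p r. (S \<inter> T \<noteq> {} \<longrightarrow> x q \<noteq> y q) \<longrightarrow> h (case_sum A B) = 0)"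
proof -
  let ?X = "bad_configs d S T p r"
  define P where "P = replicate d p"
  define Q where "Q = q # replicate (d - 1) p"
  define O' where "O' = replicate d r"
  \<comment> \<open>One entry of \<open>A\<close> per condition: rows in \<open>S\<close> are solved
    at \<open>P\<close>, rows in \<open>T - S\<close> at \<open>O'\<close>, and the second condition
    of a row in \<open>S \<inter> T\<close> at \<open>Q\<close>.\<close>
  define Sol where "Sol = (\<lambda>i. i # P) ` S \<union> (\<lambda>i. i # O') ` (T - S) \<union> (\<lambda>i. i # Q) ` (S \<inter> T)"
  define lamf :: "'n config \<Rightarrow> complex" where "lamf = (\<lambda>(A, B, lam, x, y). lam)"
  define xf :: "'n \<Rightarrow> 'n config \<Rightarrow> complex" where "xf i = (\<lambda>(A, B, lam, x, y). x i)" for i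
  define yf :: "'n \<Rightarrow> 'n config \<Rightarrow> complex" where "yf i = (\<lambda>(A, B, lam, x, y). y i)" for i
  define D where "D = (if S \<inter> T = {} then (\<lambda>_. 1) else (\<lambda>\<xi>. xf q \<xi> - yf q \<xi>))"
  \<comment> \<open>The free parameters: unsolved entries, the eigenvalue and the coordinates not
    normalised to 1, at most \<open>card I - (card S + card T) + 1 + (card S - 1) + (card T - 1) =
    card I - 1\<close> in number.\<close>
  define \<Theta> where "\<Theta> = tensor_coord ` (I - Inl ` Sol) \<union> {lamf} \<union> xf ` (S - {p}) \<union> yf ` (T - {r})"
  define PT where "PT = {g. \<exists>h\<in>polyfun \<Theta>. \<forall>\<xi>\<in>?X. g \<xi> = h (\<lambda>\<theta>. \<theta> \<xi>)}"
  have finI: "finite I" by (simp add: I_def)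
  have len: "length P = d" "length Q = d" "length O' = d" using d by (auto simp: P_def Q_def O'_def)
  have PQ: "P \<noteq> Q" if "S \<inter> T \<noteq> {}" using common[OF that] d by (cases d) (auto simp: P_def Q_def)
  have SolI: "Inl ` Sol \<subseteq> I" using len by (auto simp: Sol_def I_def index_tuples_def)
  have finSol: "finite Sol" by (simp add: Sol_def)
  have "card Sol = card ((\<lambda>i. i # P) ` S \<union> (\<lambda>i. i # O') ` (T - S)) + card ((\<lambda>i. i # Q) ` (S \<inter> T))"
    unfolding Sol_def using PQ by (intro card_Un_disjoint) auto
  also have "card ((\<lambda>i. i # P) ` S \<union> (\<lambda>i. i # O') ` (T - S)) = card ((\<lambda>i. i # P) ` S) + card ((\<lambda>i. i # O') ` (T - S))"
    by (intro card_Un_disjoint) auto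
  also have "card ((\<lambda>i. i # P) ` S) = card S" by (intro card_image) (auto simp: inj_on_def)
  also have "card ((\<lambda>i. i # O') ` (T - S)) = card (T - S)" by (intro card_image) (auto simp: inj_on_def)
  also have "card ((\<lambda>i. i # Q) ` (S \<inter> T)) = card (S \<inter> T)" by (intro card_image) (auto simp: inj_on_def)
  also have "card S + card (T - S) + card (S \<inter> T) = card S + card T"
    using card_Int_Diff[of T S] by (simp add: Int_commute)
  finally have cardSol: "card Sol = card S + card T" .
  have "card \<Theta> \<le> (card I - card Sol) + 1 + (card S - 1) + (card T - 1)"
  proof -
    have "card (I - Inl ` Sol) = card I - card Sol"
      using SolI finSol by (simp add: card_Diff_subset card_image)
    then have "card (tensor_coord ` (I - Inl ` Sol)) \<le> card I - card Sol"
      using card_image_le[of "I - Inl ` Sol" tensor_coord] finI by simp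
    moreover have "card (xf ` (S - {p})) \<le> card S - 1"
      using card_image_le[of "S - {p}" xf] p by simp
    moreover have "card (yf ` (T - {r})) \<le> card T - 1"
      using card_image_le[of "T - {r}" yf] r by simp
    moreover have "card {lamf} = 1" by simp
    ultimately show ?thesis unfolding \<Theta>_def
      by (intro order.trans[OF card_Un_le] add_mono) auto
  qed
  moreover have "card Sol \<le> card I"
    using card_mono[OF finI SolI] by (simp add: card_image)
  moreover have "card S > 0" "card T > 0" using p r by (auto simp: card_gt_0_iff)
  ultimately have card\<Theta>: "card \<Theta> < card I" using cardSol by linarith
  have fin\<Theta>: "finite \<Theta>" using finI by (simp add: \<Theta>_def)
  have PT_add: "(\<lambda>\<xi>. g \<xi> + g' \<xi>) \<in> PT" if "g \<in> PT" "g' \<in> PT" for g g'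
  proof -
    from that obtain h h' where "h \<in> polyfun \<Theta>" "h' \<in> polyfun \<Theta>"
      "\<forall>\<xi>\<in>?X. g \<xi> = h (\<lambda>\<theta>. \<theta> \<xi>)" "\<forall>\<xi>\<in>?X. g' \<xi> = h' (\<lambda>\<theta>. \<theta> \<xi>)" unfolding PT_def by blast
    then show ?thesis unfolding PT_def
      by (intro CollectI bexI[of _ "\<lambda>y. h y + h' y"]) (auto intro: polyfun.add)
  qed
  have PT_mult: "(\<lambda>\<xi>. g \<xi> * g' \<xi>) \<in> PT" if "g \<in> PT" "g' \<in> PT" for g g'
  proof -
    from that obtain h h' where "h \<in> polyfun \<Theta>" "h' \<in> polyfun \<Theta>"
      "\<forall>\<xi>\<in>?X. g \<xi> = h (\<lambda>\<theta>. \<theta> \<xi>)" "\<forall>\<xi>\<in>?X. g' \<xi> = h' (\<lambda>\<theta>. \<theta> \<xi>)" unfolding PT_def by blast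
    then show ?thesis unfolding PT_def
      by (intro CollectI bexI[of _ "\<lambda>y. h y * h' y"]) (auto intro: polyfun.mult)
  qed
  have PT_const: "(\<lambda>_. a) \<in> PT" for a
    unfolding PT_def by (intro CollectI bexI[of _ "\<lambda>_. a"]) (auto intro: polyfun.const)
  have PT_\<Theta>: "\<theta> \<in> PT" if "\<theta> \<in> \<Theta>" for \<theta>
    unfolding PT_def using that by (intro CollectI bexI[of _ "\<lambda>y. y \<theta>"]) (auto intro: polyfun.var)
  have PT_cong: "g \<in> PT" if "g' \<in> PT" "\<And>\<xi>. \<xi> \<in> ?X \<Longrightarrow> g \<xi> = g' \<xi>" for g g'
    using that unfolding PT_def by auto
  have PT_diff: "(\<lambda>\<xi>. g \<xi> - g' \<xi>) \<in> PT" if "g \<in> PT" "g' \<in> PT" for g g'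
    using PT_add[OF that(1) PT_mult[OF PT_const[of "-1"] that(2)]] by simp
  have PT_sum: "(\<lambda>\<xi>. \<Sum>a\<in>A. g a \<xi>) \<in> PT" if "\<And>a. a \<in> A \<Longrightarrow> g a \<in> PT" for g and A :: "'n list set"
    using that by (induction A rule: infinite_finite_induct) (auto intro: PT_const PT_add)
  have PT_prod_list: "(\<lambda>\<xi>. prod_list (map (\<lambda>k. g k \<xi>) is)) \<in> PT" if "\<And>k. g k \<in> PT" for g and "is" :: "'n list"
    using that by (induction "is") (auto intro: PT_const PT_mult)
  have PT_lam: "lamf \<in> PT" by (rule PT_\<Theta>) (simp add: \<Theta>_def)
  have PT_x: "xf i \<in> PT" for i
  proof -
    consider "i \<notin> S" | "i = p" | "i \<in> S - {p}" by blast
    then show ?thesis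
    proof cases
      case 1
      then show ?thesis by (intro PT_cong[OF PT_const[of 0]]) (auto simp: bad_configs_def xf_def)
    next
      case 2
      then show ?thesis by (intro PT_cong[OF PT_const[of 1]]) (auto simp: bad_configs_def xf_def)
    next
      case 3
      then show ?thesis by (intro PT_\<Theta>) (simp add: \<Theta>_def)
    qed
  qed
  have PT_y: "yf i \<in> PT" for i
  proof -
    consider "i \<notin> T" | "i = r" | "i \<in> T - {r}" by blast
    then show ?thesis
    proof cases
      case 1
      then show ?thesis by (intro PT_cong[OF PT_const[of 0]]) (auto simp: bad_configs_def yf_def)
    next
      case 2
      then show ?thesis by (intro PT_cong[OF PT_const[of 1]]) (auto simp: bad_configs_def yf_def)
    next
      case 3
      then show ?thesis by (intro PT_\<Theta>) (simp add: \<Theta>_def)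
    qed
  qed
  have PT_D: "D \<in> PT" unfolding D_def using PT_const PT_diff[OF PT_x PT_y] by simp
  have PT_coord: "tensor_coord k \<in> PT" if "k \<in> I" "k \<notin> Inl ` Sol" for k
    using that by (intro PT_\<Theta>) (simp add: \<Theta>_def)
  \<comment> \<open>The right-hand side when the eigenvalue equation of row \<open>i\<close> is
    solved for its entries at \<open>U\<close>; \<open>g\<close> is \<open>xf\<close> or
    \<open>yf\<close>.\<close>
  define rest where "rest g i U \<xi> = lamf \<xi> * (\<Sum>is\<in>index_tuples d. tensor_coord (Inr (i # is)) \<xi> * prod_list (map (\<lambda>k. g k \<xi>) is))
     - (\<Sum>is\<in>index_tuples d - U. tensor_coord (Inl (i # is)) \<xi> * prod_list (map (\<lambda>k. g k \<xi>) is))"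
    for g :: "'n \<Rightarrow> 'n config \<Rightarrow> complex" and i U \<xi>
  have PT_rest: "rest g i U \<in> PT" if g: "\<And>k. g k \<in> PT" and U: "\<And>is. is \<notin> U \<Longrightarrow> i # is \<notin> Sol" for g i U
    unfolding rest_def[abs_def]
  proof (intro PT_diff PT_mult PT_lam PT_sum PT_prod_list g PT_coord)
    fix "is" :: "'n list" assume "is \<in> index_tuples d"
    then show "Inr (i # is) \<in> I" by (auto simp: I_def index_tuples_def intro!: InrI)
  next
    fix "is" :: "'n list" assume "is \<in> index_tuples d - U"
    then show "Inl (i # is) \<in> I" "Inl (i # is) \<notin> Inl ` Sol" using U by (auto simp: I_def index_tuples_def intro!: InlI)
  qed auto
  have rest_x: "(\<Sum>is\<in>U. tensor_coord (Inl (i # is)) \<xi> * prod_list (map (\<lambda>k. xf k \<xi>) is)) = rest xf i U \<xi>"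
    if "\<xi> \<in> ?X" "i \<in> S" "U \<subseteq> index_tuples d" for i U \<xi>
  proof -
    obtain A B lam x y where \<xi>: "\<xi> = (A, B, lam, x, y)" by (cases \<xi>)
    have "eigen_eq d A B lam x i" using that(1,2) by (auto simp: \<xi> bad_configs_def)
    then show ?thesis
      using sum.subset_diff[OF that(3), of "\<lambda>is. A (i # is) * prod_list (map x is)"]
      by (simp add: rest_def eigen_eq_def \<xi> tensor_coord_def xf_def lamf_def algebra_simps)
  qed
  have rest_y: "(\<Sum>is\<in>U. tensor_coord (Inl (i # is)) \<xi> * prod_list (map (\<lambda>k. yf k \<xi>) is)) = rest yf i U \<xi>"
    if "\<xi> \<in> ?X" "i \<in> T" "U \<subseteq> index_tuples d" for i U \<xi>
  proof -
    obtain A B lam x y where \<xi>: "\<xi> = (A, B, lam, x, y)" by (cases \<xi>)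
    have "eigen_eq d A B lam y i" using that(1,2) by (auto simp: \<xi> bad_configs_def)
    then show ?thesis
      using sum.subset_diff[OF that(3), of "\<lambda>is. A (i # is) * prod_list (map y is)"]
      by (simp add: rest_def eigen_eq_def \<xi> tensor_coord_def yf_def lamf_def algebra_simps)
  qed
  have xP: "prod_list (map (\<lambda>k. xf k \<xi>) P) = 1" "prod_list (map (\<lambda>k. xf k \<xi>) Q) = xf q \<xi>"
    and yO: "prod_list (map (\<lambda>k. yf k \<xi>) O') = 1"
    if "\<xi> \<in> ?X" for \<xi>
    using that by (auto simp: P_def Q_def O'_def bad_configs_def xf_def yf_def map_replicate_const)
  have yP: "prod_list (map (\<lambda>k. yf k \<xi>) P) = 1" "prod_list (map (\<lambda>k. yf k \<xi>) Q) = yf q \<xi>"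
    if "\<xi> \<in> ?X" "p = r" for \<xi>
    using that by (auto simp: P_def Q_def bad_configs_def yf_def)
  have mem: "P \<in> index_tuples d" "Q \<in> index_tuples d" "O' \<in> index_tuples d" using len by (auto simp: index_tuples_def)
  have PT_Sol: "(\<lambda>\<xi>. D \<xi> * tensor_coord (Inl k) \<xi>) \<in> PT" if k: "k \<in> Sol" for k
  proof -
    obtain i "is" where kk: "k = i # is" using k by (auto simp: Sol_def)
    consider "i \<in> S - T" "is = P" | "i \<in> T - S" "is = O'" | "i \<in> S \<inter> T" "is = P" | "i \<in> S \<inter> T" "is = Q"
      using k unfolding kk Sol_def by auto
    then show ?thesis
    proof cases
      case 1
      have "rest xf i {P} \<in> PT" using 1 by (intro PT_rest PT_x) (auto simp: Sol_def)
      then have "tensor_coord (Inl k) \<in> PT"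
        by (rule PT_cong) (use 1 rest_x[of _ i "{P}"] mem xP kk in auto)
      then show ?thesis by (intro PT_mult PT_D)
    next
      case 2
      have "rest yf i {O'} \<in> PT" using 2 by (intro PT_rest PT_y) (auto simp: Sol_def)
      then have "tensor_coord (Inl k) \<in> PT"
        by (rule PT_cong) (use 2 rest_y[of _ i "{O'}"] mem yO kk in auto)
      then show ?thesis by (intro PT_mult PT_D)
    next
      case 3
      have pr: "p = r" "P \<noteq> Q" "S \<inter> T \<noteq> {}" using common PQ 3 by auto
      have "rest xf i {P, Q} \<in> PT" "rest yf i {P, Q} \<in> PT"
        using 3 by (intro PT_rest PT_x PT_y; auto simp: Sol_def)+
      \<comment> \<open>Cramer's rule: the entries \<open>a\<close> at \<open>P\<close> and
        \<open>b\<close> at \<open>Q\<close> satisfy \<open>a + x q * b = rest xf\<close> and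
        \<open>a + y q * b = rest yf\<close>. This case solves for \<open>a\<close>, the next one
        for \<open>b\<close>.\<close>
      then have "(\<lambda>\<xi>. xf q \<xi> * rest yf i {P, Q} \<xi> - yf q \<xi> * rest xf i {P, Q} \<xi>) \<in> PT"
        by (intro PT_diff PT_mult PT_x PT_y)
      then show ?thesis
      proof (rule PT_cong)
        fix \<xi> assume \<xi>: "\<xi> \<in> ?X"
        show "D \<xi> * tensor_coord (Inl k) \<xi> = xf q \<xi> * rest yf i {P, Q} \<xi> - yf q \<xi> * rest xf i {P, Q} \<xi>"
          using rest_x[OF \<xi>, of i "{P, Q}", symmetric] rest_y[OF \<xi>, of i "{P, Q}", symmetric]
            3 mem pr xP[OF \<xi>] yP[OF \<xi> pr(1)] by (simp add: kk D_def algebra_simps)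
      qed
    next
      case 4
      have pr: "p = r" "P \<noteq> Q" "S \<inter> T \<noteq> {}" using common PQ 4 by auto
      have "rest xf i {P, Q} \<in> PT" "rest yf i {P, Q} \<in> PT"
        using 4 by (intro PT_rest PT_x PT_y; auto simp: Sol_def)+
      then have "(\<lambda>\<xi>. rest xf i {P, Q} \<xi> - rest yf i {P, Q} \<xi>) \<in> PT"
        by (intro PT_diff)
      then show ?thesis
      proof (rule PT_cong)
        fix \<xi> assume \<xi>: "\<xi> \<in> ?X"
        show "D \<xi> * tensor_coord (Inl k) \<xi> = rest xf i {P, Q} \<xi> - rest yf i {P, Q} \<xi>"
          using rest_x[OF \<xi>, of i "{P, Q}", symmetric] rest_y[OF \<xi>, of i "{P, Q}", symmetric]
            4 mem pr xP[OF \<xi>] yP[OF \<xi> pr(1)] by (simp add: kk D_def algebra_simps)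
      qed
    qed
  qed
  have "\<exists>h\<in>polyfun I. (\<exists>a. h a \<noteq> 0) \<and> (\<forall>\<xi>\<in>?X. D \<xi> \<noteq> 0 \<longrightarrow> h (\<lambda>i. tensor_coord i \<xi>) = 0)"
  proof (rule algebraic_dependence[OF finI fin\<Theta> card\<Theta>])
    show "\<exists>h\<in>polyfun \<Theta>. \<forall>\<xi>\<in>?X. D \<xi> = h (\<lambda>\<theta>. \<theta> \<xi>)" using PT_D by (simp add: PT_def)
    fix i assume i: "i \<in> I"
    have "(\<lambda>\<xi>. D \<xi> * tensor_coord i \<xi>) \<in> PT"
      using PT_Sol PT_mult[OF PT_D PT_coord[OF i]] by (cases "i \<in> Inl ` Sol") auto
    then show "\<exists>h\<in>polyfun \<Theta>. \<forall>\<xi>\<in>?X. D \<xi> * tensor_coord i \<xi> = h (\<lambda>\<theta>. \<theta> \<xi>)" by (simp add: PT_def)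
  qed
  then obtain h where h: "h \<in> polyfun I" "\<exists>a. h a \<noteq> 0"
    "\<And>\<xi>. \<xi> \<in> ?X \<Longrightarrow> D \<xi> \<noteq> 0 \<Longrightarrow> h (\<lambda>i. tensor_coord i \<xi>) = 0" by blast
  show ?thesis
  proof (intro bexI[of _ h] conjI h(1,2) ballI, clarify)
    fix A B lam x y
    assume X: "(A, B, lam, x, y) \<in> ?X" and "S \<inter> T \<noteq> {} \<longrightarrow> x q \<noteq> y q"
    then have "D (A, B, lam, x, y) \<noteq> 0" by (auto simp: D_def xf_def yf_def)
    from h(3)[OF X this] show "h (case_sum A B) = 0" by (simp add: tensor_coord_def)
  qed
qed

section \<open>From excluded configurations to uniqueness\<close>

definition unique_eigenvectors :: "nat \<Rightarrow> 'n::finite tensor \<Rightarrow> 'n tensor \<Rightarrow> bool" where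
  "unique_eigenvectors m A B \<longleftrightarrow> (\<forall>lam. cb_eigenvalue m A B lam \<longrightarrow>
      (\<exists>x. cb_eigenvector m A B lam x \<and>
        (\<forall>y. cb_eigenvector m A B lam y \<longrightarrow> (\<exists>c. c \<noteq> 0 \<and> y = c *s x))))"

lemma unique_eigenvectorsI:
  assumes "\<And>lam x y. cb_eigenvector m A B lam x \<Longrightarrow> cb_eigenvector m A B lam y \<Longrightarrow> \<exists>c. c \<noteq> 0 \<and> y = c *s x"
  shows "unique_eigenvectors m A B"
  using assms unfolding unique_eigenvectors_def cb_eigenvalue_def by blast

lemma generic_pair_if_nonvanishing:
  fixes Q :: "'n::finite tensor \<Rightarrow> 'n tensor \<Rightarrow> bool"
  assumes "h \<in> polyfun (index_tuples m <+> index_tuples m)" "h a \<noteq> 0"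
    and "\<And>A B. h (case_sum A B) \<noteq> 0 \<Longrightarrow> Q A B"
  shows "generic_pair m Q"
  unfolding generic_pair_def Let_def
  using zariski_dense_nonzero_locus[OF assms(1,2)] assms(3)
  by (intro exI[of _ "{w \<in> affine_space (index_tuples m <+> index_tuples m). h w \<noteq> 0}"]) simp

lemma tensor_apply_nth:
  "vec_nth (tensor_apply (Suc d) F x) i = (\<Sum>is\<in>index_tuples d. F (i # is) * prod_list (map (vec_nth x) is))"
  by (simp add: tensor_apply_def)

lemma eigen_eq_scale:
  assumes "eigen_eq d A B lam x i"
  shows "eigen_eq d A B lam (\<lambda>k. c * x k) i"
proof -
  have "prod_list (map (\<lambda>k. c * x k) is) = c ^ length is * prod_list (map x is)" for "is"
    by (induction "is") auto
  then have "(\<Sum>is\<in>index_tuples d. F (i # is) * prod_list (map (\<lambda>k. c * x k) is))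
      = c ^ d * (\<Sum>is\<in>index_tuples d. F (i # is) * prod_list (map x is))" for F :: "'a tensor"
    by (simp add: sum_distrib_left index_tuples_def mult.left_commute)
  then show ?thesis using assms by (simp add: eigen_eq_def)
qed

lemma cb_eigenvector_eigen_eq:
  fixes x :: "complex ^ 'n::finite"
  assumes "cb_eigenvector (Suc d) A B lam x" "vec_nth x i \<noteq> 0"
  shows "eigen_eq d A B lam (\<lambda>k. c * vec_nth x k) i"
  by (rule eigen_eq_scale) (use assms in \<open>auto simp: cb_eigenvector_iff eigen_eq_def tensor_apply_nth\<close>)

text \<open>In order 1 each index of a support satisfies \<open>A [i] = lam * B [i]\<close>, so two
  different indices make a 2 by 2 minor of the pair vanish. Where no minor vanishes, all
  eigenvectors for one eigenvalue live on the same single coordinate.\<close>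

lemma generic_unique_eigenvectors_order_one:
  "generic_pair 1 (unique_eigenvectors 1 :: 'n::finite tensor \<Rightarrow> _)"
proof -
  define I where "I = (index_tuples 1 :: 'n list set) <+> (index_tuples 1 :: 'n list set)"
  define S :: "('n \<times> 'n) set" where "S = {(i, j). i \<noteq> j}"
  define h where "h = (\<lambda>(i, j) (w :: 'n list + 'n list \<Rightarrow> complex).
    w (Inl [i]) * w (Inr [j]) - w (Inl [j]) * w (Inr [i]))"
  have mem: "Inl [i] \<in> I" "Inr [i] \<in> I" for i by (auto simp: I_def index_tuples_def)
  have pf: "h c \<in> polyfun I" for c
    unfolding h_def by (cases c) (auto intro!: polyfun_diff polyfun.mult polyfun.var mem)
  have "\<exists>a. (\<Prod>c\<in>S. h c a) \<noteq> 0"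
  proof (rule polyfun_prod_nonzero)
    show "finite S" by simp
    fix c assume "c \<in> S"
    then obtain i j where c: "c = (i, j)" "i \<noteq> j" by (auto simp: S_def)
    then have "h c (\<lambda>k. if k = Inl [i] \<or> k = Inr [j] then 1 else 0) \<noteq> 0" by (simp add: h_def)
    then show "\<exists>a. h c a \<noteq> 0" by blast
  qed (rule pf)
  then obtain a where a: "(\<Prod>c\<in>S. h c a) \<noteq> 0" by blast
  show ?thesis
  proof (rule generic_pair_if_nonvanishing[where h = "\<lambda>w. \<Prod>c\<in>S. h c w", OF _ a])
    show "(\<lambda>w. \<Prod>c\<in>S. h c w) \<in> polyfun (index_tuples 1 <+> index_tuples 1)"
      unfolding I_def[symmetric] by (intro polyfun_prod pf)
    fix A B :: "'n tensor" assume nz: "(\<Prod>c\<in>S. h c (case_sum A B)) \<noteq> 0"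
    have apply1: "vec_nth (tensor_apply 1 F x) i = F [i]" for F :: "'n tensor" and x i
    proof -
      have "index_tuples 0 = {[] :: 'n list}" by (auto simp: index_tuples_def)
      then show ?thesis by (simp add: tensor_apply_def)
    qed
    show "unique_eigenvectors 1 A B"
    proof (rule unique_eigenvectorsI)
      fix lam x y assume ev: "cb_eigenvector 1 A B lam x" "cb_eigenvector 1 A B lam y"
      have same: "i = j" if "vec_nth x i \<noteq> 0" "vec_nth y j \<noteq> 0" for i j
      proof (rule ccontr)
        assume "i \<noteq> j"
        then have "h (i, j) (case_sum A B) \<noteq> 0" using nz by (auto simp: S_def)
        moreover have "A [i] = lam * B [i]" "A [j] = lam * B [j]"
          using ev that unfolding cb_eigenvector_iff apply1 by auto
        ultimately show False by (simp add: h_def)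
      qed
      obtain i where i: "vec_nth x i \<noteq> 0" using ev(1) by (auto simp: cb_eigenvector_iff Finite_Cartesian_Product.vec_eq_iff)
      obtain j where j: "vec_nth y j \<noteq> 0" using ev(2) by (auto simp: cb_eigenvector_iff Finite_Cartesian_Product.vec_eq_iff)
      have "i = j" using same i j by blast
      have zero: "vec_nth x k = 0 \<and> vec_nth y k = 0" if "k \<noteq> i" for k
        using that same[of k j] same[of i k] i j \<open>i = j\<close> by auto
      have "vec_nth y k = vec_nth y i / vec_nth x i * vec_nth x k" for k
      proof (cases "k = i")
        case False
        from zero[OF this] show ?thesis by simp
      qed (use i in simp)
      then have "y = (vec_nth y i / vec_nth x i) *s x"
        unfolding Finite_Cartesian_Product.vec_eq_iff vector_smult_component by blast
      moreover have "vec_nth y i / vec_nth x i \<noteq> 0" using i j \<open>i = j\<close> by simp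
      ultimately show "\<exists>c. c \<noteq> 0 \<and> y = c *s x" by blast
    qed
  qed
qed

lemma generic_unique_eigenvectors:
  assumes d: "d \<ge> 1"
  shows "generic_pair (Suc d) (unique_eigenvectors (Suc d) :: 'n::finite tensor \<Rightarrow> _)"
proof -
  define I where "I = (index_tuples (Suc d) :: 'n list set) <+> (index_tuples (Suc d) :: 'n list set)"
  \<comment> \<open>The combinatorial types: supports, normalising coordinates and, if the supports
    meet, a coordinate \<open>q\<close> at which the vectors differ. There are finitely many, so the
    product of their polynomials is one nonzero condition.\<close>
  define \<C> :: "('n set \<times> 'n set \<times> 'n \<times> 'n \<times> 'n) set" where "\<C> = {(S, T, p, r, q).
    p \<in> S \<and> r \<in> T \<and> (S \<inter> T \<noteq> {} \<longrightarrow> p = r \<and> q \<noteq> p)}"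
  have "\<forall>c\<in>\<C>. \<exists>h. h \<in> polyfun I \<and> (\<exists>a. h a \<noteq> 0) \<and> (case c of (S, T, p, r, q) \<Rightarrow>
    (\<forall>(A, B, lam, x, y)\<in>bad_configs d S T p r. (S \<inter> T \<noteq> {} \<longrightarrow> x q \<noteq> y q) \<longrightarrow> h (case_sum A B) = 0))"
  proof
    fix c assume "c \<in> \<C>"
    then obtain S T p r q where c: "c = (S, T, p, r, q)"
      and *: "p \<in> S" "r \<in> T" "S \<inter> T \<noteq> {} \<Longrightarrow> p = r \<and> q \<noteq> p" by (auto simp: \<C>_def)
    from bad_configs_dependence[OF d *] show "\<exists>h. h \<in> polyfun I \<and> (\<exists>a. h a \<noteq> 0) \<and> (case c of (S, T, p, r, q) \<Rightarrow>
      (\<forall>(A, B, lam, x, y)\<in>bad_configs d S T p r. (S \<inter> T \<noteq> {} \<longrightarrow> x q \<noteq> y q) \<longrightarrow> h (case_sum A B) = 0))"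
      unfolding I_def c prod.case by blast
  qed
  from bchoice[OF this] obtain h where h: "\<And>c. c \<in> \<C> \<Longrightarrow> h c \<in> polyfun I" "\<And>c. c \<in> \<C> \<Longrightarrow> \<exists>a. h c a \<noteq> 0"
    "\<And>S T p r q A B lam x y. (S, T, p, r, q) \<in> \<C> \<Longrightarrow> (A, B, lam, x, y) \<in> bad_configs d S T p r \<Longrightarrow>
      (S \<inter> T \<noteq> {} \<Longrightarrow> x q \<noteq> y q) \<Longrightarrow> h (S, T, p, r, q) (case_sum A B) = 0"
    by fast
  have fin: "finite \<C>" by simp
  have "\<exists>a. (\<Prod>c\<in>\<C>. h c a) \<noteq> 0"
    by (rule polyfun_prod_nonzero[where V = I]) (fact fin, rule h(1), assumption, rule h(2))
  then obtain a where a: "(\<Prod>c\<in>\<C>. h c a) \<noteq> 0" by blast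
  show ?thesis
  proof (rule generic_pair_if_nonvanishing[where h = "\<lambda>w. \<Prod>c\<in>\<C>. h c w", OF _ a])
    show "(\<lambda>w. \<Prod>c\<in>\<C>. h c w) \<in> polyfun (index_tuples (Suc d) <+> index_tuples (Suc d))"
      unfolding I_def[symmetric] by (intro polyfun_prod h(1))
    fix A B :: "'n tensor" assume "(\<Prod>c\<in>\<C>. h c (case_sum A B)) \<noteq> 0"
    then have nz: "h c (case_sum A B) \<noteq> 0" if "c \<in> \<C>" for c using that fin by auto
    show "unique_eigenvectors (Suc d) A B"
    proof (rule unique_eigenvectorsI, rule ccontr)
      fix lam x y assume ev: "cb_eigenvector (Suc d) A B lam x" "cb_eigenvector (Suc d) A B lam y"
        and no: "\<nexists>c. c \<noteq> 0 \<and> y = c *s x"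
      define S where "S = {i. vec_nth x i \<noteq> 0}"
      define T where "T = {i. vec_nth y i \<noteq> 0}"
      define x' where "x' p = (\<lambda>k. 1 / vec_nth x p * vec_nth x k)" for p
      define y' where "y' r = (\<lambda>k. 1 / vec_nth y r * vec_nth y k)" for r
      have bad: "(A, B, lam, x' p, y' r) \<in> bad_configs d S T p r" if "p \<in> S" "r \<in> T" for p r
      proof -
        have "eigen_eq d A B lam (x' p) i" if "i \<in> S" for i
          unfolding x'_def using that by (intro cb_eigenvector_eigen_eq[OF ev(1)]) (simp add: S_def)
        moreover have "eigen_eq d A B lam (y' r) i" if "i \<in> T" for i
          unfolding y'_def using that by (intro cb_eigenvector_eigen_eq[OF ev(2)]) (simp add: T_def)
        moreover have "x' p i = 0" if "i \<notin> S" for i using that by (simp add: x'_def S_def)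
        moreover have "y' r i = 0" if "i \<notin> T" for i using that by (simp add: y'_def T_def)
        moreover have "x' p p = 1" "y' r r = 1" using that by (simp_all add: x'_def y'_def S_def T_def)
        ultimately show ?thesis by (simp add: bad_configs_def)
      qed
      show False
      proof (cases "S \<inter> T = {}")
        case True
        obtain p where p: "p \<in> S" using ev(1) by (auto simp: cb_eigenvector_iff Finite_Cartesian_Product.vec_eq_iff S_def)
        obtain r where r: "r \<in> T" using ev(2) by (auto simp: cb_eigenvector_iff Finite_Cartesian_Product.vec_eq_iff T_def)
        \<comment> \<open>Disjoint supports put no condition on \<open>q\<close>; \<open>p\<close>
          serves as its value.\<close>
        have c: "(S, T, p, r, p) \<in> \<C>" using p r True by (simp add: \<C>_def)
        from h(3)[OF c bad[OF p r]] nz[OF c] True show False by simp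
      next
        case False
        then obtain p where p: "p \<in> S" "p \<in> T" by blast
        have "\<exists>q. x' p q \<noteq> y' p q"
        proof (rule ccontr)
          assume "\<not> ?thesis"
          then have "x' p k = y' p k" for k by simp
          then have "y = (vec_nth y p / vec_nth x p) *s x"
            using p by (auto simp: Finite_Cartesian_Product.vec_eq_iff x'_def y'_def S_def T_def field_simps)
          moreover have "vec_nth y p / vec_nth x p \<noteq> 0" using p by (simp add: S_def T_def)
          ultimately show False using no by blast
        qed
        then obtain q where q: "x' p q \<noteq> y' p q" by blast
        \<comment> \<open>Both normalised vectors have the entry 1 at \<open>p\<close>.\<close>
        have "q \<noteq> p" using q p by (auto simp: x'_def y'_def S_def T_def)
        then have c: "(S, T, p, p, q) \<in> \<C>" using p by (simp add: \<C>_def)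
        from h(3)[OF c bad[OF p(1,2)] q] nz[OF c] show False by simp
      qed
    qed
  qed
qed

theorem theorem3p3:
  fixes m :: nat
  assumes "m \<ge> 1"
  shows
    "(\<forall>A \<in> (tensors m :: 'n::finite tensor set). \<forall>B \<in> (tensors m :: 'n tensor set).
        (\<forall>J. J \<noteq> {} \<longrightarrow> R_sub m J B \<noteq> 0) \<longrightarrow>
          finite {lam. cb_eigenvalue m A B lam} \<and>
          card {lam. cb_eigenvalue m A B lam} \<le> CARD('n) * m ^ (CARD('n) - 1)) \<and>
     generic_pair m (\<lambda>(A :: 'n tensor) B.
        \<forall>lam. cb_eigenvalue m A B lam \<longrightarrow>
          (\<exists>x. cb_eigenvector m A B lam x \<and>
             (\<forall>y. cb_eigenvector m A B lam y \<longrightarrow> (\<exists>c. c \<noteq> 0 \<and> y = c *s x))))"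
proof (rule conjI)
  show "\<forall>A \<in> (tensors m :: 'n tensor set). \<forall>B \<in> (tensors m :: 'n tensor set).
        (\<forall>J. J \<noteq> {} \<longrightarrow> R_sub m J B \<noteq> 0) \<longrightarrow>
          finite {lam. cb_eigenvalue m A B lam} \<and>
          card {lam. cb_eigenvalue m A B lam} \<le> CARD('n) * m ^ (CARD('n) - 1)"
    using cb_eigenvalue_count[OF assms] by blast
  have "generic_pair m (unique_eigenvectors m :: 'n tensor \<Rightarrow> _)"
  proof (cases "m = 1")
    case True
    then show ?thesis using generic_unique_eigenvectors_order_one by simp
  next
    case False
    with assms have "m = Suc (m - 1)" "m - 1 \<ge> 1" by auto
    then show ?thesis using generic_unique_eigenvectors[of "m - 1"] by simp
  qed
  then show "generic_pair m (\<lambda>(A :: 'n tensor) B.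
        \<forall>lam. cb_eigenvalue m A B lam \<longrightarrow>
          (\<exists>x. cb_eigenvector m A B lam x \<and>
             (\<forall>y. cb_eigenvector m A B lam y \<longrightarrow> (\<exists>c. c \<noteq> 0 \<and> y = c *s x))))"
    unfolding unique_eigenvectors_def[abs_def] .
qed

end
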